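(* Let $\Phi(u)=\frac12\|P^+u\|^2-\frac12\|P^-u\|^2+\Psi(u)$, where $\Psi\in C^1(X,\mathbb{R})$ is even, bounded below and weakly sequentially lower semicontinuous, and $\Psi'$ is weakly sequentially continuous. Suppose there is $k_0$ such that for every $k\ge k_0$ there exist $\rho_k>r_k>0$ with (B1) $a^k:=\inf_{u\in X_k^+,\ \|u\|=\rho_k}\Phi(u)>\max\big(0,\sup_{u\in X,\ \|u\|\le r_k}\Phi(u)\big)$ and $b^k:=\sup_{u\in X_k^-,\ \|u\|=r_k}\Phi(u)<0$; (B2) $d^k:=\inf_{u\in X_k^+,\ \|u\|\le\rho_k}\Phi(u)\to0$ as $k\to\infty$. Then for every $k\ge k_0$ there exist $c^k\in[d^k,0)$ and a sequence $(u_k^n)_n\subset X$ such that $\Phi(u_k^n)\to c^k$ and $(1+\|u_k^n\|)\Phi'(u_k^n)\to0$ as $n\to\infty$. Moreover, if $\Phi$ satisfies the Cerami condition $(Ce)_c$ for every $c\in[d^{k_0},0)$, then $\Phi$ has a sequence $(u_k)$ of critical points with $\Phi(u_k)\to0^-$ as $k\to\infty$.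
   Context: $X$ is a separable Hilbert space with norm $\|\cdot\|$, $X=X^-\oplus X^+$ with $X^-$ closed and $X^+=(X^-)^\perp$, and $P^\pm:X\to X^\pm$ are the orthogonal projections. Fix an orthonormal basis $(e_j)_{j\ge0}$ of $X^+$ and set $X_k^-:=X^-\oplus\bigoplus_{j=0}^k\mathbb{R}e_j$ and $X_k^+:=\overline{\bigoplus_{j=k}^\infty\mathbb{R}e_j}$. Cerami condition $(Ce)_c$: every sequence $(u_n)\subset X$ with $\Phi(u_n)\to c$ and $(1+\|u_n\|)\Phi'(u_n)\to0$ has a convergent subsequence. *)

theory Defs
  imports "HOL-Analysis.Analysis" "HOL-Library.Extended_Real"
begin

definition orth_compl :: "'a::real_inner set \<Rightarrow> 'a set" where
  "orth_compl S = {x. \<forall>y\<in>S. x \<bullet> y = 0}"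

definition proj_minus :: "'a::real_inner set \<Rightarrow> 'a \<Rightarrow> 'a" where
  "proj_minus Xm u = (THE v. v \<in> Xm \<and> u - v \<in> orth_compl Xm)"

definition proj_plus :: "'a::real_inner set \<Rightarrow> 'a \<Rightarrow> 'a" where
  "proj_plus Xm u = u - proj_minus Xm u"

definition Xk_minus :: "'a::real_inner set \<Rightarrow> (nat \<Rightarrow> 'a) \<Rightarrow> nat \<Rightarrow> 'a set" where
  "Xk_minus Xm e k = {x + y | x y. x \<in> Xm \<and> y \<in> span (e ` {..k})}"

definition Xk_plus :: "(nat \<Rightarrow> 'a::real_inner) \<Rightarrow> nat \<Rightarrow> 'a set" where
  "Xk_plus e k = closure (span (e ` {k..}))"

definition Phi_fun :: "'a::real_inner set \<Rightarrow> ('a \<Rightarrow> real) \<Rightarrow> 'a \<Rightarrow> real" where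
  "Phi_fun Xm Psi u = (1/2) * (norm (proj_plus Xm u))\<^sup>2 - (1/2) * (norm (proj_minus Xm u))\<^sup>2 + Psi u"

definition weak_conv :: "(nat \<Rightarrow> 'a::real_inner) \<Rightarrow> 'a \<Rightarrow> bool" where
  "weak_conv x u \<longleftrightarrow> (\<forall>y. (\<lambda>n. x n \<bullet> y) \<longlonglongrightarrow> u \<bullet> y)"

definition weak_conv_dual :: "(nat \<Rightarrow> ('a::real_normed_vector \<Rightarrow>\<^sub>L real)) \<Rightarrow> ('a \<Rightarrow>\<^sub>L real) \<Rightarrow> bool" where
  "weak_conv_dual f g \<longleftrightarrow> (\<forall>h. (\<lambda>n. blinfun_apply (f n) h) \<longlonglongrightarrow> blinfun_apply g h)"

definition cerami :: "('a::real_normed_vector \<Rightarrow> real) \<Rightarrow> ('a \<Rightarrow> ('a \<Rightarrow>\<^sub>L real)) \<Rightarrow> real \<Rightarrow> bool" where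
  "cerami F F' c \<longleftrightarrow> (\<forall>u::nat \<Rightarrow> 'a.
      ((\<lambda>n. F (u n)) \<longlonglongrightarrow> c) \<and> ((\<lambda>n. (1 + norm (u n)) *\<^sub>R F' (u n)) \<longlonglongrightarrow> 0)
      \<longrightarrow> (\<exists>s. strict_mono s \<and> convergent (u \<circ> s)))"

end

theory Submission
  imports Defs "HOL-Library.Z2"
begin

text \<open>
  Fix \<open>k\<close>, let \<open>B\<close> be the ball of radius \<open>\<rho>\<^sub>k\<close> in \<open>X\<^sub>k\<^sup>+\<close> and consider the odd maps \<open>\<kappa> : X \<rightarrow> X\<close>, bounded,
  continuous, and weak-to-strong continuous on \<open>B\<close>, for which \<open>\<Phi>(u + \<kappa> u)\<close> is bounded below by a
  suitable constant on the sphere of radius \<open>\<rho>\<^sub>k\<close>. The level is \<open>c\<^sup>k = sup\<^sub>\<kappa> min\<^sub>u\<^sub>\<in>\<^sub>B \<Phi>(u + \<kappa> u)\<close>. Taking \<open>\<kappa> = 0\<close> gives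
  \<open>c\<^sup>k \<ge> d\<^sup>k\<close>. A Borsuk-type theorem, proved by a parity argument on triangulations, shows that every
  graph \<open>{u + \<kappa> u}\<close> meets the sphere of radius \<open>r\<^sub>k\<close> in \<open>X\<^sub>k\<^sup>-\<close>, whence \<open>c\<^sup>k \<le> b\<^sup>k < 0\<close>. The admissible maps form
  a complete metric space, on which Ekeland's principle yields almost optimal \<open>\<kappa>\<close>; if no lowest point of
  the graph were almost critical, adding a small multiple of a pseudogradient would raise the whole
  graph. Since Ekeland's principle controls the distance to the starting
  map, the derivative is small even after multiplication by \<open>1 + \<parallel>u\<parallel>\<close>.
\<close>

section \<open>A Borsuk theorem for symmetric neighbourhoods of the origin\<close>

text \<open>The quadratic form is strongly indefinite and \<open>B\<close> is infinite-dimensional,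
  so neither norm compactness nor Brouwer degree applies directly. Two features compensate. Over
  X_k^+ the negative part of the form sees only the strongly convergent values of \<kappa>, so
  \<Phi> is weakly lower semicontinuous along graphs and minima exist. And \<Phi>' is weakly
  continuous, so finitely many test directions describe the slope near the bottom of a graph; a
  pseudogradient built from them is again odd and weak-to-strong continuous. The intersection comes
  from the line through e_k, the common part of X_k^+ and X_k^-: a finite section of X_k^+ has p + 1
  coordinates against p odd orthogonality equations, and their common zeros must reach the boundary
  of a symmetric neighbourhood of the origin. The bound imposed on the sphere is a number strictly
  between the two sides of (B1). It keeps the graph over that sphere outside the ball of radius r_k,
  so the boundary that is reached is the one where the graph has norm r_k.\<close>

lemma bit_sum_involution:
  fixes f :: "'a \<Rightarrow> bit"
  assumes "finite S" "\<And>x. x \<in> S \<Longrightarrow> i x \<in> S" "\<And>x. x \<in> S \<Longrightarrow> i (i x) = x"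
    "\<And>x. x \<in> S \<Longrightarrow> i x \<noteq> x" "\<And>x. x \<in> S \<Longrightarrow> f (i x) = f x"
  shows "sum f S = 0"
  using assms
proof (induction "card S" arbitrary: S rule: less_induct)
  case less
  show ?case
  proof (cases "S = {}")
    case False
    then obtain x where x: "x \<in> S" by blast
    have ix: "i x \<in> S" "i x \<noteq> x" "f (i x) = f x" "i (i x) = x" using less.prems x by auto
    let ?T = "S - {x, i x}"
    have "sum f ?T = 0"
    proof (rule less.hyps)
      show "card ?T < card S" using x less.prems(1) by (intro psubset_card_mono) auto
      show "finite ?T" using less.prems(1) by simp
      fix y assume y: "y \<in> ?T"
      show "i y \<in> ?T" using y ix less.prems x by (metis DiffD1 DiffD2 DiffI empty_iff insert_iff)
      show "i (i y) = y" "i y \<noteq> y" "f (i y) = f y" using y less.prems by auto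
    qed
    moreover have "sum f S = sum f ?T + sum f {x, i x}"
      by (rule sum.subset_diff) (use x ix less.prems(1) in auto)
    moreover have "sum f {x, i x} = 0"
      using ix by simp
    ultimately show ?thesis by simp
  qed simp
qed

lemma bit_of_nat_card_involution:
  assumes "finite S" "\<And>x. x \<in> S \<Longrightarrow> i x \<in> S" "\<And>x. x \<in> S \<Longrightarrow> i (i x) = x"
    "\<And>x. x \<in> S \<Longrightarrow> i x \<noteq> x"
  shows "(of_nat (card S) :: bit) = 0"
  using bit_sum_involution[OF assms, of "\<lambda>_. 1"] by simp

text \<open>The boundary of a boundary vanishes modulo two: the ordered pairs (v, u) and (u, v)
  remove the same two vertices and cancel.\<close>

lemma bit_sum_remove_twice:
  fixes F :: "'a set \<Rightarrow> bit"
  assumes "finite S"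
  shows "(\<Sum>v\<in>S. \<Sum>u\<in>S - {v}. F (S - {v} - {u})) = 0"
proof -
  have "(\<Sum>v\<in>S. \<Sum>u\<in>S - {v}. F (S - {v} - {u}))
      = (\<Sum>(v, u)\<in>(SIGMA v:S. S - {v}). F (S - {v} - {u}))"
    using assms by (subst sum.Sigma) auto
  also have "\<dots> = 0"
  proof (rule bit_sum_involution[where i = prod.swap])
    show "finite (SIGMA v:S. S - {v})" using assms by blast
    fix p assume p: "p \<in> (SIGMA v:S. S - {v})"
    show "prod.swap p \<in> (SIGMA v:S. S - {v})" "prod.swap (prod.swap p) = p" "prod.swap p \<noteq> p"
      using p by auto
    have "S - {x} - {y} = S - {y} - {x}" for x y by blast
    then show "(case prod.swap p of (v, u) \<Rightarrow> F (S - {v} - {u})) = (case p of (v, u) \<Rightarrow> F (S - {v} - {u}))"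
      by (cases p) simp
  qed
  finally show ?thesis .
qed

text \<open>The signs of the elements of \<open>T\<close>, listed in the order of \<open>key\<close>, alternate and start with \<open>s\<close>.\<close>

definition alternating :: "('v \<Rightarrow> int) \<Rightarrow> ('v \<Rightarrow> bool) \<Rightarrow> bool \<Rightarrow> 'v set \<Rightarrow> bool" where
  "alternating key pos s T \<longleftrightarrow> (\<forall>x\<in>T. pos x \<longleftrightarrow> (even (card {y\<in>T. key y < key x}) \<longleftrightarrow> s))"

lemma alternating_empty [simp]: "alternating key pos s {}"
  by (simp add: alternating_def)

lemma alternating_insert_top:
  assumes "finite T" "\<And>y. y \<in> T \<Longrightarrow> key y < key m"
  shows "alternating key pos s (insert m T)
     \<longleftrightarrow> alternating key pos s T \<and> (pos m \<longleftrightarrow> (even (card T) \<longleftrightarrow> s))"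
proof -
  have "{y \<in> insert m T. key y < key x} = {y \<in> T. key y < key x}" if "x \<in> T" for x
    using assms(2)[OF that] by auto
  moreover have "{y \<in> insert m T. key y < key m} = T"
    using assms(2) by auto
  ultimately show ?thesis by (auto simp: alternating_def)
qed

text \<open>Induction on the vertex \<open>m\<close> of largest key. Removing \<open>m\<close>
  leaves \<open>T\<close>; removing any other vertex keeps \<open>m\<close> on top but flips the
  parity of its position, so the remaining sum is the induction hypothesis times the condition on
  the sign of \<open>m\<close>. The right-hand side does not depend on \<open>s\<close>, which lets
  one count of positive patterns control both patterns.\<close>

lemma alternating_coboundary:
  assumes "finite T" "T \<noteq> {}" "inj_on key T"
  shows "(\<Sum>v\<in>T. (of_bool (alternating key pos s (T - {v})) :: bit))
     = of_bool (alternating key pos True T) + of_bool (alternating key pos False T)"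
  using assms
proof (induction T rule: finite_ranking_induct[where f = key])
  case empty
  then show ?case by simp
next
  case (insert m T)
  show ?case
  proof (cases "m \<in> T")
    case True
    then show ?thesis using insert by (auto simp: insert_absorb)
  next
    case m: False
    have less: "key y < key m" if "y \<in> T" for y
      using insert.hyps(2)[OF that] insert.prems m that
      by (metis inj_onD insertI1 insertI2 order_le_less)
    show ?thesis
    proof (cases "T = {}")
      case True
      then show ?thesis by (auto simp: alternating_def)
    next
      case False
      let ?a = "\<lambda>s T. (of_bool (alternating key pos s T) :: bit)"
      have IH: "(\<Sum>v\<in>T. ?a s (T - {v})) = ?a True T + ?a False T"
        using insert False by (auto simp: inj_on_def)
      have ins: "alternating key pos s (insert m T - {v})
         \<longleftrightarrow> alternating key pos s (T - {v}) \<and> (pos m \<longleftrightarrow> (odd (card T) \<longleftrightarrow> s))" if "v \<in> T" for v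
      proof -
        have "insert m T - {v} = insert m (T - {v})" using that m by blast
        moreover have "even (card (T - {v})) \<longleftrightarrow> odd (card T)"
          using that insert.hyps(1) by (simp add: card_Diff_singleton card_gt_0_iff)
             (metis Suc_pred card_gt_0_iff empty_iff even_Suc)
        ultimately show ?thesis
          using alternating_insert_top[of "T - {v}" key m pos s] less insert.hyps(1) by auto
      qed
      have "(\<Sum>v\<in>insert m T. ?a s (insert m T - {v}))
          = ?a s T + (\<Sum>v\<in>T. ?a s (insert m T - {v}))"
        using m insert.hyps(1) by (simp del: sum_of_bool_eq)
      also have "(\<Sum>v\<in>T. ?a s (insert m T - {v}))
          = of_bool (pos m \<longleftrightarrow> (odd (card T) \<longleftrightarrow> s)) * (\<Sum>v\<in>T. ?a s (T - {v}))"
        unfolding sum_distrib_left by (intro sum.cong refl) (simp only: ins of_bool_conj mult.commute)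
      also have "\<dots> = of_bool (pos m \<longleftrightarrow> (odd (card T) \<longleftrightarrow> s)) * (?a True T + ?a False T)"
        by (simp only: IH)
      finally show ?thesis
        using alternating_insert_top[of T key m pos True] alternating_insert_top[of T key m pos False]
          less insert.hyps(1)
        by (cases s; cases "pos m"; cases "odd (card T)") (simp_all)
    qed
  qed
qed

text \<open>Two vertices share an absolute label. Since \<open>key\<close> sorts by absolute label
  first, everything between them shares it too, and the exclusion of complementary labels gives
  neighbours in the order equal signs.\<close>

lemma not_alternating_pigeonhole:
  fixes lab :: "'v \<Rightarrow> int"
  assumes "finite T" and inj: "inj_on key T" and card: "p < card T"
    and lab: "\<And>x. x \<in> T \<Longrightarrow> 1 \<le> \<bar>lab x\<bar> \<and> \<bar>lab x\<bar> \<le> int p"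
    and key: "\<And>x y. x \<in> T \<Longrightarrow> y \<in> T \<Longrightarrow> \<bar>lab x\<bar> < \<bar>lab y\<bar> \<Longrightarrow> key x < key y"
    and noncompl: "\<And>x y. x \<in> T \<Longrightarrow> y \<in> T \<Longrightarrow> lab x \<noteq> - lab y"
  shows "\<not> alternating key (\<lambda>x. 0 < lab x) s T"
proof
  assume alt: "alternating key (\<lambda>x. 0 < lab x) s T"
  have "\<not> inj_on (\<lambda>x. \<bar>lab x\<bar>) T"
  proof
    assume i: "inj_on (\<lambda>x. \<bar>lab x\<bar>) T"
    have "card T \<le> card {1..int p}"
      by (rule card_inj_on_le[OF i]) (use lab in auto)
    then show False using card by simp
  qed
  then obtain x0 y0 where "x0 \<in> T" "y0 \<in> T" "\<bar>lab x0\<bar> = \<bar>lab y0\<bar>" "x0 \<noteq> y0"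
    by (auto simp: inj_on_def)
  moreover from this have "key x0 \<noteq> key y0" using inj by (auto simp: inj_on_def)
  ultimately obtain x y where xy: "x \<in> T" "y \<in> T" "\<bar>lab x\<bar> = \<bar>lab y\<bar>" "key x < key y"
    by (metis linorder_neqE)
  \<comment> \<open>The minimum \<open>z\<close> of this set is the immediate successor of
    \<open>x\<close>; the ranks of \<open>x\<close> and \<open>z\<close> differ by one, so
    alternation would require opposite signs.\<close>
  let ?Z = "{z\<in>T. key x < key z}"
  have "finite ?Z" "?Z \<noteq> {}" using assms(1) xy by auto
  then obtain z where z: "z \<in> ?Z" and zmin: "\<And>w. w \<in> ?Z \<Longrightarrow> key z \<le> key w"
    using ex_is_arg_min_if_finite[of ?Z key] by (metis is_arg_min_linorder)
  have zT: "z \<in> T" "key x < key z" "key z \<le> key y" using z zmin xy by auto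
  have "\<bar>lab z\<bar> = \<bar>lab x\<bar>"
    using key[of z x] key[of y z] zT xy by force
  then have "lab z = lab x" using noncompl[of z x] zT(1) xy(1) by linarith
  moreover have "{w\<in>T. key w < key z} = insert x {w\<in>T. key w < key x}"
  proof -
    have "w = x \<or> key w < key x" if "w \<in> T" "key w < key z" for w
      using zmin[of w] that inj xy(1) by (force simp: inj_on_def)
    then show ?thesis using zT xy(1) by auto
  qed
  then have "card {w\<in>T. key w < key z} = Suc (card {w\<in>T. key w < key x})"
    using assms(1) by simp
  ultimately show False
    using alt[unfolded alternating_def, rule_format, OF zT(1)]
      alt[unfolded alternating_def, rule_format, OF xy(1)] by (cases s) auto
qed

section \<open>The Freudenthal--Kuhn triangulation\<close>

text \<open>The lattices of all dimensions live in one type of integer sequences, so that a simplex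
  of dimension j can serve as a face of one of dimension j + 1 without any embedding.\<close>

definition coord_space :: "nat \<Rightarrow> (nat \<Rightarrow> int) set" where
  "coord_space d = {x. \<forall>i\<ge>d. x i = 0}"

definition kuhn_le :: "(nat \<Rightarrow> int) \<Rightarrow> (nat \<Rightarrow> int) \<Rightarrow> bool" where
  "kuhn_le x y \<longleftrightarrow> (\<forall>i. x i \<le> y i \<and> y i \<le> x i + 1)"

definition adjacent :: "(nat \<Rightarrow> int) \<Rightarrow> (nat \<Rightarrow> int) \<Rightarrow> bool" where
  "adjacent x y \<longleftrightarrow> kuhn_le x y \<or> kuhn_le y x"

text \<open>The simplices of the Freudenthal--Kuhn triangulation, given by their vertices.\<close>

definition kuhn_simplex :: "(nat \<Rightarrow> int) set \<Rightarrow> bool" where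
  "kuhn_simplex S \<longleftrightarrow> finite S \<and> (\<forall>x\<in>S. \<forall>y\<in>S. adjacent x y)"

definition height :: "nat \<Rightarrow> (nat \<Rightarrow> int) \<Rightarrow> int" where
  "height d x = (\<Sum>i<d. x i)"

lemma adjacent_refl [simp]: "adjacent x x"
  by (simp add: adjacent_def kuhn_le_def)

lemma adjacent_sym: "adjacent x y \<longleftrightarrow> adjacent y x"
  by (auto simp: adjacent_def)

lemma adjacent_uminus [simp]: "adjacent (- x) (- y) \<longleftrightarrow> adjacent x y"
proof -
  have "kuhn_le (- x) (- y) \<longleftrightarrow> kuhn_le y x" for x y
    unfolding kuhn_le_def by (rule iff_allI) auto
  then show ?thesis by (auto simp: adjacent_def)
qed

lemma kuhn_simplex_insert:
  "kuhn_simplex (insert v S) \<longleftrightarrow> kuhn_simplex S \<and> (\<forall>z\<in>S. adjacent v z)"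
  by (auto simp: kuhn_simplex_def adjacent_sym)

lemma kuhn_simplex_mono: "kuhn_simplex S \<Longrightarrow> T \<subseteq> S \<Longrightarrow> kuhn_simplex T"
  by (auto simp: kuhn_simplex_def intro: finite_subset)

lemma kuhn_simplex_uminus [simp]: "kuhn_simplex (uminus ` S) \<longleftrightarrow> kuhn_simplex S"
proof -
  have "inj_on (uminus :: (nat \<Rightarrow> int) \<Rightarrow> _) S"
    by (auto simp: inj_on_def fun_eq_iff)
  then show ?thesis by (auto simp: kuhn_simplex_def finite_image_iff)
qed

lemma uminus_coord_space [simp]: "- x \<in> coord_space d \<longleftrightarrow> x \<in> coord_space d"
  by (auto simp: coord_space_def)

lemma height_kuhn_le:
  assumes "kuhn_le x y"
  shows "height d x \<le> height d y" "height d y \<le> height d x + int d"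
proof -
  show "height d x \<le> height d y"
    unfolding height_def using assms by (intro sum_mono) (auto simp: kuhn_le_def)
  have "height d y \<le> (\<Sum>i<d. x i + 1)"
    unfolding height_def using assms by (intro sum_mono) (auto simp: kuhn_le_def)
  then show "height d y \<le> height d x + int d"
    by (simp add: height_def sum.distrib)
qed

lemma height_eq_imp_eq:
  assumes "kuhn_le x y" "x \<in> coord_space d" "y \<in> coord_space d" "height d x = height d y"
  shows "x = y"
proof
  fix i
  have "x i = y i" if "i < d"
  proof (rule ccontr)
    assume "x i \<noteq> y i"
    then have "x i < y i" using assms(1) by (auto simp: kuhn_le_def order_less_le)
    then have "height d x < height d y"
      unfolding height_def
      using assms(1) that by (intro sum_strict_mono_ex1) (auto simp: kuhn_le_def)
    then show False using assms(4) by simp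
  qed
  then show "x i = y i"
    using assms(2,3) by (cases "i < d") (auto simp: coord_space_def)
qed

lemma kuhn_le_if_height_less:
  assumes "adjacent x y" "height d x < height d y"
  shows "kuhn_le x y"
  using assms height_kuhn_le(1)[of y x d] by (auto simp: adjacent_def)

lemma inj_on_height:
  assumes "kuhn_simplex S" "S \<subseteq> coord_space d"
  shows "inj_on (height d) S"
  using assms height_eq_imp_eq by (fastforce simp: inj_on_def kuhn_simplex_def adjacent_def)

text \<open>Pairwise adjacency is enough for a chain: adjacent points of different heights are
  comparable in the direction of the heights, so the vertex of least height lies below all
  others.\<close>

lemma kuhn_simplex_bottom:
  assumes "kuhn_simplex S" "S \<subseteq> coord_space d" "S \<noteq> {}"
  obtains b where "b \<in> S" "\<And>x. x \<in> S \<Longrightarrow> kuhn_le b x"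
proof -
  obtain b where b: "b \<in> S" "\<And>x. x \<in> S \<Longrightarrow> height d b \<le> height d x"
    using ex_is_arg_min_if_finite[of S "height d"] assms
    by (metis is_arg_min_linorder kuhn_simplex_def)
  have "kuhn_le b x" if "x \<in> S" for x
  proof (cases "x = b")
    case False
    then have "height d b \<noteq> height d x"
      using inj_on_height[OF assms(1,2)] b(1) that by (auto simp: inj_on_def)
    then show ?thesis
      using b(1) b(2)[OF that] kuhn_le_if_height_less[of b x d] assms(1) that
      unfolding kuhn_simplex_def by (meson order_less_le)
  qed (simp add: kuhn_le_def)
  then show thesis using b(1) that by metis
qed

lemma kuhn_simplex_top:
  assumes "kuhn_simplex S" "S \<subseteq> coord_space d" "S \<noteq> {}"
  obtains t where "t \<in> S" "\<And>x. x \<in> S \<Longrightarrow> kuhn_le x t"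
proof -
  obtain b where b: "b \<in> uminus ` S" "\<And>x. x \<in> uminus ` S \<Longrightarrow> kuhn_le b x"
  proof (rule kuhn_simplex_bottom[of "uminus ` S" d])
    show "kuhn_simplex (uminus ` S)" "uminus ` S \<subseteq> coord_space d" "uminus ` S \<noteq> {}"
      using assms by auto
  qed blast
  obtain t where t: "t \<in> S" "b = - t" using b(1) by auto
  have "kuhn_le x t" if "x \<in> S" for x
  proof -
    have "kuhn_le (- t) (- x)" using b(2) that t by auto
    then show ?thesis unfolding kuhn_le_def by (simp add: algebra_simps)
  qed
  then show thesis using t(1) that by metis
qed

lemma card_kuhn_simplex_le:
  assumes "kuhn_simplex S" "S \<subseteq> coord_space d"
  shows "card S \<le> Suc d"
proof (cases "S = {}")
  case False
  obtain b where b: "b \<in> S" "\<And>x. x \<in> S \<Longrightarrow> kuhn_le b x"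
    using kuhn_simplex_bottom[OF assms False] by blast
  have "card S \<le> card {height d b..height d b + int d}"
    using b height_kuhn_le
    by (intro card_inj_on_le[OF inj_on_height[OF assms]]) auto
  then show ?thesis by simp
qed simp

text \<open>A simplex of codimension one lies in exactly two top simplices. If \<open>a\<close> and \<open>b\<close> are the
  neighbours of the missing vertex in the cyclic order of the heights, the two possible
  vertices are exchanged by \<open>v \<mapsto> a + b - v\<close>.\<close>

lemma cofacet_reflection:
  assumes S: "kuhn_simplex S" "S \<subseteq> coord_space d" "card S = d" and "0 < d"
  obtains a b where "a \<in> S" "b \<in> S"
    "\<And>v. v \<in> coord_space d \<Longrightarrow> v \<notin> S \<Longrightarrow> kuhn_simplex (insert v S) \<Longrightarrow>
        kuhn_simplex (insert (\<lambda>i. a i + b i - v i) S) \<and>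
        (\<lambda>i. a i + b i - v i) \<notin> S \<and> (\<lambda>i. a i + b i - v i) \<noteq> v"
    "\<And>v j. v \<in> coord_space d \<Longrightarrow> v \<notin> S \<Longrightarrow> kuhn_simplex (insert v S) \<Longrightarrow>
        \<forall>x\<in>S. 0 \<le> x j \<Longrightarrow> 0 \<le> v j \<Longrightarrow> \<exists>x\<in>S. x j \<noteq> 0 \<Longrightarrow> 0 \<le> a j + b j - v j"
proof -
  have "S \<noteq> {}" using assms by auto
  obtain b where b: "b \<in> S" "\<And>x. x \<in> S \<Longrightarrow> kuhn_le b x"
    using kuhn_simplex_bottom[OF S(1,2) \<open>S \<noteq> {}\<close>] by blast
  obtain t where t: "t \<in> S" "\<And>x. x \<in> S \<Longrightarrow> kuhn_le x t"
    using kuhn_simplex_top[OF S(1,2) \<open>S \<noteq> {}\<close>] by blast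
  have finS: "finite S" using S(1) by (simp add: kuhn_simplex_def)
  have hS: "height d b \<le> height d x" "height d x \<le> height d t" if "x \<in> S" for x
    using height_kuhn_le(1) b t that by auto
  have injS: "inj_on (height d) S" by (rule inj_on_height[OF S(1,2)])
  have cardH: "card (height d ` S) = d" using card_image[OF injS] S(3) by simp
  have htb: "height d t \<le> height d b + int d" using b(2)[OF t(1)] height_kuhn_le(2) by blast
  have H: "height d ` S \<subseteq> {height d b..height d t}" using hS by auto
  have adj: "adjacent v x" if "kuhn_simplex (insert v S)" "x \<in> S" for v x
    using that by (simp add: kuhn_simplex_insert)
  have vnot: "height d v \<notin> height d ` S" if "v \<in> coord_space d" "v \<notin> S" "kuhn_simplex (insert v S)" for v
    using inj_on_height[OF that(3), of d] that S(2) by (auto simp: inj_on_def)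
  have hrefl: "height d (\<lambda>i. x i + y i - v i) = height d x + height d y - height d v" for x y v
    by (simp add: height_def sum.distrib sum_subtractf)
  have simpl: "kuhn_simplex (insert w S)" if "\<And>x. x \<in> S \<Longrightarrow> kuhn_le x w \<or> kuhn_le w x" for w
    using that S(1) by (auto simp: kuhn_simplex_insert adjacent_def)
  show thesis
  proof (cases "height d t = height d b + int d")
    \<comment> \<open>The spread is less than d, so the d distinct heights fill an interval. The
      missing vertex then lies below the bottom or above the top, and its cyclic neighbours are
      \<open>t\<close> and \<open>b\<close>.\<close>
    case False
    then have "card {height d b..height d t} \<le> d" using htb hS[OF t(1)] by auto
    then have Heq: "height d ` S = {height d b..height d t}"
      using H cardH by (metis card_seteq finite_atLeastAtMost_int)
    have out: "(\<forall>x\<in>S. kuhn_le v x) \<and> height d v < height d b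
        \<or> (\<forall>x\<in>S. kuhn_le x v) \<and> height d v > height d t"
      if "v \<in> coord_space d" "v \<notin> S" "kuhn_simplex (insert v S)" for v
    proof -
      have "height d v < height d b \<or> height d v > height d t"
        using vnot[OF that] Heq by auto
      then show ?thesis
      proof
        assume l: "height d v < height d b"
        have "kuhn_le v x" if "x \<in> S" for x
          using adj[OF \<open>kuhn_simplex (insert v S)\<close> that] l hS[OF that]
          by (intro kuhn_le_if_height_less[of _ _ d]) auto
        then show ?thesis using l by blast
      next
        assume l: "height d v > height d t"
        have "kuhn_le x v" if "x \<in> S" for x
          using adj[OF \<open>kuhn_simplex (insert v S)\<close> that] l hS[OF that]
          by (intro kuhn_le_if_height_less[of _ _ d]) (auto simp: adjacent_sym)
        then show ?thesis using l by blast
      qed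
    qed
    show thesis
    proof (rule that[OF t(1) b(1)])
      fix v assume v: "v \<in> coord_space d" "v \<notin> S" "kuhn_simplex (insert v S)"
      let ?w = "\<lambda>i. t i + b i - v i"
      have "height d ?w \<notin> {height d b..height d t}" "height d ?w \<noteq> height d v"
        using out[OF v] hS[OF t(1)] unfolding hrefl by auto
      then have w: "?w \<notin> S" "?w \<noteq> v" using H by auto
      have "kuhn_le x ?w \<or> kuhn_le ?w x" if x: "x \<in> S" for x
      proof -
        have bx: "b i \<le> x i" "x i \<le> t i" "t i \<le> b i + 1" for i
          using b(2)[OF x] t(2)[OF x] b(2)[OF t(1)] by (auto simp: kuhn_le_def)
        from out[OF v] show ?thesis
        proof
          assume "(\<forall>x\<in>S. kuhn_le v x) \<and> height d v < height d b"
          then have vx: "v i \<le> b i" "t i \<le> v i + 1" for i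
            using t(1) b(1) by (auto simp: kuhn_le_def)
          have "x i \<le> ?w i \<and> ?w i \<le> x i + 1" for i
            using bx[of i] vx[of i] by linarith
          then show ?thesis by (simp add: kuhn_le_def)
        next
          assume "(\<forall>x\<in>S. kuhn_le x v) \<and> height d v > height d t"
          then have vx: "t i \<le> v i" "v i \<le> b i + 1" for i
            using t(1) b(1) by (auto simp: kuhn_le_def)
          have "?w i \<le> x i \<and> x i \<le> ?w i + 1" for i
            using bx[of i] vx[of i] by linarith
          then show ?thesis by (simp add: kuhn_le_def)
        qed
      qed
      then show "kuhn_simplex (insert ?w S) \<and> ?w \<notin> S \<and> ?w \<noteq> v"
        using w simpl by blast
    next
      fix v j assume v: "v \<in> coord_space d" "v \<notin> S" "kuhn_simplex (insert v S)"
        and nn: "\<forall>x\<in>S. 0 \<le> x j" "0 \<le> v j" "\<exists>x\<in>S. x j \<noteq> 0"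
      \<comment> \<open>The vertex off the hyperplane yields \<open>t j \<ge> 1\<close>, which
        compensates the possible excess in \<open>v j \<le> b j + 1\<close>.\<close>
      obtain x where x: "x \<in> S" "x j \<noteq> 0" using nn(3) by blast
      have "x j \<le> t j" "0 \<le> x j" "t j \<le> b j + 1" "0 \<le> b j"
        using t(2)[OF x(1)] b(2)[OF t(1)] b(1) nn(1) x(1) by (auto simp: kuhn_le_def)
      moreover have "kuhn_le v b \<or> kuhn_le b v"
        using out[OF v] b(1) by blast
      then have "v j \<le> b j + 1"
        unfolding kuhn_le_def by (elim disjE) (drule spec[of _ j], linarith)+
      ultimately show "0 \<le> t j + b j - v j" using x(2) by linarith
    qed
  next
    \<comment> \<open>The spread is d, so d heights occupy all but one of d + 1 values. The gap
      \<open>q\<close> is interior and is the only possible height of the missing vertex; its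
      neighbours are the vertices \<open>a\<close> and \<open>c\<close> of heights q - 1 and q +
      1.\<close>
    case True
    have "card ({height d b..height d t} - height d ` S) = 1"
      using True cardH finS H by (subst card_Diff_subset) auto
    then obtain q where q: "{height d b..height d t} - height d ` S = {q}"
      by (auto simp: card_1_singleton_iff)
    have qb: "height d b < q" "q < height d t"
      using q b(1) t(1) by (fastforce simp: order_less_le)+
    have "q - 1 \<in> height d ` S" "q + 1 \<in> height d ` S"
    proof -
      have "w \<in> height d ` S" if "w \<in> {height d b..height d t}" "w \<noteq> q" for w
        using q that by blast
      then show "q - 1 \<in> height d ` S" "q + 1 \<in> height d ` S" using qb by simp_all
    qed
    then obtain a c where a: "a \<in> S" "height d a = q - 1" and c: "c \<in> S" "height d c = q + 1"
      by (metis imageE)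
    have ac: "kuhn_le a c"
      using S(1) a c by (intro kuhn_le_if_height_less[of _ _ d]) (auto simp: kuhn_simplex_def)
    have hv: "height d v = q" if v: "v \<in> coord_space d" "v \<notin> S" "kuhn_simplex (insert v S)" for v
    proof -
      have "height d b \<le> height d v"
      proof (rule ccontr)
        assume "\<not> ?thesis"
        then have l: "height d v < height d b" by simp
        then have "kuhn_le v t"
          using adj[OF v(3) t(1)] True by (intro kuhn_le_if_height_less[of _ _ d]) auto
        then show False using height_kuhn_le(2)[of v t d] True l by simp
      qed
      moreover have "height d v \<le> height d t"
      proof (rule ccontr)
        assume "\<not> ?thesis"
        then have l: "height d t < height d v" by simp
        then have "kuhn_le b v"
          using adj[OF v(3) b(1)] True
          by (intro kuhn_le_if_height_less[of _ _ d]) (auto simp: adjacent_sym)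
        then show False using height_kuhn_le(2)[of b v d] True l by simp
      qed
      ultimately show ?thesis using q vnot[OF v] by auto
    qed
    have between: "kuhn_le a v" "kuhn_le v c"
      if v: "v \<in> coord_space d" "v \<notin> S" "kuhn_simplex (insert v S)" for v
      using adj[OF v(3)] a c hv[OF v]
      by (auto intro!: kuhn_le_if_height_less[of _ _ d] simp: adjacent_sym)
    show thesis
    proof (rule that[OF a(1) c(1)])
      fix v assume v: "v \<in> coord_space d" "v \<notin> S" "kuhn_simplex (insert v S)"
      let ?w = "\<lambda>i. a i + c i - v i"
      have "height d ?w = q" unfolding hrefl using a c hv[OF v] by simp
      then have w: "?w \<notin> S" using q by blast
      \<comment> \<open>A fixed point would make every \<open>a i + c i\<close> even, but the
        entries of c - a are zero or one.\<close>
      have w': "?w \<noteq> v"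
      proof
        assume "?w = v"
        then have e: "a i + c i = 2 * v i" for i by (metis diff_eq_eq mult_2)
        have "a i = c i" for i
        proof -
          have "a i \<le> c i \<and> c i \<le> a i + 1" using ac by (simp add: kuhn_le_def)
          then show ?thesis using e[of i] by presburger
        qed
        then have "a = c" by auto
        then show False using a c by simp
      qed
      have "kuhn_le x ?w \<or> kuhn_le ?w x" if x: "x \<in> S" for x
      proof -
        have vb: "a i \<le> v i" "v i \<le> c i" for i
          using between[OF v] by (auto simp: kuhn_le_def)
        have "height d x \<noteq> q" using q x by blast
        then consider "height d x < q" | "height d x > q" by linarith
        then show ?thesis
        proof cases
          case 1
          have "kuhn_le x a \<and> kuhn_le x c"
          proof (cases "x = a")
            case True then show ?thesis using ac by (simp add: kuhn_le_def)
          next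
            case False
            then have "height d x \<noteq> height d a" using injS x a by (auto simp: inj_on_def)
            then show ?thesis using 1 a c S(1) x
              by (auto intro!: kuhn_le_if_height_less[of _ _ d] simp: kuhn_simplex_def)
          qed
          then have xa: "x i \<le> a i" "c i \<le> x i + 1" for i by (auto simp: kuhn_le_def)
          have "x i \<le> ?w i \<and> ?w i \<le> x i + 1" for i
            using xa[of i] vb[of i] by linarith
          then show ?thesis by (simp add: kuhn_le_def)
        next
          case 2
          have "kuhn_le c x \<and> kuhn_le a x"
          proof (cases "x = c")
            case True then show ?thesis using ac by (simp add: kuhn_le_def)
          next
            case False
            then have "height d x \<noteq> height d c" using injS x c by (auto simp: inj_on_def)
            then show ?thesis using 2 a c S(1) x
              by (auto intro!: kuhn_le_if_height_less[of _ _ d] simp: kuhn_simplex_def)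
          qed
          then have xa: "c i \<le> x i" "x i \<le> a i + 1" for i by (auto simp: kuhn_le_def)
          have "?w i \<le> x i \<and> x i \<le> ?w i + 1" for i
            using xa[of i] vb[of i] by linarith
          then show ?thesis by (simp add: kuhn_le_def)
        qed
      qed
      then show "kuhn_simplex (insert ?w S) \<and> ?w \<notin> S \<and> ?w \<noteq> v"
        using w w' simpl by blast
    next
      fix v j assume v: "v \<in> coord_space d" "v \<notin> S" "kuhn_simplex (insert v S)"
        and nn: "\<forall>x\<in>S. 0 \<le> x j" "0 \<le> v j" "\<exists>x\<in>S. x j \<noteq> 0"
      have "0 \<le> a j" using nn(1) a(1) by blast
      moreover have "v j \<le> c j" using between(2)[OF v] by (simp add: kuhn_le_def)
      ultimately show "0 \<le> a j + c j - v j" by linarith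
    qed
  qed
qed

section \<open>Hemispheres of symmetric chains modulo two\<close>

definition full_simplices :: "(nat \<Rightarrow> int) set \<Rightarrow> nat \<Rightarrow> (nat \<Rightarrow> int) set set" where
  "full_simplices U j = {S. S \<subseteq> U \<inter> coord_space j \<and> kuhn_simplex S \<and> card S = Suc j}"

definition upper_simplices :: "(nat \<Rightarrow> int) set \<Rightarrow> nat \<Rightarrow> (nat \<Rightarrow> int) set set" where
  "upper_simplices U j = {S \<in> full_simplices U (Suc j). \<forall>x\<in>S. 0 \<le> x j}"

lemma coord_space_Suc: "x \<in> coord_space j \<longleftrightarrow> x \<in> coord_space (Suc j) \<and> x j = 0"
  by (auto simp: coord_space_def) (metis le_antisym not_less_eq_eq)

lemma coord_space_mono: "j \<le> k \<Longrightarrow> coord_space j \<subseteq> coord_space k"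
  by (auto simp: coord_space_def)

lemma finite_full_simplices: "finite U \<Longrightarrow> finite (full_simplices U j)"
  by (rule finite_subset[of _ "Pow U"]) (auto simp: full_simplices_def)

lemma finite_upper_simplices: "finite U \<Longrightarrow> finite (upper_simplices U j)"
  by (simp add: upper_simplices_def finite_full_simplices)

lemma full_simplices_uminus:
  assumes "uminus ` U = U"
  shows "uminus ` S \<in> full_simplices U j \<longleftrightarrow> S \<in> full_simplices U j"
proof -
  have inj: "inj (uminus :: (nat \<Rightarrow> int) \<Rightarrow> _)"
    by (auto simp: inj_on_def fun_eq_iff)
  have U: "- x \<in> U \<longleftrightarrow> x \<in> U" for x
    using assms by (metis (no_types, opaque_lifting) imageI inj inj_image_mem_iff)
  have "card (uminus ` S) = card S"
    using inj by (intro card_image) (auto simp: inj_on_def)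
  moreover have "uminus ` S \<subseteq> U \<inter> coord_space j \<longleftrightarrow> S \<subseteq> U \<inter> coord_space j"
    using U by (auto simp: subset_iff)
  ultimately show ?thesis unfolding full_simplices_def by auto
qed

lemma not_in_coord_space_if_full:
  assumes "S \<in> full_simplices U (Suc j)"
  obtains x where "x \<in> S" "x j \<noteq> 0"
proof (cases "S \<subseteq> coord_space j")
  case True
  then show ?thesis using card_kuhn_simplex_le[of S j] assms by (auto simp: full_simplices_def)
next
  case False
  then obtain x where "x \<in> S" "x \<notin> coord_space j" by blast
  moreover have "x \<in> coord_space (Suc j)" using assms \<open>x \<in> S\<close> by (auto simp: full_simplices_def)
  ultimately show ?thesis using that coord_space_Suc by blast
qed

text \<open>Coordinates of adjacent points differ by at most one and in a common direction, so no
  simplex crosses the hyperplane where coordinate j vanishes. A simplex of full dimension has a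
  vertex off that hyperplane, so it cannot belong to both halves.\<close>

lemma full_simplices_Suc_split:
  assumes "uminus ` U = U"
  shows "full_simplices U (Suc j) = upper_simplices U j \<union> image uminus ` upper_simplices U j"
    and "upper_simplices U j \<inter> image uminus ` upper_simplices U j = {}"
proof -
  have uu: "uminus ` uminus ` S = S" for S :: "(nat \<Rightarrow> int) set"
    by (simp add: image_image fun_Compl_def)
  have split: "(\<forall>x\<in>S. 0 \<le> x j) \<or> (\<forall>x\<in>S. x j \<le> 0)" if "S \<in> full_simplices U (Suc j)" for S
  proof (rule ccontr)
    assume "\<not> ?thesis"
    then obtain x y where "x \<in> S" "y \<in> S" "x j < 0" "0 < y j" by force
    moreover then have "adjacent x y" using that by (auto simp: full_simplices_def kuhn_simplex_def)
    then have "y j \<le> x j + 1 \<or> x j \<le> y j + 1 \<and> y j \<le> x j" by (auto simp: adjacent_def kuhn_le_def)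
    ultimately show False by linarith
  qed
  have neg: "S \<in> image uminus ` upper_simplices U j \<longleftrightarrow>
      S \<in> full_simplices U (Suc j) \<and> (\<forall>x\<in>S. x j \<le> 0)" for S
  proof
    assume "S \<in> image uminus ` upper_simplices U j"
    then show "S \<in> full_simplices U (Suc j) \<and> (\<forall>x\<in>S. x j \<le> 0)"
      using full_simplices_uminus[OF assms] by (auto simp: upper_simplices_def)
  next
    assume S: "S \<in> full_simplices U (Suc j) \<and> (\<forall>x\<in>S. x j \<le> 0)"
    then have "uminus ` S \<in> upper_simplices U j"
      using full_simplices_uminus[OF assms] by (auto simp: upper_simplices_def)
    then have "uminus ` uminus ` S \<in> image uminus ` upper_simplices U j" by (rule imageI)
    then show "S \<in> image uminus ` upper_simplices U j" by (simp only: uu)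
  qed
  show "full_simplices U (Suc j) = upper_simplices U j \<union> image uminus ` upper_simplices U j"
  proof (rule set_eqI)
    fix S
    show "S \<in> full_simplices U (Suc j)
      \<longleftrightarrow> S \<in> upper_simplices U j \<union> image uminus ` upper_simplices U j"
      unfolding Un_iff neg using split[of S] by (auto simp: upper_simplices_def)
  qed
  show "upper_simplices U j \<inter> image uminus ` upper_simplices U j = {}"
  proof -
    have False if S: "S \<in> upper_simplices U j" "S \<in> image uminus ` upper_simplices U j" for S
    proof -
      have "S \<in> full_simplices U (Suc j)" using S(1) by (simp add: upper_simplices_def)
      then obtain x where "x \<in> S" "x j \<noteq> 0" by (rule not_in_coord_space_if_full)
      moreover have "0 \<le> x j" using S(1) \<open>x \<in> S\<close> by (simp add: upper_simplices_def)
      moreover have "x j \<le> 0" using S(2) \<open>x \<in> S\<close> by (simp add: neg)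
      ultimately show False by simp
    qed
    then show ?thesis by blast
  qed
qed

text \<open>The number modulo 2 of occurrences of \<open>T\<close> in the boundary of the upper half of the
  top-dimensional chain, plus its number of occurrences in the equator.\<close>

definition hemisphere :: "(nat \<Rightarrow> int) set \<Rightarrow> nat \<Rightarrow> (nat \<Rightarrow> int) set \<Rightarrow> bit" where
  "hemisphere U j T =
     of_nat (card {v \<in> U - T. insert v T \<in> upper_simplices U j}) + of_bool (T \<in> full_simplices U j)"

text \<open>Flags (S, v) are reindexed by the facet T = S - {v}. In chain terms the boundary of the
  upper half is the hemisphere plus the equator: \<open>hemisphere\<close> already contains the
  equator once, and adding it again cancels modulo two.\<close>

lemma sum_facets_upper:
  fixes F :: "(nat \<Rightarrow> int) set \<Rightarrow> bit"
  assumes "finite U"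
  shows "(\<Sum>S\<in>upper_simplices U j. \<Sum>v\<in>S. F (S - {v}))
       = (\<Sum>T\<in>Pow U. F T * hemisphere U j T) + (\<Sum>T\<in>full_simplices U j. F T)"
proof -
  have fin: "finite S" "S \<subseteq> U" if "S \<in> upper_simplices U j" for S
    using that by (auto simp: upper_simplices_def full_simplices_def kuhn_simplex_def)
  have "(\<Sum>S\<in>upper_simplices U j. \<Sum>v\<in>S. F (S - {v}))
      = (\<Sum>(S, v)\<in>(SIGMA S:upper_simplices U j. S). F (S - {v}))"
    using fin finite_upper_simplices[OF assms] by (subst sum.Sigma) auto
  also have "\<dots> = (\<Sum>(T, v)\<in>(SIGMA T:Pow U. {v \<in> U - T. insert v T \<in> upper_simplices U j}). F T)"
    using fin
    by (intro sum.reindex_bij_witness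
          [where i = "\<lambda>(T, v). (insert v T, v)" and j = "\<lambda>(S, v). (S - {v}, v)"])
       (auto simp: insert_absorb)
  also have "\<dots> = (\<Sum>T\<in>Pow U. of_nat (card {v \<in> U - T. insert v T \<in> upper_simplices U j}) * F T)"
    using assms by (subst sum.Sigma[symmetric]) auto
  also have "\<dots> = (\<Sum>T\<in>Pow U. F T * hemisphere U j T) + (\<Sum>T\<in>Pow U. F T * of_bool (T \<in> full_simplices U j))"
  proof -
    have "c * x = x * (c + y) + x * y" for c x y :: bit
      by (cases "c = 0"; cases "x = 0"; cases "y = 0") auto
    then show ?thesis unfolding hemisphere_def sum.distrib[symmetric] by (intro sum.cong refl)
  qed
  also have "(\<Sum>T\<in>Pow U. F T * of_bool (T \<in> full_simplices U j)) = (\<Sum>T\<in>full_simplices U j. F T)"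
  proof -
    have "(\<Sum>T\<in>full_simplices U j. F T * of_bool (T \<in> full_simplices U j))
        = (\<Sum>T\<in>Pow U. F T * of_bool (T \<in> full_simplices U j))"
      using assms by (intro sum.mono_neutral_left) (auto simp: full_simplices_def)
    moreover have "(\<Sum>T\<in>full_simplices U j. F T * of_bool (T \<in> full_simplices U j))
        = (\<Sum>T\<in>full_simplices U j. F T)"
      by (rule sum.cong) auto
    ultimately show ?thesis by metis
  qed
  finally show ?thesis .
qed

definition lattice_boundary :: "(nat \<Rightarrow> int) set \<Rightarrow> nat \<Rightarrow> (nat \<Rightarrow> int) set" where
  "lattice_boundary U n = {x \<in> U \<inter> coord_space n. \<exists>v\<in>coord_space n - U. adjacent x v}"

text \<open>The j + 1 distinct heights in \<open>S\<close> force the top vertex to exceed the bottom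
  one by 1 in every coordinate. A vertex in the upper half lies above both, hence is squeezed onto
  the top vertex in the first j coordinates, with 1 as its last coordinate.\<close>

lemma ex1_upper_cofacet:
  assumes S: "kuhn_simplex S" "S \<subseteq> coord_space j" "card S = Suc j"
  shows "\<exists>!v. v \<in> coord_space (Suc j) - S \<and> kuhn_simplex (insert v S) \<and> 0 \<le> v j"
proof -
  have "S \<noteq> {}" using S(3) by auto
  obtain b where b: "b \<in> S" "\<And>x. x \<in> S \<Longrightarrow> kuhn_le b x"
    using kuhn_simplex_bottom[OF S(1,2) \<open>S \<noteq> {}\<close>] by blast
  obtain t where t: "t \<in> S" "\<And>x. x \<in> S \<Longrightarrow> kuhn_le x t"
    using kuhn_simplex_top[OF S(1,2) \<open>S \<noteq> {}\<close>] by blast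
  have injS: "inj_on (height j) S" by (rule inj_on_height[OF S(1,2)])
  have zero: "x i = 0" if "x \<in> S" "j \<le> i" for x i using S(2) that by (auto simp: coord_space_def)
  have tb: "t i = b i + 1" if "i < j" for i
  proof (rule ccontr)
    assume "t i \<noteq> b i + 1"
    moreover have "t k \<le> b k + 1" for k using b(2)[OF t(1)] by (simp add: kuhn_le_def)
    ultimately have le: "t k \<le> b k + 1" "t i < b i + 1" for k by (auto simp: order_less_le)
    have "height j t < (\<Sum>i<j. b i + 1)"
      unfolding height_def
    proof (rule sum_strict_mono_ex1)
      show "\<exists>k\<in>{..<j}. t k < b k + 1" using le(2) that by blast
    qed (use le in auto)
    then have "height j t < height j b + int j" by (simp add: height_def sum.distrib)
    moreover have "card S \<le> card {height j b..height j t}"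
      using height_kuhn_le(1) b t by (intro card_inj_on_le[OF injS]) auto
    ultimately show False using S(3) by simp
  qed
  let ?v = "t(j := 1)"
  show ?thesis
  proof (rule ex1I[of _ ?v])
    have "?v \<in> coord_space (Suc j)" "?v \<notin> S"
      using zero[OF t(1)] zero[of ?v j] by (auto simp: coord_space_def)
    moreover have "adjacent ?v x" if x: "x \<in> S" for x
    proof -
      have "x i \<le> ?v i \<and> ?v i \<le> x i + 1" for i
        using t(2)[OF x] zero[OF x, of j] by (auto simp: kuhn_le_def)
      then show ?thesis by (simp add: adjacent_def kuhn_le_def)
    qed
    ultimately show "?v \<in> coord_space (Suc j) - S \<and> kuhn_simplex (insert ?v S) \<and> 0 \<le> ?v j"
      using S(1) by (auto simp: kuhn_simplex_insert)
  next
    fix v assume v: "v \<in> coord_space (Suc j) - S \<and> kuhn_simplex (insert v S) \<and> 0 \<le> v j"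
    have "v \<notin> coord_space j"
    proof
      assume "v \<in> coord_space j"
      then have "card (insert v S) \<le> Suc j"
        using v S(2) by (intro card_kuhn_simplex_le) auto
      then show False using v S(1,3) by (auto simp: kuhn_simplex_def)
    qed
    then have "0 < v j" using v coord_space_Suc[of v j] by (auto simp: order_less_le)
    have above: "kuhn_le x v" if "x \<in> S" for x
    proof -
      have "adjacent v x" using v that by (simp add: kuhn_simplex_insert)
      moreover have "\<not> kuhn_le v x"
      proof
        assume "kuhn_le v x"
        then have "v j \<le> x j" by (simp add: kuhn_le_def)
        then show False using zero[OF that, of j] \<open>0 < v j\<close> by simp
      qed
      ultimately show ?thesis by (simp add: adjacent_def)
    qed
    show "v = ?v"
    proof
      fix i
      have "b i \<le> v i" "v i \<le> b i + 1" "t i \<le> v i" "v i \<le> t i + 1"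
        using above[OF b(1)] above[OF t(1)] by (auto simp: kuhn_le_def)
      moreover have "i > j \<Longrightarrow> v i = 0" using v by (simp add: coord_space_def)
      ultimately show "v i = ?v i"
        using tb[of i] zero[OF t(1), of i] \<open>0 < v j\<close>
        by (cases i j rule: linorder_cases) auto
    qed
  qed
qed

text \<open>If all cofacets of \<open>T\<close> had their vertices in \<open>U\<close>, the
  coefficient would vanish: on the equator there is one upper cofacet plus the equator term, and
  elsewhere the reflection pairs the upper cofacets. So a nonzero coefficient exposes a point
  outside \<open>U\<close> adjacent to every vertex of \<open>T\<close>.\<close>

lemma hemisphere_nonzero:
  assumes "hemisphere U j T \<noteq> 0"
  shows "T \<subseteq> lattice_boundary U (Suc j)" "kuhn_simplex T" "card T = Suc j"
proof -
  have T: "T \<subseteq> U \<inter> coord_space (Suc j) \<and> kuhn_simplex T \<and> card T = Suc j \<and> (\<forall>x\<in>T. 0 \<le> x j)"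
  proof (cases "T \<in> full_simplices U j")
    case True
    then show ?thesis using coord_space_Suc[of _ j] by (auto simp: full_simplices_def)
  next
    case False
    have "{v \<in> U - T. insert v T \<in> upper_simplices U j} \<noteq> {}"
    proof
      assume "{v \<in> U - T. insert v T \<in> upper_simplices U j} = {}"
      then show False using assms False unfolding hemisphere_def by (simp only: card.empty) simp
    qed
    then obtain v where v: "v \<in> U - T" "insert v T \<in> upper_simplices U j" by blast
    then have "kuhn_simplex T"
      using kuhn_simplex_mono[of "insert v T" T] by (auto simp: upper_simplices_def full_simplices_def)
    then show ?thesis
      using v by (auto simp: upper_simplices_def full_simplices_def kuhn_simplex_def)
  qed
  then show "kuhn_simplex T" "card T = Suc j" by auto
  have "\<exists>v\<in>coord_space (Suc j) - U. kuhn_simplex (insert v T)"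
  proof (rule ccontr)
    assume "\<not> ?thesis"
    then have inU: "v \<in> U" if "v \<in> coord_space (Suc j)" "kuhn_simplex (insert v T)" for v
      using that by blast
    let ?C = "{v \<in> U - T. insert v T \<in> upper_simplices U j}"
    have C: "v \<in> ?C \<longleftrightarrow> v \<in> coord_space (Suc j) - T \<and> kuhn_simplex (insert v T) \<and> 0 \<le> v j" for v
    proof
      assume "v \<in> ?C"
      then show "v \<in> coord_space (Suc j) - T \<and> kuhn_simplex (insert v T) \<and> 0 \<le> v j"
        by (auto simp: upper_simplices_def full_simplices_def)
    next
      assume v: "v \<in> coord_space (Suc j) - T \<and> kuhn_simplex (insert v T) \<and> 0 \<le> v j"
      then have "v \<in> U" using inU by blast
      moreover have "finite T" using T by (simp add: kuhn_simplex_def)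
      ultimately show "v \<in> ?C" using v T by (auto simp: upper_simplices_def full_simplices_def)
    qed
    have "hemisphere U j T = 0"
    proof (cases "T \<subseteq> coord_space j")
      case True
      have "\<exists>!v. v \<in> ?C" unfolding C by (rule ex1_upper_cofacet) (use T True in auto)
      then obtain v where "?C = {v}" by blast
      then have "card ?C = 1" by simp
      moreover have "T \<in> full_simplices U j" using T True by (auto simp: full_simplices_def)
      ultimately show ?thesis by (simp add: hemisphere_def)
    next
      case False
      then obtain x where x: "x \<in> T" "x j \<noteq> 0" using T coord_space_Suc[of _ j] by blast
      obtain a b where ab: "a \<in> T" "b \<in> T"
        and refl: "\<And>v. v \<in> coord_space (Suc j) \<Longrightarrow> v \<notin> T \<Longrightarrow> kuhn_simplex (insert v T) \<Longrightarrow>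
          kuhn_simplex (insert (\<lambda>i. a i + b i - v i) T) \<and>
          (\<lambda>i. a i + b i - v i) \<notin> T \<and> (\<lambda>i. a i + b i - v i) \<noteq> v"
        and nonneg: "\<And>v k. v \<in> coord_space (Suc j) \<Longrightarrow> v \<notin> T \<Longrightarrow> kuhn_simplex (insert v T) \<Longrightarrow>
          \<forall>x\<in>T. 0 \<le> x k \<Longrightarrow> 0 \<le> v k \<Longrightarrow> \<exists>x\<in>T. x k \<noteq> 0 \<Longrightarrow> 0 \<le> a k + b k - v k"
      proof (rule cofacet_reflection[of T "Suc j"])
        show "kuhn_simplex T" "T \<subseteq> coord_space (Suc j)" "card T = Suc j" "0 < Suc j"
          using T by auto
      qed blast
      have "(of_nat (card ?C) :: bit) = 0"
      \<comment> \<open>An infinite \<open>?C\<close> has \<open>card\<close> 0 by convention, so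
        only the finite case needs the involution.\<close>
      proof (cases "finite ?C")
        case True
        show ?thesis
        proof (rule bit_of_nat_card_involution[OF True, where i = "\<lambda>v i. a i + b i - v i"])
          fix v assume "v \<in> ?C"
          then have v: "v \<in> coord_space (Suc j)" "v \<notin> T" "kuhn_simplex (insert v T)" "0 \<le> v j"
            unfolding C by auto
          show "(\<lambda>i. a i + b i - (a i + b i - v i)) = v" by simp
          show "(\<lambda>i. a i + b i - v i) \<noteq> v" using refl[OF v(1-3)] by blast
          have "0 \<le> a j + b j - v j"
            using nonneg[OF v(1-3), of j] T v(4) x by blast
          moreover have "(\<lambda>i. a i + b i - v i) \<in> coord_space (Suc j)"
          proof -
          have "a \<in> coord_space (Suc j)" "b \<in> coord_space (Suc j)" using ab T by blast+
          then show ?thesis using v(1) by (simp add: coord_space_def)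
        qed
          ultimately show "(\<lambda>i. a i + b i - v i) \<in> ?C"
            using refl[OF v(1-3)] unfolding C by blast
        qed
      qed simp
      moreover have "T \<notin> full_simplices U j" using False by (auto simp: full_simplices_def)
      ultimately show ?thesis by (simp add: hemisphere_def)
    qed
    then show False using assms by blast
  qed
  then obtain v where "v \<in> coord_space (Suc j) - U" "\<forall>x\<in>T. adjacent x v"
    by (auto simp: kuhn_simplex_insert adjacent_sym)
  then show "T \<subseteq> lattice_boundary U (Suc j)" using T by (auto simp: lattice_boundary_def)
qed

section \<open>The parity argument of Fan's lemma\<close>

text \<open>The order must refine the absolute labels, be injective on simplices and yet be
  invariant under x \<mapsto> -x. The tie-breaker is the smaller of the numbers of x and -x, so only
  antipodal points collide, and antipodal points are adjacent only at the origin. Multiplying the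
  absolute label by \<open>n\<close>, which exceeds every tie-breaker, makes the order
  lexicographic.\<close>

lemma obtain_symmetric_key:
  fixes lab :: "(nat \<Rightarrow> int) \<Rightarrow> int"
  assumes "finite U" and sym: "uminus ` U = U"
  obtains key :: "(nat \<Rightarrow> int) \<Rightarrow> int" where
    "\<And>T. T \<subseteq> U \<Longrightarrow> kuhn_simplex T \<Longrightarrow> inj_on key T"
    "\<And>x. \<bar>lab (- x)\<bar> = \<bar>lab x\<bar> \<Longrightarrow> key (- x) = key x"
    "\<And>x y. x \<in> U \<Longrightarrow> y \<in> U \<Longrightarrow> \<bar>lab x\<bar> < \<bar>lab y\<bar> \<Longrightarrow> key x < key y"
proof -
  have neg: "- (- x) = x" for x :: "nat \<Rightarrow> int" by (simp add: fun_Compl_def)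
  have U: "- x \<in> U" if "x \<in> U" for x using sym that by blast
  obtain h n where h: "h ` U = {i::nat. i < n}" "inj_on h U"
    using finite_imp_inj_to_nat_seg[OF assms(1)] by metis
  define tie where "tie x = int (min (h x) (h (- x)))" for x
  define key where "key x = \<bar>lab x\<bar> * int n + tie x" for x
  have tie: "0 \<le> tie x" "tie x < int n" if "x \<in> U" for x
  proof -
    have "h x < n" using h(1) that by (metis imageI mem_Collect_eq)
    then show "0 \<le> tie x" "tie x < int n" by (auto simp: tie_def min_def)
  qed
  have tie_eq: "y = x \<or> y = - x" if "x \<in> U" "y \<in> U" "tie x = tie y" for x y
  proof -
    have "h x = h y \<or> h x = h (- y) \<or> h (- x) = h y \<or> h (- x) = h (- y)"
      using that(3) by (auto simp: tie_def min_def split: if_splits)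
    then have "x = y \<or> x = - y \<or> - x = y \<or> - x = - y"
      using h(2) U that(1,2) by (meson inj_onD)
    then show ?thesis using neg by metis
  qed
  show thesis
  proof
    fix T assume T: "T \<subseteq> U" "kuhn_simplex T"
    show "inj_on key T"
    proof (rule inj_onI)
      fix x y assume xy: "x \<in> T" "y \<in> T" "key x = key y"
      have xU: "x \<in> U" "y \<in> U" using xy T by auto
      have "key z mod int n = tie z" if "z \<in> U" for z
        using tie[OF that] by (simp add: key_def)
      then have "tie x = tie y" using xy(3) xU by metis
      with tie_eq[OF xU] have "y = x \<or> y = - x" .
      then show "x = y"
      proof
        assume y: "y = - x"
        have "adjacent x y" using T(2) xy by (simp add: kuhn_simplex_def)
        then have "x i = 0" for i
        proof -
          have "(x i \<le> - x i \<and> - x i \<le> x i + 1) \<or> (- x i \<le> x i \<and> x i \<le> - x i + 1)"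
            using \<open>adjacent x y\<close> unfolding y adjacent_def kuhn_le_def by auto
          then show ?thesis by linarith
        qed
        then show ?thesis using y by auto
      qed simp
    qed
  next
    fix x assume "\<bar>lab (- x)\<bar> = \<bar>lab x\<bar>"
    then show "key (- x) = key x" by (simp add: key_def tie_def neg min.commute)
  next
    fix x y assume xy: "x \<in> U" "y \<in> U" "\<bar>lab x\<bar> < \<bar>lab y\<bar>"
    have "\<bar>lab x\<bar> * int n + int n \<le> \<bar>lab y\<bar> * int n"
      using mult_right_mono[of "\<bar>lab x\<bar> + 1" "\<bar>lab y\<bar>" "int n"] xy(3) by (simp add: algebra_simps)
    then show "key x < key y" using tie[OF xy(1)] tie[OF xy(2)] by (simp add: key_def)
  qed
qed

text \<open>The parity argument of Fan's lemma. With \<open>W\<^sub>j\<close> the sum modulo 2 of the \<open>j\<close>-simplices of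
  \<open>U \<inter> \<int>\<^sup>j\<close>, the boundary of \<open>W\<^sub>j\<^sub>+\<^sub>1\<close> is \<open>h + (- h)\<close> with \<open>\<partial>h = \<partial>W\<^sub>j\<close>, so that the number of
  alternating simplices of \<open>\<partial>W\<^sub>j\<close> modulo 2 does not depend on \<open>j\<close>.\<close>

theorem no_antipodal_labelling:
  fixes lab :: "(nat \<Rightarrow> int) \<Rightarrow> int" and U :: "(nat \<Rightarrow> int) set" and p :: nat
  defines "B \<equiv> lattice_boundary U (Suc p)"
  assumes finU: "finite U" and symU: "uminus ` U = U" and zero: "(\<lambda>_. 0) \<in> U"
    and odd: "\<And>x. x \<in> B \<Longrightarrow> lab (- x) = - lab x"
    and range: "\<And>x. x \<in> B \<Longrightarrow> 1 \<le> \<bar>lab x\<bar> \<and> \<bar>lab x\<bar> \<le> int p"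
    and noncompl: "\<And>x y. x \<in> B \<Longrightarrow> y \<in> B \<Longrightarrow> adjacent x y \<Longrightarrow> lab x \<noteq> - lab y"
  shows False
proof -
  obtain key :: "(nat \<Rightarrow> int) \<Rightarrow> int" where key:
    "\<And>T. T \<subseteq> U \<Longrightarrow> kuhn_simplex T \<Longrightarrow> inj_on key T"
    "\<And>x. \<bar>lab (- x)\<bar> = \<bar>lab x\<bar> \<Longrightarrow> key (- x) = key x"
    "\<And>x y. x \<in> U \<Longrightarrow> y \<in> U \<Longrightarrow> \<bar>lab x\<bar> < \<bar>lab y\<bar> \<Longrightarrow> key x < key y"
    using obtain_symmetric_key[OF finU symU, of lab] by blast
  have neg: "- (- x) = x" for x :: "nat \<Rightarrow> int" by (simp add: fun_Compl_def)
  have inj_neg: "inj_on (uminus :: (nat \<Rightarrow> int) \<Rightarrow> _) S" for S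
    using neg by (metis inj_onI)
  have uu: "uminus ` uminus ` S = S" for S :: "(nat \<Rightarrow> int) set"
    by (simp add: image_image neg)
  have inj_neg': "inj_on (image (uminus :: (nat \<Rightarrow> int) \<Rightarrow> _)) S" for S
    using uu by (metis inj_onI)
  let ?pos = "\<lambda>x. 0 < lab x"
  define a :: "bool \<Rightarrow> (nat \<Rightarrow> int) set \<Rightarrow> bit" where
    "a s T = of_bool (alternating key ?pos s T)" for s T
  \<comment> \<open>Alternating simplices with positive start in the boundary of the chain of all
    j-simplices, counted with multiplicity modulo two.\<close>
  define A where "A j = (\<Sum>S\<in>full_simplices U j. \<Sum>v\<in>S. a True (S - {v}))" for j
  define G where "G T = a True T + a True (uminus ` T)" for T
  have B: "lattice_boundary U (Suc j) \<subseteq> B" if "j \<le> p" for j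
    using coord_space_mono[of "Suc j" "Suc p"] that unfolding B_def lattice_boundary_def by blast
  have BU: "B \<subseteq> U" by (auto simp: B_def lattice_boundary_def)
  \<comment> \<open>Negation keeps the order given by \<open>key\<close> and flips all signs, so the
    two kinds of pattern are exchanged. This needs the odd labelling, hence
    \<open>T \<subseteq> B\<close>.\<close>
  have a_neg: "a True (uminus ` T) = a False T" if T: "T \<subseteq> B" for T
  proof -
    have k: "key (- x) = key x" if "x \<in> T" for x
      using key(2)[of x] odd[of x] that T by auto
    have "card {y \<in> uminus ` T. key y < key (- x)} = card {y \<in> T. key y < key x}" if "x \<in> T" for x
    proof -
      have "{y \<in> uminus ` T. key y < key (- x)} = uminus ` {y \<in> T. key y < key x}"
        using k that by auto
      then show ?thesis using card_image[OF inj_neg] by metis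
    qed
    moreover have "?pos (- x) \<longleftrightarrow> \<not> ?pos x" if "x \<in> T" for x
      using odd[of x] range[of x] that T by force
    ultimately have "alternating key ?pos True (uminus ` T) \<longleftrightarrow> alternating key ?pos False T"
      unfolding alternating_def by auto
    then show ?thesis by (simp add: a_def)
  qed
  have A_Suc_eq: "A (Suc j) = (\<Sum>T\<in>Pow U. G T * hemisphere U j T)" for j
  proof -
    have fin: "finite (upper_simplices U j)" by (rule finite_upper_simplices[OF finU])
    have "A (Suc j) = (\<Sum>S\<in>upper_simplices U j. \<Sum>v\<in>S. a True (S - {v}))
        + (\<Sum>S\<in>image uminus ` upper_simplices U j. \<Sum>v\<in>S. a True (S - {v}))"
      unfolding A_def full_simplices_Suc_split(1)[OF symU]
      using fin full_simplices_Suc_split(2)[OF symU] by (intro sum.union_disjoint) auto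
    also have "(\<Sum>S\<in>image uminus ` upper_simplices U j. \<Sum>v\<in>S. a True (S - {v}))
        = (\<Sum>S\<in>upper_simplices U j. \<Sum>v\<in>S. a True (uminus ` (S - {v})))"
      by (simp add: sum.reindex[OF inj_neg'] sum.reindex[OF inj_neg] image_set_diff[OF inj_neg])
    also have "(\<Sum>S\<in>upper_simplices U j. \<Sum>v\<in>S. a True (S - {v}))
        + (\<Sum>S\<in>upper_simplices U j. \<Sum>v\<in>S. a True (uminus ` (S - {v})))
        = (\<Sum>S\<in>upper_simplices U j. \<Sum>v\<in>S. G (S - {v}))"
      by (simp only: G_def sum.distrib)
    also have "\<dots> = (\<Sum>T\<in>Pow U. G T * hemisphere U j T) + (\<Sum>T\<in>full_simplices U j. G T)"
      by (rule sum_facets_upper[OF finU])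
    \<comment> \<open>The equator is invariant under negation, so both summands of \<open>G\<close>
      contribute the same amount.\<close>
    also have "(\<Sum>T\<in>full_simplices U j. G T) = 0"
    proof -
      have "(\<Sum>T\<in>full_simplices U j. a True (uminus ` T)) = (\<Sum>T\<in>full_simplices U j. a True T)"
        using full_simplices_uminus[OF symU] uu
        by (intro sum.reindex_bij_witness[where i = "image uminus" and j = "image uminus"]) auto
      then show ?thesis unfolding G_def sum.distrib by simp
    qed
    finally show ?thesis by simp
  qed
  have G_B: "G T = a True T + a False T" if "T \<subseteq> B" for T
    using a_neg[OF that] by (simp add: G_def)
  have A_Suc: "A (Suc j) = A j" if j: "j \<le> p" for j
  proof -
    \<comment> \<open>\<open>K\<close> is the coboundary of the positive pattern and agrees with
      \<open>G\<close> wherever the hemisphere coefficient is nonzero. Unlike \<open>G\<close>, it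
      sums to zero over the boundary of the upper half, so the hemisphere may be traded for the
      equator, on which \<open>K\<close> yields \<open>A j\<close>.\<close>
    define K where "K T = (\<Sum>v\<in>T. a True (T - {v}))" for T
    have "G T * hemisphere U j T = K T * hemisphere U j T" for T
    proof (cases "hemisphere U j T = 0")
      case False
      note T = hemisphere_nonzero[OF False]
      have "T \<subseteq> B" using T(1) B[OF j] by blast
      moreover have "K T = a True T + a False T"
        unfolding K_def a_def
        using T \<open>T \<subseteq> B\<close> BU by (intro alternating_coboundary key(1)) (auto simp: kuhn_simplex_def)
      ultimately show ?thesis by (simp add: G_B)
    qed simp
    then have "A (Suc j) = (\<Sum>T\<in>Pow U. K T * hemisphere U j T)"
      by (simp add: A_Suc_eq)
    moreover have "(\<Sum>S\<in>upper_simplices U j. \<Sum>v\<in>S. K (S - {v})) = 0"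
    proof (rule sum.neutral, rule ballI)
      fix S assume "S \<in> upper_simplices U j"
      then have "finite S" by (simp add: upper_simplices_def full_simplices_def kuhn_simplex_def)
      then show "(\<Sum>v\<in>S. K (S - {v})) = 0" unfolding K_def by (rule bit_sum_remove_twice)
    qed
    moreover have "A j = (\<Sum>T\<in>full_simplices U j. K T)"
      by (simp add: A_def K_def)
    ultimately have "A (Suc j) + A j = 0" using sum_facets_upper[OF finU, of K j] by metis
    then show ?thesis by (cases "A j = 0"; cases "A (Suc j) = 0") auto
  qed
  have "A j = A 0" if "j \<le> Suc p" for j
    using that by (induction j) (auto simp: A_Suc)
  \<comment> \<open>The only 0-simplex is the origin, and its only facet is the empty set, which
    alternates vacuously.\<close>
  moreover have "A 0 = 1"
  proof -
    have "S \<in> full_simplices U 0 \<longleftrightarrow> S = {\<lambda>_. 0}" for S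
    proof
      assume S: "S \<in> full_simplices U 0"
      then obtain x where "S = {x}" by (auto simp: full_simplices_def card_1_singleton_iff)
      then show "S = {\<lambda>_. 0}" using S by (auto simp: full_simplices_def coord_space_def)
    qed (use zero in \<open>auto simp: full_simplices_def coord_space_def kuhn_simplex_def\<close>)
    then have "full_simplices U 0 = {{\<lambda>_. 0}}" by blast
    then show ?thesis by (simp add: A_def a_def)
  qed
  \<comment> \<open>Simplices of the last hemisphere have p + 1 vertices but only p absolute labels,
    so neither pattern occurs on them.\<close>
  moreover have "A (Suc p) = 0"
  proof -
    have "G T * hemisphere U p T = 0" for T
    proof (cases "hemisphere U p T = 0")
      case False
      note T = hemisphere_nonzero[OF False]
      have TB: "T \<subseteq> B" using T(1) B[of p] by blast
      have "\<not> alternating key ?pos s T" for s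
      proof (rule not_alternating_pigeonhole)
        show "finite T" using T(2) by (simp add: kuhn_simplex_def)
        show "inj_on key T" using key(1) TB BU T(2) by blast
        show "p < card T" using T(3) by simp
        show "\<And>x. x \<in> T \<Longrightarrow> 1 \<le> \<bar>lab x\<bar> \<and> \<bar>lab x\<bar> \<le> int p" using range TB by blast
        show "\<And>x y. x \<in> T \<Longrightarrow> y \<in> T \<Longrightarrow> \<bar>lab x\<bar> < \<bar>lab y\<bar> \<Longrightarrow> key x < key y"
          using key(3) TB BU by blast
        show "\<And>x y. x \<in> T \<Longrightarrow> y \<in> T \<Longrightarrow> lab x \<noteq> - lab y"
          using noncompl TB T(2) unfolding kuhn_simplex_def by blast
      qed
      then show ?thesis using G_B[OF TB] by (simp add: a_def)
    qed simp
    then show ?thesis unfolding A_Suc_eq by (intro sum.neutral ballI)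
  qed
  ultimately show False by (metis order_refl zero_neq_one)
qed

section \<open>From lattice labels to common zeros of odd functions\<close>

lemma tendsto_componentwise_iff_fun:
  fixes f :: "'b \<Rightarrow> nat \<Rightarrow> real"
  shows "(f \<longlongrightarrow> l) F \<longleftrightarrow> (\<forall>i. ((\<lambda>c. f c i) \<longlongrightarrow> l i) F)"
  using limitin_componentwise[of "\<lambda>_. euclidean" UNIV f l F]
  by (simp add: euclidean_product_topology)

lemma compact_fun_box:
  fixes S :: "nat \<Rightarrow> real set"
  assumes "\<And>i. compact (S i)"
  shows "compact {x. \<forall>i. x i \<in> S i}"
proof -
  have "compactin (product_topology (\<lambda>_. euclidean) UNIV) (PiE UNIV S)"
    unfolding compactin_PiE using assms by simp
  then show ?thesis
    by (simp add: euclidean_product_topology PiE_def Pi_def)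
qed

text \<open>Each point is labelled by the index and the sign of its dominant component. If no
  dominant component at a boundary point changed sign or vanished at an adjacent point, the labels
  would be odd and never complementary on adjacent boundary points, which the parity argument
  excludes.\<close>

lemma labelled_grid:
  fixes f :: "nat \<Rightarrow> (nat \<Rightarrow> int) \<Rightarrow> real" and U :: "(nat \<Rightarrow> int) set"
  assumes "0 < p" "finite U" "uminus ` U = U" "(\<lambda>_. 0) \<in> U"
    and odd: "\<And>i x. i < p \<Longrightarrow> f i (- x) = - f i x"
  shows "\<exists>x\<in>U \<inter> coord_space (Suc p). \<exists>v\<in>coord_space (Suc p) - U. \<exists>y. \<exists>i<p.
    adjacent x v \<and> adjacent x y \<and> (\<forall>k<p. \<bar>f k x\<bar> \<le> \<bar>f i x\<bar>) \<and> f i x * f i y \<le> 0"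
proof (rule ccontr)
  assume contra: "\<not> ?thesis"
  define B where "B = lattice_boundary U (Suc p)"
  \<comment> \<open>Choosing the least index among ties depends on absolute values only, so x and -x
    get the same index.\<close>
  define idx where "idx x = (LEAST i. i < p \<and> (\<forall>k<p. \<bar>f k x\<bar> \<le> \<bar>f i x\<bar>))" for x
  \<comment> \<open>The shift by one keeps the label of index 0 away from 0, so that it can carry a
    sign.\<close>
  define lab where "lab x = (if 0 < f (idx x) x then int (idx x) + 1 else - (int (idx x) + 1))" for x
  have idx: "idx x < p" "\<And>k. k < p \<Longrightarrow> \<bar>f k x\<bar> \<le> \<bar>f (idx x) x\<bar>" for x
  proof -
    have "Max ((\<lambda>k. \<bar>f k x\<bar>) ` {..<p}) \<in> (\<lambda>k. \<bar>f k x\<bar>) ` {..<p}"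
      using assms(1) by (intro Max_in) auto
    then obtain i where "i < p" "\<bar>f i x\<bar> = Max ((\<lambda>k. \<bar>f k x\<bar>) ` {..<p})" by auto
    then have "i < p \<and> (\<forall>k<p. \<bar>f k x\<bar> \<le> \<bar>f i x\<bar>)" by auto
    then have "idx x < p \<and> (\<forall>k<p. \<bar>f k x\<bar> \<le> \<bar>f (idx x) x\<bar>)"
      unfolding idx_def by (rule LeastI)
    then show "idx x < p" "\<And>k. k < p \<Longrightarrow> \<bar>f k x\<bar> \<le> \<bar>f (idx x) x\<bar>" by auto
  qed
  have pos: "0 < f (idx x) x * f (idx x) y" if "x \<in> B" "adjacent x y" for x y
  proof (rule ccontr)
    assume "\<not> ?thesis"
    moreover obtain v where "v \<in> coord_space (Suc p) - U" "adjacent x v"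
      using \<open>x \<in> B\<close> by (auto simp: B_def lattice_boundary_def)
    moreover have "x \<in> U \<inter> coord_space (Suc p)"
      using \<open>x \<in> B\<close> by (auto simp: B_def lattice_boundary_def)
    ultimately show False using contra idx(1)[of x] idx(2)[of _ x] that(2) by (meson not_less)
  qed
  have idx_neg: "idx (- x) = idx x" for x
    unfolding idx_def using odd by (intro arg_cong[where f = Least] ext) auto
  show False
  proof (rule no_antipodal_labelling[OF assms(2-4)])
    fix x assume "x \<in> lattice_boundary U (Suc p)"
    then have x: "x \<in> B" by (simp add: B_def)
    have "f (idx x) x \<noteq> 0" using pos[OF x, of x] by auto
    then show "lab (- x) = - lab x"
      using odd[OF idx(1)[of x], of x] by (auto simp: lab_def idx_neg)
    show "1 \<le> \<bar>lab x\<bar> \<and> \<bar>lab x\<bar> \<le> int p" using idx(1)[of x] by (auto simp: lab_def)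
    fix y assume y: "y \<in> lattice_boundary U (Suc p)" "adjacent x y"
    show "lab x \<noteq> - lab y"
    proof
      assume e: "lab x = - lab y"
      then have "idx y = idx x" by (auto simp: lab_def split: if_splits)
      then have "f (idx x) x * f (idx x) y \<le> 0"
        using e by (auto simp: lab_def mult_le_0_iff split: if_splits)
      then show False using pos[OF x y(2)] by simp
    qed
  qed
qed

text \<open>A Borsuk theorem in p + 1 variables: the symmetric neighbourhood is the set where
  \<open>s\<close> is positive. On grids of mesh 1/(m + 1) the labelling argument gives an inner
  point, an adjacent outer point, and an adjacent point where the dominant component changes sign.
  All three have the same limit along a subsequence, where \<open>s\<close> vanishes by the first
  two.\<close>

theorem odd_even_common_zero:
  fixes f :: "nat \<Rightarrow> (nat \<Rightarrow> real) \<Rightarrow> real" and s :: "(nat \<Rightarrow> real) \<Rightarrow> real"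
  assumes "0 < p"
    and contf: "\<And>i. i < p \<Longrightarrow> continuous_on UNIV (f i)" and conts: "continuous_on UNIV s"
    and odd: "\<And>i x. i < p \<Longrightarrow> f i (\<lambda>k. - x k) = - f i x" and even: "\<And>x. s (\<lambda>k. - x k) = s x"
    and s0: "0 < s (\<lambda>_. 0)"
    and bounded: "\<And>x i. \<forall>k>p. x k = 0 \<Longrightarrow> 0 < s x \<Longrightarrow> \<bar>x i\<bar> \<le> R"
  obtains x where "\<forall>k>p. x k = 0" "s x = 0" "\<forall>i<p. f i x = 0"
proof -
  define g where "g m z = (\<lambda>i. real_of_int (z i) / real (Suc m))" for m and z :: "nat \<Rightarrow> int"
  have g_neg: "g m (- z) = (\<lambda>k. - g m z k)" for m z by (simp add: g_def)
  define U where "U m = {z \<in> coord_space (Suc p). 0 < s (g m z)}" for m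
  have g_zero: "\<forall>k>p. g m z k = 0" if "z \<in> coord_space (Suc p)" for m z
    using that by (simp add: g_def coord_space_def)
  have finU: "finite (U m)" for m
  proof (rule finite_subset)
    let ?N = "\<lceil>R * real (Suc m)\<rceil>"
    show "U m \<subseteq> {z. \<forall>i. (i \<in> {..p} \<longrightarrow> z i \<in> {-?N..?N}) \<and> (i \<notin> {..p} \<longrightarrow> z i = 0)}"
    proof
      fix z assume z: "z \<in> U m"
      have "\<bar>z i\<bar> \<le> ?N" for i
      proof -
        have "\<bar>g m z i\<bar> \<le> R" using z bounded[OF g_zero] by (auto simp: U_def)
        then have "\<bar>real_of_int (z i)\<bar> \<le> R * real (Suc m)"
          by (simp add: g_def field_simps)
        then show ?thesis by linarith
      qed
      then show "z \<in> {z. \<forall>i. (i \<in> {..p} \<longrightarrow> z i \<in> {-?N..?N}) \<and> (i \<notin> {..p} \<longrightarrow> z i = 0)}"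
        using z by (auto simp: U_def coord_space_def abs_le_iff minus_le_iff)
    qed
    show "finite {z :: nat \<Rightarrow> int. \<forall>i. (i \<in> {..p} \<longrightarrow> z i \<in> {-?N..?N}) \<and> (i \<notin> {..p} \<longrightarrow> z i = 0)}"
      by (rule finite_set_of_finite_funs) auto
  qed
  have symU: "uminus ` U m = U m" for m
  proof -
    have "- z \<in> U m" if "z \<in> U m" for z
      using that even[of "g m z"] by (auto simp: U_def g_neg)
    moreover have "z = - (- z)" for z :: "nat \<Rightarrow> int" by (simp add: fun_Compl_def)
    ultimately show ?thesis by (metis image_eqI image_subsetI subsetI subset_antisym)
  qed
  have zeroU: "(\<lambda>_. 0) \<in> U m" for m using s0 by (simp add: U_def coord_space_def g_def)
  have "\<forall>m. \<exists>x v y i. x \<in> U m \<and> v \<in> coord_space (Suc p) - U m \<and> adjacent x v \<and> adjacent x y \<and>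
      i < p \<and> (\<forall>k<p. \<bar>f k (g m x)\<bar> \<le> \<bar>f i (g m x)\<bar>) \<and> f i (g m x) * f i (g m y) \<le> 0"
  proof
    fix m
    show "\<exists>x v y i. x \<in> U m \<and> v \<in> coord_space (Suc p) - U m \<and> adjacent x v \<and> adjacent x y \<and>
      i < p \<and> (\<forall>k<p. \<bar>f k (g m x)\<bar> \<le> \<bar>f i (g m x)\<bar>) \<and> f i (g m x) * f i (g m y) \<le> 0"
      using labelled_grid[OF assms(1) finU symU zeroU, of "\<lambda>i z. f i (g m z)"] odd
      unfolding g_neg by blast
  qed
  then obtain x v y i where
    xU: "\<And>m. x m \<in> U m" and vU: "\<And>m. v m \<in> coord_space (Suc p) - U m"
    and adj: "\<And>m. adjacent (x m) (v m)" "\<And>m. adjacent (x m) (y m)"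
    and i: "\<And>m. i m < p" "\<And>m k. k < p \<Longrightarrow> \<bar>f k (g m (x m))\<bar> \<le> \<bar>f (i m) (g m (x m))\<bar>"
    and opp: "\<And>m. f (i m) (g m (x m)) * f (i m) (g m (y m)) \<le> 0"
    by metis
  have "compact {z :: nat \<Rightarrow> real. \<forall>i. z i \<in> {-R..R}}"
    by (rule compact_fun_box) simp
  then have "seq_compact {z :: nat \<Rightarrow> real. \<forall>i. z i \<in> {-R..R}}" by (rule compact_imp_seq_compact)
  moreover have "\<forall>m. g m (x m) \<in> {z. \<forall>i. z i \<in> {-R..R}}"
  proof
    fix m
    have "\<bar>g m (x m) k\<bar> \<le> R" for k
      using xU[of m] bounded[OF g_zero, of "x m" m] by (simp add: U_def)
    then show "g m (x m) \<in> {z. \<forall>i. z i \<in> {-R..R}}" by (simp add: abs_le_iff minus_le_iff)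
  qed
  ultimately obtain l r where r: "strict_mono r" and l: "((\<lambda>m. g m (x m)) \<circ> r) \<longlonglongrightarrow> l"
    by (rule seq_compactE) blast
  have "(\<lambda>m. 1 / real (Suc m)) \<longlonglongrightarrow> 0" by (rule LIMSEQ_Suc[OF lim_1_over_n])
  then have small: "(\<lambda>m. 1 / real (Suc (r m))) \<longlonglongrightarrow> 0"
    using LIMSEQ_subseq_LIMSEQ[OF _ r] unfolding o_def by blast
  have lx: "(\<lambda>m. g (r m) (x (r m))) \<longlonglongrightarrow> l" using l by (simp add: o_def)
  have near: "(\<lambda>m. g (r m) (w (r m))) \<longlonglongrightarrow> l" if "\<And>m. adjacent (x m) (w m)" for w
    unfolding tendsto_componentwise_iff_fun
  proof
    fix k
    have "(\<lambda>m. g (r m) (w (r m)) k - g (r m) (x (r m)) k) \<longlonglongrightarrow> 0"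
    proof (rule Lim_null_comparison[OF always_eventually small], rule allI)
      fix m
      have "\<bar>w (r m) k - x (r m) k\<bar> \<le> 1"
        using that[of "r m"] unfolding adjacent_def kuhn_le_def by (auto dest!: spec[of _ k])
      then have "\<bar>real_of_int (w (r m) k) - real_of_int (x (r m) k)\<bar> \<le> 1" by linarith
      then show "norm (g (r m) (w (r m)) k - g (r m) (x (r m)) k) \<le> 1 / real (Suc (r m))"
        unfolding g_def diff_divide_distrib[symmetric] by (simp add: divide_right_mono)
    qed
    moreover have "(\<lambda>m. g (r m) (x (r m)) k) \<longlonglongrightarrow> l k"
      using lx unfolding tendsto_componentwise_iff_fun by blast
    ultimately show "(\<lambda>m. g (r m) (w (r m)) k) \<longlonglongrightarrow> l k"
      using tendsto_add by fastforce
  qed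
  have cont: "(\<lambda>m. h (w m)) \<longlonglongrightarrow> h l" if "continuous_on UNIV h" "w \<longlonglongrightarrow> l"
    for h :: "(nat \<Rightarrow> real) \<Rightarrow> real" and w
    using continuous_on_tendsto_compose[OF that] by simp
  have "l k = 0" if "p < k" for k
  proof -
    have "(\<lambda>m. g (r m) (x (r m)) k) \<longlonglongrightarrow> l k"
      using lx unfolding tendsto_componentwise_iff_fun by blast
    moreover have "g (r m) (x (r m)) k = 0" for m using xU g_zero that by (auto simp: U_def)
    ultimately show ?thesis by (simp add: LIMSEQ_const_iff)
  qed
  moreover have "s l = 0"
  proof (rule antisym)
    show "0 \<le> s l"
      using cont[OF conts lx] xU
      by (intro LIMSEQ_le_const[of _ "s l"]) (auto simp: U_def intro!: less_imp_le)
    show "s l \<le> 0"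
      using cont[OF conts near[of v, OF adj(1)]] vU
      by (intro LIMSEQ_le_const2[of _ "s l"]) (auto simp: U_def not_less)
  qed
  moreover have "f k l = 0" if "k < p" for k
  proof -
    let ?X = "\<lambda>m. g (r m) (x (r m))" and ?Y = "\<lambda>m. g (r m) (y (r m))"
    \<comment> \<open>The dominant component is bounded by its jump between the two points because
      of the sign change. Its index varies with m, so the jumps of all components are
      summed.\<close>
    have "(\<lambda>m. \<Sum>j<p. \<bar>f j (?X m) - f j (?Y m)\<bar>) \<longlonglongrightarrow> (\<Sum>j<p. \<bar>f j l - f j l\<bar>)"
      using near[of y, OF adj(2)] lx contf
      by (intro tendsto_sum tendsto_rabs tendsto_diff cont) auto
    moreover have "\<bar>f k (?X m)\<bar> \<le> (\<Sum>j<p. \<bar>f j (?X m) - f j (?Y m)\<bar>)" for m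
    proof -
      have "\<bar>f k (?X m)\<bar> \<le> \<bar>f (i (r m)) (?X m)\<bar>" using i(2) that by blast
      also have "\<dots> \<le> \<bar>f (i (r m)) (?X m) - f (i (r m)) (?Y m)\<bar>"
        using opp[of "r m"] by (auto simp: mult_le_0_iff abs_if)
      also have "\<dots> \<le> (\<Sum>j<p. \<bar>f j (?X m) - f j (?Y m)\<bar>)"
        using i(1) by (intro member_le_sum) auto
      finally show ?thesis .
    qed
    moreover have "(\<lambda>m. \<bar>f k (?X m)\<bar>) \<longlonglongrightarrow> \<bar>f k l\<bar>"
      using lx contf[OF that] by (intro tendsto_rabs cont)
    ultimately have "\<bar>f k l\<bar> \<le> 0" by (intro LIMSEQ_le[of _ "\<bar>f k l\<bar>"]) auto
    then show ?thesis by simp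
  qed
  ultimately show thesis using that by blast
qed

section \<open>Ekeland's variational principle\<close>

text \<open>The maximising form. The relation behind \<open>S\<close> is transitive, so the sets
  \<open>S (X n)\<close> decrease; choosing each successor within 1/(n + 1) of the supremum of
  \<open>J\<close> over the current set makes their diameters tend to 0. Their common point is the
  one sought.\<close>

theorem ekeland:
  fixes J :: "'a::complete_space \<Rightarrow> real"
  assumes "closed G" "x0 \<in> G" "0 < \<epsilon>"
    and bdd: "\<And>x. x \<in> G \<Longrightarrow> J x \<le> b"
    and usc: "\<And>X l a. (\<And>n. X n \<in> G) \<Longrightarrow> X \<longlonglongrightarrow> l \<Longrightarrow> (\<And>n. a \<le> J (X n)) \<Longrightarrow> a \<le> J l"
  obtains x1 where "x1 \<in> G" "J x0 + \<epsilon> * dist x0 x1 \<le> J x1"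
    "\<And>y. y \<in> G \<Longrightarrow> J x1 + \<epsilon> * dist x1 y \<le> J y \<Longrightarrow> y = x1"
proof -
  define S where "S x = {y \<in> G. J x + \<epsilon> * dist x y \<le> J y}" for x
  have S_refl: "x \<in> S x" if "x \<in> G" for x using that by (simp add: S_def)
  have S_trans: "z \<in> S x" if "y \<in> S x" "z \<in> S y" for x y z
  proof -
    have "\<epsilon> * dist x z \<le> \<epsilon> * dist x y + \<epsilon> * dist y z"
      using mult_left_mono[OF dist_triangle[of x z y], of \<epsilon>] assms(3) by (simp add: algebra_simps)
    then show ?thesis using that by (auto simp: S_def)
  qed
  have "\<exists>y. y \<in> S x \<and> (\<forall>z\<in>S x. J z \<le> J y + 1 / real (Suc n))" if x: "x \<in> G" for x n
  proof -
    have bd: "bdd_above (J ` S x)" using bdd by (auto simp: S_def bdd_above_def)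
    have "Sup (J ` S x) - 1 / real (Suc n) < Sup (J ` S x)" by simp
    then obtain y where "y \<in> S x" "Sup (J ` S x) - 1 / real (Suc n) < J y"
      using S_refl[OF x] less_cSup_iff[OF _ bd] by blast
    moreover have "J z \<le> Sup (J ` S x)" if "z \<in> S x" for z
      by (rule cSup_upper[OF imageI[OF that] bd])
    ultimately show ?thesis by (intro exI[of _ y]) force
  qed
  then have "\<forall>n x. \<exists>y. x \<in> G \<longrightarrow> y \<in> S x \<and> (\<forall>z\<in>S x. J z \<le> J y + 1 / real (Suc n))" by blast
  then obtain F where F: "\<And>n x. x \<in> G \<Longrightarrow> F n x \<in> S x"
    "\<And>n x z. x \<in> G \<Longrightarrow> z \<in> S x \<Longrightarrow> J z \<le> J (F n x) + 1 / real (Suc n)"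
    by metis
  define X where "X = rec_nat x0 F"
  have X0: "X 0 = x0" and XS: "X (Suc n) = F n (X n)" for n by (simp_all add: X_def)
  have XG: "X n \<in> G" for n
    by (induction n) (use assms(2) F(1) in \<open>auto simp: X0 XS S_def\<close>)
  have later: "X m \<in> S (X n)" if "n \<le> m" for n m
    using that
  proof (induction m rule: dec_induct)
    case base
    show ?case by (rule S_refl[OF XG])
  next
    case (step m)
    then show ?case using S_trans F(1)[OF XG] by (auto simp: XS)
  qed
  have close: "\<epsilon> * dist (X (Suc n)) y \<le> 1 / real (Suc n)" if "y \<in> S (X (Suc n))" for n y
  proof -
    have "y \<in> S (X n)" using S_trans[OF _ that] later[of n "Suc n"] by simp
    then have "J y \<le> J (X (Suc n)) + 1 / real (Suc n)" using F(2)[OF XG] by (simp add: XS)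
    then show ?thesis using that by (simp add: S_def)
  qed
  have scale: "a \<le> (1 / \<epsilon>) * c" if "\<epsilon> * a \<le> c" for a c
    using that assms(3) by (simp add: pos_le_divide_eq mult.commute)
  have null: "(\<lambda>n. (1 / \<epsilon>) * (1 / real (Suc n))) \<longlonglongrightarrow> 0"
    using tendsto_mult_right_zero[OF LIMSEQ_Suc[OF lim_1_over_n]] by blast
  have "Cauchy (\<lambda>n. X (Suc n))"
    unfolding Cauchy_altdef
  proof (intro allI impI)
    fix e :: real assume "0 < e"
    then obtain N where N: "\<And>n. n \<ge> N \<Longrightarrow> (1 / \<epsilon>) * (1 / real (Suc n)) < e"
      using order_tendstoD(2)[OF null] by (auto simp: eventually_sequentially)
    have "dist (X (Suc m)) (X (Suc n)) < e" if "m \<ge> N" "n > m" for m n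
    proof -
      have "\<epsilon> * dist (X (Suc m)) (X (Suc n)) \<le> 1 / real (Suc m)"
        using close later that by simp
      then have "dist (X (Suc m)) (X (Suc n)) \<le> (1 / \<epsilon>) * (1 / real (Suc m))"
        by (rule scale)
      then show ?thesis using N[OF that(1)] by linarith
    qed
    then show "\<exists>M. \<forall>m\<ge>M. \<forall>n>m. dist (X (Suc m)) (X (Suc n)) < e" by blast
  qed
  then obtain l where l: "(\<lambda>n. X (Suc n)) \<longlonglongrightarrow> l" by (metis Cauchy_convergent convergent_def)
  have lG: "l \<in> G" using closed_sequentially[OF assms(1) _ l] XG by blast
  have lS: "l \<in> S (X n)" for n
  proof -
    have "(\<lambda>m. X (Suc (m + n))) \<longlonglongrightarrow> l" using LIMSEQ_ignore_initial_segment[OF l, of n] by simp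
    \<comment> \<open>The lower bound on \<open>J\<close> varies along the sequence, whereas
      \<open>usc\<close> takes a constant one. The slack \<eta> turns it into a constant along a
      tail.\<close>
    have "J (X n) + \<epsilon> * dist (X n) l - \<eta> \<le> J l" if "0 < \<eta>" for \<eta>
    proof -
      have "(\<lambda>m. J (X n) + \<epsilon> * dist (X n) (X (Suc m))) \<longlonglongrightarrow> J (X n) + \<epsilon> * dist (X n) l"
        by (intro tendsto_intros l)
      then have "\<forall>\<^sub>F m in sequentially. J (X n) + \<epsilon> * dist (X n) l - \<eta>
          < J (X n) + \<epsilon> * dist (X n) (X (Suc m))"
        by (rule order_tendstoD(1)) (simp add: that)
      then obtain N where N: "\<And>m. m \<ge> N \<Longrightarrow> J (X n) + \<epsilon> * dist (X n) l - \<eta>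
          < J (X n) + \<epsilon> * dist (X n) (X (Suc m))"
        unfolding eventually_sequentially by blast
      show ?thesis
      proof (rule usc)
        show "(\<lambda>m. X (Suc (m + (N + n)))) \<longlonglongrightarrow> l"
          using LIMSEQ_ignore_initial_segment[OF l, of "N + n"] by simp
        fix m
        have "J (X n) + \<epsilon> * dist (X n) (X (Suc (m + (N + n)))) \<le> J (X (Suc (m + (N + n))))"
          using later[of n "Suc (m + (N + n))"] by (simp add: S_def)
        then show "J (X n) + \<epsilon> * dist (X n) l - \<eta> \<le> J (X (Suc (m + (N + n))))"
          using N[of "m + (N + n)"] by linarith
      qed (rule XG)
    qed
    then have "J (X n) + \<epsilon> * dist (X n) l \<le> J l + \<eta>" if "0 < \<eta>" for \<eta>
      using that by (metis diff_le_eq)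
    then have "J (X n) + \<epsilon> * dist (X n) l \<le> J l" by (rule field_le_epsilon)
    then show ?thesis using lG by (simp add: S_def)
  qed
  show thesis
  proof
    show "l \<in> G" by (rule lG)
    show "J x0 + \<epsilon> * dist x0 l \<le> J l" using lS[of 0] by (simp add: X0 S_def)
    fix y assume y: "y \<in> G" "J l + \<epsilon> * dist l y \<le> J y"
    then have "y \<in> S (X (Suc n))" for n using S_trans[OF lS] by (simp add: S_def)
    then have "\<epsilon> * dist (X (Suc n)) y \<le> 1 / real (Suc n)" for n by (rule close)
    then have "dist (X (Suc n)) y \<le> (1 / \<epsilon>) * (1 / real (Suc n))" for n by (rule scale)
    then have "norm (dist (X (Suc n)) y) \<le> (1 / \<epsilon>) * (1 / real (Suc n))" for n
      unfolding real_norm_def abs_of_nonneg[OF zero_le_dist] .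
    then have "(\<lambda>n. dist (X (Suc n)) y) \<longlonglongrightarrow> 0"
      by (intro Lim_null_comparison[OF always_eventually null]) blast
    then have "(\<lambda>n. X (Suc n)) \<longlonglongrightarrow> y" using tendsto_dist_iff by blast
    then show "y = l" using LIMSEQ_unique l by blast
  qed
qed

section \<open>Minimax over weak-to-strong continuous maps\<close>

lemma weak_conv_add:
  assumes "weak_conv x u" "b \<longlonglongrightarrow> c"
  shows "weak_conv (\<lambda>n. x n + b n) (u + c)"
  using tendsto_add[OF _ tendsto_inner[OF assms(2) tendsto_const]] assms(1)
  unfolding weak_conv_def inner_add_left by blast

lemma weak_conv_subseq: "weak_conv x u \<Longrightarrow> strict_mono r \<Longrightarrow> weak_conv (\<lambda>n. x (r n)) u"
  unfolding weak_conv_def using LIMSEQ_subseq_LIMSEQ unfolding o_def by blast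

lemma weak_conv_if_tendsto: "x \<longlonglongrightarrow> u \<Longrightarrow> weak_conv x u"
  unfolding weak_conv_def by (auto intro!: tendsto_intros)

text \<open>\<open>B\<close> abstracts the ball of X_k^+ and \<open>E\<close> its bounding sphere.
  The assumption \<open>lsc\<close> couples weak convergence of base points with strong convergence
  of shifts, which is what a weak-to-strong continuous map produces along its graph.\<close>

locale weak_minimax =
  fixes Phi :: "'a::{real_inner,complete_space} \<Rightarrow> real" and D :: "'a \<Rightarrow> 'a \<Rightarrow>\<^sub>L real"
    and B E :: "'a set" and L rho :: real
  assumes deriv: "\<And>u. (Phi has_derivative blinfun_apply (D u)) (at u)"
    and Phi_even: "\<And>u. Phi (- u) = Phi u"
    and D_weak: "\<And>x u. weak_conv x u \<Longrightarrow> weak_conv_dual (\<lambda>n. D (x n)) (D u)"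
    and B_bound: "\<And>u. u \<in> B \<Longrightarrow> norm u \<le> rho"
    and B_ne: "B \<noteq> {}" and E_sub: "E \<subseteq> B"
    and B_compact: "\<And>x. (\<And>n. x n \<in> B) \<Longrightarrow> \<exists>l\<in>B. \<exists>r::nat \<Rightarrow> nat. strict_mono r \<and> weak_conv (\<lambda>n. x (r n)) l"
    and lsc: "\<And>x l b b' c. (\<And>n. x n \<in> B) \<Longrightarrow> l \<in> B \<Longrightarrow> weak_conv x l \<Longrightarrow> b \<longlonglongrightarrow> b' \<Longrightarrow>
        (\<And>n. Phi (x n + b n) \<le> c) \<Longrightarrow> Phi (l + b') \<le> c"
begin

definition weak_strong :: "('a \<Rightarrow> 'a) \<Rightarrow> bool" where
  "weak_strong k \<longleftrightarrow> (\<forall>x u. (\<forall>n. x n \<in> B) \<longrightarrow> u \<in> B \<longrightarrow> weak_conv x u \<longrightarrow> (\<lambda>n. k (x n)) \<longlonglongrightarrow> k u)"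

text \<open>The type of bounded continuous functions supplies the complete sup metric for Ekeland's
  principle. The lower bound on \<open>E\<close> is the only boundary condition: it is closed under
  limits and is preserved by moves that do not decrease \<open>Phi\<close> on the graph.\<close>

definition admissible :: "('a \<Rightarrow>\<^sub>C 'a) set" where
  "admissible = {k :: 'a \<Rightarrow>\<^sub>C 'a. (\<forall>u. k (- u) = - k u) \<and> weak_strong k \<and> (\<forall>u\<in>E. L \<le> Phi (u + k u))}"

definition lowest :: "('a \<Rightarrow>\<^sub>C 'a) \<Rightarrow> real" where
  "lowest k = Inf ((\<lambda>u. Phi (u + k u)) ` B)"

lemma Phi_cont: "continuous_on S Phi"
  using deriv by (meson continuous_at_imp_continuous_on has_derivative_continuous)

lemma D_uminus: "D (- u) w = - D u w"
proof -
  have "((\<lambda>x. Phi (- x)) has_derivative (\<lambda>w. D (- u) (- w))) (at u)"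
    by (rule has_derivative_compose[OF _ deriv, of uminus uminus]) (intro derivative_intros)
  then have "(Phi has_derivative (\<lambda>w. - D (- u) w)) (at u)"
    by (simp add: Phi_even blinfun.minus_right)
  from has_derivative_unique[OF this deriv] show ?thesis by (metis minus_minus)
qed

lemma weak_graph:
  assumes "k \<in> admissible" "\<And>n. x n \<in> B" "u \<in> B" "weak_conv x u"
  shows "(\<lambda>n. k (x n)) \<longlonglongrightarrow> k u" "weak_conv (\<lambda>n. x n + k (x n)) (u + k u)"
proof -
  show "(\<lambda>n. k (x n)) \<longlonglongrightarrow> k u" using assms by (simp add: admissible_def weak_strong_def)
  then show "weak_conv (\<lambda>n. x n + k (x n)) (u + k u)" by (rule weak_conv_add[OF assms(4)])
qed

lemma lsc_lim:
  assumes k: "k \<in> admissible" and x: "\<And>n. x n \<in> B" "u \<in> B" "weak_conv x u"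
    and c: "\<And>n. Phi (x n + k (x n)) \<le> c n" "c \<longlonglongrightarrow> c'"
  shows "Phi (u + k u) \<le> c'"
proof (rule field_le_epsilon)
  fix \<eta> :: real assume "0 < \<eta>"
  then have "\<forall>\<^sub>F n in sequentially. c n < c' + \<eta>" using c(2) by (intro order_tendstoD(2)) auto
  then obtain N where N: "\<And>n. n \<ge> N \<Longrightarrow> c n < c' + \<eta>" unfolding eventually_sequentially by blast
  have mono: "strict_mono (\<lambda>n. n + N)" by (simp add: strict_mono_def)
  show "Phi (u + k u) \<le> c' + \<eta>"
  proof (rule lsc)
    show "\<And>n. x (n + N) \<in> B" by (rule x)
    show "u \<in> B" by (rule x)
    show "weak_conv (\<lambda>n. x (n + N)) u" by (rule weak_conv_subseq[OF x(3) mono])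
    show "(\<lambda>n. k (x (n + N))) \<longlonglongrightarrow> k u"
      by (rule LIMSEQ_ignore_initial_segment[OF weak_graph(1)[OF k x]])
    show "Phi (x (n + N) + k (x (n + N))) \<le> c' + \<eta>" for n
      using c(1)[of "n + N"] N[of "n + N"] by simp
  qed
qed

text \<open>Points with values tending to minus infinity would have a weak limit in
  \<open>B\<close>, whose value \<open>lsc\<close> pushes below every integer.\<close>

lemma bdd_below_graph:
  assumes k: "k \<in> admissible"
  shows "bdd_below ((\<lambda>u. Phi (u + k u)) ` B)"
proof (rule ccontr)
  assume "\<not> ?thesis"
  then have "\<exists>u\<in>B. Phi (u + k u) \<le> - real n" for n
    unfolding bdd_below_def by (metis (no_types, lifting) imageE linear)
  then obtain x where x: "\<And>n. x n \<in> B" "\<And>n. Phi (x n + k (x n)) \<le> - real n" by metis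
  obtain l r where l: "l \<in> B" and r: "strict_mono (r :: nat \<Rightarrow> nat)" and w: "weak_conv (\<lambda>n. x (r n)) l"
    using B_compact[of x] x(1) by blast
  obtain M :: nat where M: "- Phi (l + k l) < real M" using reals_Archimedean2 by blast
  have mono: "strict_mono (\<lambda>n. n + M)" by (simp add: strict_mono_def)
  have "Phi (l + k l) \<le> - real M"
  proof (rule lsc_lim[OF k, of "\<lambda>n. x (r (n + M))"])
    show "weak_conv (\<lambda>n. x (r (n + M))) l" by (rule weak_conv_subseq[OF w mono])
    show "Phi (x (r (n + M)) + k (x (r (n + M)))) \<le> - real M" for n
    proof -
      have "n + M \<le> r (n + M)" by (rule seq_suble[OF r])
      then show ?thesis using x(2)[of "r (n + M)"] by linarith
    qed
  qed (use x l in auto)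
  then show False using M by simp
qed

lemma lowest_le: "k \<in> admissible \<Longrightarrow> u \<in> B \<Longrightarrow> lowest k \<le> Phi (u + k u)"
  unfolding lowest_def by (rule cInf_lower[OF imageI bdd_below_graph])

lemma le_lowest:
  fixes k :: "'a \<Rightarrow>\<^sub>C 'a"
  shows "(\<And>u. u \<in> B \<Longrightarrow> a \<le> Phi (u + k u)) \<Longrightarrow> a \<le> lowest k"
  unfolding lowest_def using B_ne by (intro cInf_greatest) auto

lemma lowest_attained_limit:
  assumes k: "k \<in> admissible" and x: "\<And>n. x n \<in> B" and e: "\<eta> \<longlonglongrightarrow> 0"
    and le: "\<And>n. Phi (x n + k (x n)) \<le> lowest k + \<eta> n"
  obtains l r where "l \<in> B" "strict_mono (r :: nat \<Rightarrow> nat)" "weak_conv (\<lambda>n. x (r n)) l"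
    "Phi (l + k l) = lowest k"
proof -
  obtain l r where l: "l \<in> B" and r: "strict_mono (r :: nat \<Rightarrow> nat)" and w: "weak_conv (\<lambda>n. x (r n)) l"
    using B_compact[of x] x by blast
  have "(\<lambda>n. \<eta> (r n)) \<longlonglongrightarrow> 0" using LIMSEQ_subseq_LIMSEQ[OF e r] by (simp add: o_def)
  then have "(\<lambda>n. lowest k + \<eta> (r n)) \<longlonglongrightarrow> lowest k + 0" by (intro tendsto_intros)
  then have "Phi (l + k l) \<le> lowest k"
    using lsc_lim[OF k _ l w, of "\<lambda>n. lowest k + \<eta> (r n)"] x le by simp
  then show thesis using that l r w lowest_le[OF k l] by force
qed

text \<open>Oddness and the bound on \<open>E\<close> pass to pointwise limits. Weak-to-strong
  continuity uses uniform convergence, through an estimate in three parts.\<close>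

lemma closed_admissible: "closed admissible"
  unfolding closed_sequential_limits
proof (intro allI impI)
  fix X k assume X: "(\<forall>n. X n \<in> admissible) \<and> X \<longlonglongrightarrow> k"
  have pt: "(\<lambda>n. apply_bcontfun (X n) u) \<longlonglongrightarrow> k u" for u
  proof -
    have "(\<lambda>n. dist (X n) k) \<longlonglongrightarrow> 0" using X tendsto_dist_iff by blast
    then have "(\<lambda>n. dist (X n u) (k u)) \<longlonglongrightarrow> 0"
      by (rule Lim_null_comparison[rotated]) (simp add: dist_bounded)
    then show ?thesis using tendsto_dist_iff by blast
  qed
  have "k (- u) = - k u" for u
  proof (rule LIMSEQ_unique[OF pt])
    have "X n (- u) = - X n u" for n using X by (simp add: admissible_def)
    then show "(\<lambda>n. X n (- u)) \<longlonglongrightarrow> - k u" using tendsto_minus[OF pt[of u]] by simp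
  qed
  moreover have "L \<le> Phi (u + k u)" if "u \<in> E" for u
  proof -
    have "(\<lambda>n. Phi (u + X n u)) \<longlonglongrightarrow> Phi (u + k u)"
      using continuous_on_tendsto_compose[OF Phi_cont[of UNIV], of "\<lambda>n. u + X n u" "u + k u"] pt[of u]
      by (simp add: tendsto_add)
    moreover have "\<forall>n\<ge>0. L \<le> Phi (u + X n u)" using X that by (simp add: admissible_def)
    ultimately show ?thesis by (intro LIMSEQ_le_const) blast+
  qed
  moreover have "weak_strong k"
    unfolding weak_strong_def
  proof (intro allI impI)
    fix x u assume x: "\<forall>n. x n \<in> B" "u \<in> B" "weak_conv x u"
    show "(\<lambda>n. k (x n)) \<longlonglongrightarrow> k u"
    proof (rule metric_LIMSEQ_I)
      fix e :: real assume "0 < e"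
      then have "0 < e / 3" by simp
      moreover have "(\<lambda>n. dist (X n) k) \<longlonglongrightarrow> 0" using X tendsto_dist_iff by blast
      ultimately obtain n where n: "dist (X n) k < e / 3"
        using order_tendstoD(2)[of _ 0 sequentially "e / 3"] unfolding eventually_sequentially by blast
      have "X n \<in> admissible" using X by blast
      then have "(\<lambda>m. X n (x m)) \<longlonglongrightarrow> X n u" using weak_graph(1) x by blast
      then obtain N where N: "\<And>m. m \<ge> N \<Longrightarrow> dist (X n (x m)) (X n u) < e / 3"
        using metric_LIMSEQ_D \<open>0 < e / 3\<close> by meson
      have "dist (k (x m)) (k u) < e" if "m \<ge> N" for m
      proof -
        have "dist (X n (x m)) (k (x m)) < e / 3" "dist (X n u) (k u) < e / 3"
          using n dist_bounded[of "X n" _ k] order_le_less_trans by blast+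
        then show ?thesis using N[OF that] dist_triangle[of "k (x m)" "k u" "X n u"]
            dist_triangle[of "k (x m)" "X n u" "X n (x m)"] dist_commute[of "k (x m)" "X n (x m)"]
          by linarith
      qed
      then show "\<exists>N. \<forall>m\<ge>N. dist (k (x m)) (k u) < e" by blast
    qed
  qed
  ultimately show "k \<in> admissible" by (simp add: admissible_def)
qed

text \<open>An infimum of the continuous maps \<open>k \<mapsto> Phi (u + k u)\<close> is upper
  semicontinuous.\<close>

lemma lowest_usc:
  assumes "\<And>n. X n \<in> admissible" "X \<longlonglongrightarrow> k" "\<And>n. a \<le> lowest (X n)"
  shows "a \<le> lowest k"
proof (rule le_lowest)
  fix u assume u: "u \<in> B"
  have "(\<lambda>n. dist (X n) k) \<longlonglongrightarrow> 0" using assms(2) tendsto_dist_iff by blast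
  then have "(\<lambda>n. dist (X n u) (k u)) \<longlonglongrightarrow> 0"
    by (rule Lim_null_comparison[rotated]) (simp add: dist_bounded)
  then have "(\<lambda>n. X n u) \<longlonglongrightarrow> k u" using tendsto_dist_iff by blast
  then have "(\<lambda>n. Phi (u + X n u)) \<longlonglongrightarrow> Phi (u + k u)"
    using continuous_on_tendsto_compose[OF Phi_cont[of UNIV], of "\<lambda>n. u + X n u" "u + k u"]
    by (simp add: tendsto_add)
  moreover have "\<forall>n\<ge>0. a \<le> Phi (u + X n u)" using assms(1,3) lowest_le[OF _ u] order_trans by blast
  ultimately show "a \<le> Phi (u + k u)" by (intro LIMSEQ_le_const) blast+
qed

end

section \<open>Pseudogradients from finitely many test directions\<close>

text \<open>Weak continuity controls the derivative only direction by direction. Separability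
  provides one countable list of directions that detects the norm of every functional, and
  compactness later reduces it to a finite part.\<close>

lemma obtain_norming_sequence:
  assumes "\<exists>A::'a::real_normed_vector set. countable A \<and> closure A = UNIV"
  obtains w :: "nat \<Rightarrow> 'a::real_normed_vector" where "\<And>i. norm (w i) \<le> 1"
    "\<And>(f :: 'a::real_normed_vector \<Rightarrow>\<^sub>L real) c. 0 \<le> c \<Longrightarrow> c < norm f \<Longrightarrow> \<exists>i. c < blinfun_apply f (w i)"
proof -
  obtain A :: "'a set" where A: "countable A" "closure A = UNIV" using assms by blast
  have "A \<noteq> {}" using A(2) by auto
  \<comment> \<open>Dividing by \<open>max 1 (norm a)\<close> maps into the unit ball continuously,
    so density of \<open>A\<close> carries over to the values of \<open>f\<close> there.\<close>
  define q where "q a = a /\<^sub>R max 1 (norm a)" for a :: 'a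
  define w where "w i = q (from_nat_into A i)" for i
  show thesis
  proof
    show "norm (w i) \<le> 1" for i
      by (simp add: w_def q_def divide_simps)
    fix f :: "'a \<Rightarrow>\<^sub>L real" and c :: real assume c: "0 \<le> c" "c < norm f"
    have "\<exists>x. c * norm x < \<bar>f x\<bar>"
    proof (rule ccontr)
      assume "\<not> ?thesis"
      then have "norm f \<le> c" using c(1) by (intro norm_blinfun_bound) (auto simp: not_less)
      then show False using c(2) by simp
    qed
    then obtain x0 where x0: "c * norm x0 < \<bar>f x0\<bar>" by blast
    define x where "x = (if 0 < f x0 then x0 else - x0)"
    have x: "c * norm x < f x" using x0 by (auto simp: x_def blinfun.minus_right)
    then have "x \<noteq> 0" by auto
    have "c < f (q (x /\<^sub>R norm x))"
      using x \<open>x \<noteq> 0\<close> by (simp add: q_def blinfun.scaleR_right field_simps)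
    moreover have "continuous_on UNIV (\<lambda>a. f (q a))"
      unfolding q_def by (intro continuous_intros) (auto simp: max_def)
    then have "open {a. c < f (q a)}" by (rule open_Collect_less[OF continuous_on_const])
    ultimately have "{a. c < f (q a)} \<inter> A \<noteq> {}"
      using open_Int_closure_eq_empty[of "{a. c < f (q a)}" A] A(2) by blast
    then obtain a where "a \<in> A" "c < f (q a)" by blast
    then show "\<exists>i. c < blinfun_apply f (w i)"
      using from_nat_into_surj[OF A(1)] unfolding w_def by metis
  qed
qed

text \<open>For c \<ge> 0 this is the shrinkage function, zero on [-c, c]. As a weight it replaces a
  partition of unity: it is continuous, keeps the sign of a slope and discards slopes of size at
  most c, and being odd it makes the pseudogradient odd.\<close>

definition soft_threshold :: "real \<Rightarrow> real \<Rightarrow> real" where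
  "soft_threshold c t = max 0 (t - c) - max 0 (- t - c)"

lemma soft_threshold_uminus [simp]: "soft_threshold c (- t) = - soft_threshold c t"
  by (simp add: soft_threshold_def)

lemma continuous_soft_threshold: "continuous_on S (soft_threshold c)"
  unfolding soft_threshold_def by (intro continuous_intros)

lemma soft_threshold_pos: "0 \<le> c \<Longrightarrow> c < t \<Longrightarrow> 0 < soft_threshold c t"
  by (simp add: soft_threshold_def)

text \<open>A nonzero weight means that the slope \<open>t\<close> exceeds c in size; a slope
  \<open>y\<close> at distance at most d still has that sign and size at least c - d. This keeps an
  ascent direction valid after a small displacement.\<close>

lemma soft_threshold_mult_ge:
  assumes "0 \<le> c" "\<bar>y - t\<bar> \<le> d" "d \<le> c"
  shows "(c - d) * \<bar>soft_threshold c t\<bar> \<le> soft_threshold c t * y"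
proof -
  consider "t > c" | "t < - c" | "\<bar>t\<bar> \<le> c" by linarith
  then show ?thesis
  proof cases
    case 1
    have "soft_threshold c t * (c - d) \<le> soft_threshold c t * y"
      using 1 assms soft_threshold_pos[of c t] by (intro mult_left_mono) auto
    then show ?thesis using soft_threshold_pos[of c t] 1 assms by (simp add: mult.commute)
  next
    case 2
    have p: "0 < - soft_threshold c t" using soft_threshold_pos[of c "- t"] 2 assms by simp
    have "- soft_threshold c t * (c - d) \<le> - soft_threshold c t * (- y)"
      using 2 assms p by (intro mult_left_mono) auto
    then show ?thesis using p by (simp add: mult.commute)
  next
    case 3
    then have "soft_threshold c t = 0" by (simp add: soft_threshold_def)
    then show ?thesis by simp
  qed
qed

context weak_minimax
begin

lemma D_graph_weak:
  assumes "k \<in> admissible" "\<And>n. x n \<in> B" "u \<in> B" "weak_conv x u" "v \<longlonglongrightarrow> 0"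
  shows "(\<lambda>n. D (x n + k (x n) + v n) w) \<longlonglongrightarrow> D (u + k u) w"
proof -
  have "weak_conv (\<lambda>n. x n + k (x n) + v n) (u + k u + 0)"
    by (rule weak_conv_add[OF weak_graph(2)[OF assms(1-4)] assms(5)])
  then show ?thesis using D_weak by (fastforce simp: weak_conv_dual_def)
qed

lemma D_continuous: "continuous_on S (\<lambda>u. D u w)"
proof (rule continuous_on_sequentiallyI)
  fix u a assume "u \<longlonglongrightarrow> (a :: 'a)"
  then show "(\<lambda>n. D (u n) w) \<longlonglongrightarrow> D a w"
    using D_weak[OF weak_conv_if_tendsto] by (simp add: weak_conv_dual_def)
qed

text \<open>Uniformity over the noncompact set \<open>B\<close> comes from weak compactness: a
  violating sequence of base points has a weak limit, where weak continuity makes the difference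
  vanish in each of the finitely many directions.\<close>

lemma D_uniform:
  assumes k: "k \<in> admissible" and "0 < \<epsilon>"
  obtains t where "0 < t" "\<And>u v i. u \<in> B \<Longrightarrow> norm v \<le> t \<Longrightarrow> i < (N::nat) \<Longrightarrow>
      \<bar>D (u + k u + v) (w i) - D (u + k u) (w i)\<bar> \<le> \<epsilon>"
proof -
  define q where "q u v = (\<Sum>i<N. \<bar>D (u + k u + v) (w i) - D (u + k u) (w i)\<bar>)" for u v
  have "\<exists>t>0. \<forall>u\<in>B. \<forall>v. norm v \<le> t \<longrightarrow> q u v \<le> \<epsilon>"
  proof (rule ccontr)
    assume c: "\<not> ?thesis"
    have "\<exists>u v. u \<in> B \<and> norm v \<le> 1 / real (Suc n) \<and>
        \<epsilon> < q u v" for n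
    proof -
      have "0 < 1 / real (Suc n)" by simp
      then show ?thesis using c by (meson not_le)
    qed
    then obtain x v where x: "\<And>n. x n \<in> B" and v: "\<And>n. norm (v n) \<le> 1 / real (Suc n)"
      and gt: "\<And>n. \<epsilon> < q (x n) (v n)"
      by metis
    obtain l r where l: "l \<in> B" and r: "strict_mono (r :: nat \<Rightarrow> nat)" and wc: "weak_conv (\<lambda>n. x (r n)) l"
      using B_compact[of x] x by blast
    have "v \<longlonglongrightarrow> 0"
      by (rule Lim_null_comparison[OF always_eventually LIMSEQ_Suc[OF lim_1_over_n]]) (use v in blast)
    then have v0: "(\<lambda>n. v (r n)) \<longlonglongrightarrow> 0" using LIMSEQ_subseq_LIMSEQ[OF _ r] unfolding o_def by blast
    have z0: "(\<lambda>n. 0 :: 'a) \<longlonglongrightarrow> 0" by simp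
    have "(\<lambda>n. \<Sum>i<N. \<bar>D (x (r n) + k (x (r n)) + v (r n)) (w i) - D (x (r n) + k (x (r n)) + 0) (w i)\<bar>)
        \<longlonglongrightarrow> (\<Sum>i<N. \<bar>D (l + k l) (w i) - D (l + k l) (w i)\<bar>)"
      by (intro tendsto_sum tendsto_rabs tendsto_diff D_graph_weak[OF k x l wc v0] D_graph_weak[OF k x l wc z0])
    then have "\<epsilon> \<le> (\<Sum>i<N. \<bar>D (l + k l) (w i) - D (l + k l) (w i)\<bar>)"
      by (rule LIMSEQ_le_const) (use gt in \<open>auto simp: q_def intro!: less_imp_le\<close>)
    then show False using assms(2) by simp
  qed
  then obtain t where "0 < t" and t: "\<And>u v. u \<in> B \<Longrightarrow> norm v \<le> t \<Longrightarrow>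
      q u v \<le> \<epsilon>" by blast
  show thesis
  proof (rule that[OF \<open>0 < t\<close>])
    fix u v :: 'a and i assume a: "u \<in> B" "norm v \<le> t" "i < N"
    have "\<bar>D (u + k u + v) (w i) - D (u + k u) (w i)\<bar>
        \<le> (\<Sum>i<N. \<bar>D (u + k u + v) (w i) - D (u + k u) (w i)\<bar>)"
      by (rule member_le_sum[where f = "\<lambda>i. \<bar>D (u + k u + v) (w i) - D (u + k u) (w i)\<bar>"]) (use a in auto)
    then show "\<bar>D (u + k u + v) (w i) - D (u + k u) (w i)\<bar> \<le> \<epsilon>" using t[OF a(1,2)] unfolding q_def by linarith
  qed
qed

text \<open>Steepness at exact minimisers spreads to all nearly lowest points, with finitely many
  directions. Otherwise take \<open>N = n\<close> and \<open>s = 1 / (n + 1)\<close>: the weak limit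
  of the violating points is a minimiser with a steep direction \<open>w i\<close>, and this
  direction enters the sums as soon as the subsequence index exceeds i.\<close>

lemma slope_near_bottom:
  assumes k: "k \<in> admissible" and c: "0 \<le> c"
    and w: "\<And>u. u \<in> B \<Longrightarrow> Phi (u + k u) = lowest k \<Longrightarrow> \<exists>i. c < D (u + k u) (w i)"
  obtains N :: nat and s :: real where "0 < s" "\<And>u. u \<in> B \<Longrightarrow> Phi (u + k u) \<le> lowest k + s \<Longrightarrow>
      s \<le> (\<Sum>i<N. \<bar>soft_threshold c (D (u + k u) (w i))\<bar>)"
proof -
  define q where "q N u = (\<Sum>i<N. \<bar>soft_threshold c (D (u + k u) (w i))\<bar>)" for N u
  have "\<exists>N s. 0 < s \<and> (\<forall>u\<in>B. Phi (u + k u) \<le> lowest k + s \<longrightarrow> s \<le> q N u)"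
  proof (rule ccontr)
    assume contra: "\<not> ?thesis"
    have "\<exists>u\<in>B. Phi (u + k u) \<le> lowest k + 1 / real (Suc n) \<and> q n u < 1 / real (Suc n)" for n
    proof -
      have "0 < 1 / real (Suc n)" by simp
      then show ?thesis using contra by (meson not_le)
    qed
    then obtain x where x: "\<And>n. x n \<in> B"
      and le: "\<And>n. Phi (x n + k (x n)) \<le> lowest k + 1 / real (Suc n)"
      and small: "\<And>n. q n (x n) < 1 / real (Suc n)"
      by metis
    have null: "(\<lambda>n. 1 / real (Suc n)) \<longlonglongrightarrow> 0" by (rule LIMSEQ_Suc[OF lim_1_over_n])
    obtain l r where l: "l \<in> B" and r: "strict_mono (r :: nat \<Rightarrow> nat)" and wc: "weak_conv (\<lambda>n. x (r n)) l"
      and bottom: "Phi (l + k l) = lowest k"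
      using lowest_attained_limit[OF k x null le] by blast
    obtain i where i: "c < D (l + k l) (w i)" using w[OF l bottom] by blast
    have z0: "(\<lambda>n. 0 :: 'a) \<longlonglongrightarrow> 0" by simp
    have "(\<lambda>n. D (x (r n) + k (x (r n))) (w i)) \<longlonglongrightarrow> D (l + k l) (w i)"
      using D_graph_weak[OF k x l wc z0] by simp
    then have lim: "(\<lambda>n. \<bar>soft_threshold c (D (x (r n) + k (x (r n))) (w i))\<bar>)
        \<longlonglongrightarrow> \<bar>soft_threshold c (D (l + k l) (w i))\<bar>"
      by (intro tendsto_rabs continuous_on_tendsto_compose[OF continuous_soft_threshold[of UNIV]]) auto
    have "\<bar>soft_threshold c (D (l + k l) (w i))\<bar> \<le> 0"
    proof (rule LIMSEQ_le[OF lim])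
      show "(\<lambda>n. 1 / real (Suc (r n))) \<longlonglongrightarrow> 0"
        using LIMSEQ_subseq_LIMSEQ[OF null r] by (simp add: o_def)
      have "\<bar>soft_threshold c (D (x (r n) + k (x (r n))) (w i))\<bar> \<le> 1 / real (Suc (r n))" if "n > i" for n
      proof -
        have "i < r n" using that seq_suble[OF r, of n] by linarith
        then have "\<bar>soft_threshold c (D (x (r n) + k (x (r n))) (w i))\<bar> \<le> q (r n) (x (r n))"
          unfolding q_def by (intro member_le_sum[where f = "\<lambda>i. \<bar>soft_threshold c (D (x (r n) + k (x (r n))) (w i))\<bar>"]) auto
        then show ?thesis using small[of "r n"] by linarith
      qed
      then show "\<exists>N. \<forall>n\<ge>N. \<bar>soft_threshold c (D (x (r n) + k (x (r n))) (w i))\<bar> \<le> 1 / real (Suc (r n))"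
        by (intro exI[of _ "Suc i"]) auto
    qed
    then show False using soft_threshold_pos[OF c i] by simp
  qed
  then show thesis using that unfolding q_def by blast
qed

end

context weak_minimax
begin

text \<open>If no lowest point of the graph of \<open>k\<close> is almost critical, then a small perturbation of \<open>k\<close>
  along a pseudogradient raises the lowest level. The pseudogradient never decreases \<open>Phi\<close> on the
  graph, so the constraint on \<open>E\<close> is preserved.\<close>

lemma deformation:
  assumes k: "k \<in> admissible" and e: "0 < \<epsilon>"
    and sep: "\<exists>A::'a set. countable A \<and> closure A = UNIV"
    and big: "\<And>u. u \<in> B \<Longrightarrow> Phi (u + k u) = lowest k \<Longrightarrow> 2 * \<epsilon> < norm (D (u + k u))"
  obtains k' where "k' \<in> admissible" "k' \<noteq> k" "lowest k + \<epsilon> * dist k k' \<le> lowest k'"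
proof -
  obtain w :: "nat \<Rightarrow> 'a" where w1: "\<And>i. norm (w i) \<le> 1"
    and w2: "\<And>(f :: 'a \<Rightarrow>\<^sub>L real) c. 0 \<le> c \<Longrightarrow> c < norm f \<Longrightarrow> \<exists>i. c < blinfun_apply f (w i)"
    using obtain_norming_sequence[OF sep] by blast
  obtain N s where s: "0 < s" and steep: "\<And>u. u \<in> B \<Longrightarrow> Phi (u + k u) \<le> lowest k + s \<Longrightarrow>
      s \<le> (\<Sum>i<N. \<bar>soft_threshold (2 * \<epsilon>) (D (u + k u) (w i))\<bar>)"
  proof (rule slope_near_bottom[OF k, of "2 * \<epsilon>" w])
    show "0 \<le> 2 * \<epsilon>" using e by simp
    show "\<exists>i. 2 * \<epsilon> < D (u + k u) (w i)" if "u \<in> B" "Phi (u + k u) = lowest k" for u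
      using w2[OF _ big[OF that]] e by simp
  qed blast
  obtain t0 where t0: "0 < t0" and unif: "\<And>u v i. u \<in> B \<Longrightarrow> norm v \<le> t0 \<Longrightarrow> i < N \<Longrightarrow>
      \<bar>D (u + k u + v) (w i) - D (u + k u) (w i)\<bar> \<le> \<epsilon> / 2"
    using D_uniform[OF k, of "\<epsilon> / 2" N w] e by (metis half_gt_zero)
  define a where "a i u = soft_threshold (2 * \<epsilon>) (D (u + k u) (w i))" for i u
  define \<sigma> where "\<sigma> u = (\<Sum>i<N. \<bar>a i u\<bar>)" for u
  \<comment> \<open>Dividing by \<open>max s (\<sigma> u)\<close> bounds the norm by 1, stays
    continuous where \<sigma> vanishes, and is a full normalisation where
    \<open>\<sigma> u \<ge> s\<close>, hence near the bottom.\<close>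
  define \<xi> where "\<xi> u = (1 / max s (\<sigma> u)) *\<^sub>R (\<Sum>i<N. a i u *\<^sub>R w i)" for u
  \<comment> \<open>\<open>t0\<close> keeps the slopes within \<epsilon>/2 of their initial values.
    The bound s/(2\<epsilon>) makes the target gain at most s, which points above
    \<open>lowest k + s\<close> have to spare.\<close>
  define t where "t = min t0 (s / (2 * \<epsilon>))"
  have t: "0 < t" "t \<le> t0" "t \<le> s / (2 * \<epsilon>)" using t0 s e by (auto simp: t_def)
  have \<sigma>0: "0 \<le> \<sigma> u" for u unfolding \<sigma>_def by (intro sum_nonneg) simp
  have maxpos: "0 < max s (\<sigma> u)" for u using s by simp
  have \<xi>1: "norm (\<xi> u) \<le> 1" for u
  proof -
    have "norm (\<Sum>i<N. a i u *\<^sub>R w i) \<le> \<sigma> u"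
      unfolding \<sigma>_def
    proof (rule sum_norm_le)
      fix i
      show "norm (a i u *\<^sub>R w i) \<le> \<bar>a i u\<bar>" using w1[of i] by (simp add: mult_left_le)
    qed
    also have "\<dots> \<le> max s (\<sigma> u)" by simp
    finally show ?thesis using maxpos[of u] by (simp add: \<xi>_def pos_divide_le_eq)
  qed
  have k_odd: "k (- u) = - k u" for u using k by (simp add: admissible_def)
  have a_odd: "a i (- u) = - a i u" for i u
  proof -
    have "D (- u + k (- u)) (w i) = - D (u + k u) (w i)"
      using D_uminus[of "u + k u" "w i"] by (simp add: k_odd)
    then show ?thesis by (simp add: a_def)
  qed
  have \<xi>_odd: "\<xi> (- u) = - \<xi> u" for u
    by (simp add: \<xi>_def \<sigma>_def a_odd sum_negf)
  have a_cont: "continuous_on UNIV (a i)" for i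
  proof -
    have "continuous_on UNIV (\<lambda>u. D (u + k u) (w i))"
      by (rule continuous_on_compose2[OF D_continuous[of UNIV]]) (auto intro!: continuous_intros)
    then show ?thesis unfolding a_def
      by (rule continuous_on_compose2[OF continuous_soft_threshold[of UNIV]]) simp
  qed
  have "continuous_on UNIV \<xi>"
    unfolding \<xi>_def \<sigma>_def using s by (intro continuous_intros a_cont) (auto simp: max_def)
  then have "\<xi> \<in> bcontfun" using \<xi>1 by (rule bcontfun_normI)
  then have K: "apply_bcontfun (Bcontfun \<xi>) = \<xi>" by (rule Bcontfun_inverse)
  define k' where "k' = k + t *\<^sub>R Bcontfun \<xi>"
  have k': "k' u = k u + t *\<^sub>R \<xi> u" for u by (simp add: k'_def K)
  \<comment> \<open>By the mean value theorem the gain is t times a slope along \<xi>. The threshold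
    2\<epsilon> less the variation \<epsilon>/2 gives the factor 3/2.\<close>
  have gain: "Phi (u + k u) + 3 / 2 * \<epsilon> * t * (\<sigma> u / max s (\<sigma> u)) \<le> Phi (u + k' u)" if u: "u \<in> B" for u
  proof -
    have "((\<lambda>\<tau>. Phi (u + k u + \<tau> *\<^sub>R \<xi> u)) has_derivative (\<lambda>h. D (u + k u + \<tau> *\<^sub>R \<xi> u) (h *\<^sub>R \<xi> u)))
        (at \<tau> within {0..t})" for \<tau>
      by (rule has_derivative_compose[OF _ deriv, of "\<lambda>\<tau>. u + k u + \<tau> *\<^sub>R \<xi> u"])
         (auto intro!: derivative_eq_intros)
    then obtain \<tau> where \<tau>: "\<tau> \<in> {0..t}" and
      "Phi (u + k u + t *\<^sub>R \<xi> u) - Phi (u + k u + 0 *\<^sub>R \<xi> u) = D (u + k u + \<tau> *\<^sub>R \<xi> u) ((t - 0) *\<^sub>R \<xi> u)"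
      using mvt_very_simple[of 0 t "\<lambda>\<tau>. Phi (u + k u + \<tau> *\<^sub>R \<xi> u)"] t(1) by (meson less_imp_le)
    then have "Phi (u + k' u) - Phi (u + k u) = t * D (u + k u + \<tau> *\<^sub>R \<xi> u) (\<xi> u)"
      by (simp add: k' blinfun.scaleR_right add.assoc)
    also have "D (u + k u + \<tau> *\<^sub>R \<xi> u) (\<xi> u)
        = (1 / max s (\<sigma> u)) * (\<Sum>i<N. a i u * D (u + k u + \<tau> *\<^sub>R \<xi> u) (w i))"
      unfolding \<xi>_def[of u] by (simp only: blinfun.scaleR_right blinfun.sum_right real_scaleR_def)
    finally have eq: "Phi (u + k' u) - Phi (u + k u)
        = t / max s (\<sigma> u) * (\<Sum>i<N. a i u * D (u + k u + \<tau> *\<^sub>R \<xi> u) (w i))" by simp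
    have small: "norm (\<tau> *\<^sub>R \<xi> u) \<le> t0"
    proof -
      have "norm (\<tau> *\<^sub>R \<xi> u) \<le> \<tau> * 1" using \<xi>1[of u] \<tau> by (auto intro: mult_left_le)
      then show ?thesis using \<tau> t(2) by simp
    qed
    have "(2 * \<epsilon> - \<epsilon> / 2) * \<bar>a i u\<bar> \<le> a i u * D (u + k u + \<tau> *\<^sub>R \<xi> u) (w i)" if "i < N" for i
      unfolding a_def by (rule soft_threshold_mult_ge[OF _ unif[OF u small that]]) (use e in auto)
    then have "(\<Sum>i<N. (2 * \<epsilon> - \<epsilon> / 2) * \<bar>a i u\<bar>) \<le> (\<Sum>i<N. a i u * D (u + k u + \<tau> *\<^sub>R \<xi> u) (w i))"
      by (intro sum_mono) simp
    then have "3 / 2 * \<epsilon> * \<sigma> u \<le> (\<Sum>i<N. a i u * D (u + k u + \<tau> *\<^sub>R \<xi> u) (w i))"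
      by (simp add: \<sigma>_def sum_distrib_left)
    then have "t / max s (\<sigma> u) * (3 / 2 * \<epsilon> * \<sigma> u) \<le> Phi (u + k' u) - Phi (u + k u)"
      unfolding eq using t(1) maxpos[of u] by (intro mult_left_mono) auto
    moreover have "t / max s (\<sigma> u) * (3 / 2 * \<epsilon> * \<sigma> u) = 3 / 2 * \<epsilon> * t * (\<sigma> u / max s (\<sigma> u))"
      by (simp add: mult_ac)
    ultimately show ?thesis by linarith
  qed
  have raise: "Phi (u + k u) \<le> Phi (u + k' u)" if "u \<in> B" for u
  proof -
    have "0 \<le> 3 / 2 * \<epsilon> * t * (\<sigma> u / max s (\<sigma> u))"
      using e t(1) \<sigma>0[of u] maxpos[of u] by (intro mult_nonneg_nonneg divide_nonneg_pos) auto
    then show ?thesis using gain[OF that] by linarith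
  qed
  have "lowest k + 3 / 2 * \<epsilon> * t \<le> lowest k'"
  proof (rule le_lowest)
    fix u assume u: "u \<in> B"
    show "lowest k + 3 / 2 * \<epsilon> * t \<le> Phi (u + k' u)"
    proof (cases "Phi (u + k u) \<le> lowest k + s")
      case True
      then have "s \<le> \<sigma> u" using steep[OF u] by (simp add: \<sigma>_def a_def)
      then have "\<sigma> u / max s (\<sigma> u) = 1" using s by (simp add: max_def)
      then show ?thesis using gain[OF u] lowest_le[OF k u] by simp
    next
      case False
      have "3 / 2 * \<epsilon> * t \<le> 2 * \<epsilon> * (s / (2 * \<epsilon>))"
        using t e by (intro mult_mono) auto
      then have "3 / 2 * \<epsilon> * t \<le> s" using e by simp
      then show ?thesis using False raise[OF u] by linarith
    qed
  qed
  \<comment> \<open>The factor 3/2 exceeds the 1 needed for the Ekeland inequality; the strict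
    surplus excludes \<open>k' = k\<close>.\<close>
  moreover have "0 < \<epsilon> * t" using e t(1) by simp
  moreover have "\<epsilon> * dist k k' \<le> \<epsilon> * t"
  proof (rule mult_left_mono)
    show "dist k k' \<le> t"
    proof (rule dist_bound)
      show "dist (k u) (k' u) \<le> t" for u
        using t(1) \<xi>1[of u] by (simp add: k' dist_norm mult_left_le)
    qed
  qed (use e in simp)
  ultimately have "lowest k + \<epsilon> * dist k k' \<le> lowest k'" "k' \<noteq> k" by auto
  moreover have "k' \<in> admissible"
  proof -
    have "weak_strong k'"
      unfolding weak_strong_def
    proof (intro allI impI)
      fix x u assume x: "\<forall>n. x n \<in> B" "u \<in> B" "weak_conv x u"
      have x': "x n \<in> B" for n using x(1) by blast
      have "(\<lambda>n. D (x n + k (x n)) (w i)) \<longlonglongrightarrow> D (u + k u) (w i)" for i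
        using D_graph_weak[OF k x' x(2,3), of "\<lambda>_. 0"] by simp
      then have al: "(\<lambda>n. a i (x n)) \<longlonglongrightarrow> a i u" for i
        unfolding a_def
        by (intro continuous_on_tendsto_compose[OF continuous_soft_threshold[of UNIV]]) auto
      have "(\<lambda>n. \<xi> (x n)) \<longlonglongrightarrow> \<xi> u"
        unfolding \<xi>_def \<sigma>_def using s
        by (intro tendsto_intros al) (auto simp: max_def)
      then show "(\<lambda>n. k' (x n)) \<longlonglongrightarrow> k' u"
        unfolding k' by (intro tendsto_intros weak_graph(1)[OF k x' x(2,3)])
    qed
    moreover have "L \<le> Phi (u + k' u)" if "u \<in> E" for u
      using raise[of u] that E_sub k by (force simp: admissible_def)
    ultimately show ?thesis using k_odd \<xi>_odd by (simp add: admissible_def k')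
  qed
  ultimately show thesis using that by blast
qed

text \<open>A map that is maximal in Ekeland's sense admits no deformation, and the failure of
  \<open>deformation\<close> is precisely a lowest point with small derivative. The linking
  hypothesis keeps the supremum of the levels finite and below \<beta>.\<close>

theorem almost_critical:
  assumes sep: "\<exists>A::'a set. countable A \<and> closure A = UNIV"
    and zero: "0 \<in> admissible"
    and link: "\<And>k. k \<in> admissible \<Longrightarrow> \<exists>u\<in>B. Phi (u + k u) \<le> \<beta>"
  obtains c where "c \<le> \<beta>" "lowest 0 \<le> c"
    "\<And>\<delta>. 0 < \<delta> \<Longrightarrow> \<exists>u. \<bar>Phi u - c\<bar> \<le> \<delta> \<and> (1 + norm u) * norm (D u) \<le> \<delta>"
proof -
  have le_beta: "lowest k \<le> \<beta>" if "k \<in> admissible" for k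
    using link[OF that] lowest_le[OF that] order_trans by blast
  have bdd: "bdd_above (lowest ` admissible)" using le_beta by (auto simp: bdd_above_def)
  define c where "c = Sup (lowest ` admissible)"
  have le_c: "lowest k \<le> c" if "k \<in> admissible" for k
    unfolding c_def by (rule cSup_upper[OF imageI[OF that] bdd])
  have rho: "0 \<le> rho" using B_ne B_bound norm_ge_zero order_trans by blast
  show thesis
  proof
    show "c \<le> \<beta>" unfolding c_def using zero le_beta by (intro cSup_least) auto
    show "lowest 0 \<le> c" by (rule le_c[OF zero])
    fix \<delta> :: real assume d: "0 < \<delta>"
    have "c - \<delta> / 4 < Sup (lowest ` admissible)" using d by (simp add: c_def)
    then obtain k0 where k0: "k0 \<in> admissible" "c - \<delta> / 4 < lowest k0"
      using less_cSup_iff[OF _ bdd] zero by blast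
    define R where "R = 1 + rho + norm k0"
    have R: "1 \<le> R" using rho by (simp add: R_def)
    \<comment> \<open>\<open>R\<close> depends only on the starting map. Ekeland's gain is at most
      \<delta>/4 = \<epsilon> R, so the new map is within R of \<open>k0\<close> and 1 plus the norm
      of the point is at most 2R. The derivative is at most 2\<epsilon>, and the product is
      \<delta>.\<close>
    define \<epsilon> where "\<epsilon> = \<delta> / (4 * R)"
    have e: "0 < \<epsilon>" using d R by (simp add: \<epsilon>_def)
    obtain k1 where k1: "k1 \<in> admissible" "lowest k0 + \<epsilon> * dist k0 k1 \<le> lowest k1"
      and max: "\<And>k. k \<in> admissible \<Longrightarrow> lowest k1 + \<epsilon> * dist k1 k \<le> lowest k \<Longrightarrow> k = k1"
      using ekeland[OF closed_admissible k0(1) e, of lowest \<beta>] le_beta lowest_usc by metis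
    have "\<exists>u\<in>B. Phi (u + k1 u) = lowest k1 \<and> norm (D (u + k1 u)) \<le> 2 * \<epsilon>"
    proof (rule ccontr)
      assume "\<not> ?thesis"
      then have big: "2 * \<epsilon> < norm (D (u + k1 u))" if "u \<in> B" "Phi (u + k1 u) = lowest k1" for u
        using that by (meson not_le)
      obtain k' where "k' \<in> admissible" "k' \<noteq> k1" "lowest k1 + \<epsilon> * dist k1 k' \<le> lowest k'"
        using deformation[OF k1(1) e sep big] by blast
      then show False using max by blast
    qed
    then obtain u where u: "u \<in> B" "Phi (u + k1 u) = lowest k1" "norm (D (u + k1 u)) \<le> 2 * \<epsilon>" by blast
    have "\<epsilon> * dist k0 k1 \<le> \<delta> / 4" using k0(2) k1(2) le_c[OF k1(1)] by linarith
    also have "\<delta> / 4 = \<epsilon> * R" using R by (simp add: \<epsilon>_def)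
    finally have "dist k0 k1 \<le> R" using e by simp
    have "norm (u + k1 u) \<le> norm u + norm (k1 u)" by (rule norm_triangle_ineq)
    moreover have "norm (k1 u) \<le> norm k0 + dist k0 k1"
    proof -
      have "norm (k1 u) \<le> norm k1" using dist_bounded[of k1 u 0] by simp
      also have "\<dots> \<le> norm k0 + norm (k1 - k0)" by (metis add.commute norm_triangle_sub)
      finally show ?thesis by (simp add: dist_norm norm_minus_commute)
    qed
    ultimately have "1 + norm (u + k1 u) \<le> 2 * R"
      using B_bound[OF u(1)] \<open>dist k0 k1 \<le> R\<close> by (simp add: R_def)
    then have "(1 + norm (u + k1 u)) * norm (D (u + k1 u)) \<le> (2 * R) * (2 * \<epsilon>)"
      using u(3) R by (intro mult_mono) auto
    also have "\<dots> = \<delta>" using R by (simp add: \<epsilon>_def)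
    finally have "(1 + norm (u + k1 u)) * norm (D (u + k1 u)) \<le> \<delta>" .
    moreover have "\<bar>Phi (u + k1 u) - c\<bar> \<le> \<delta>"
    proof -
      have "0 \<le> \<epsilon> * dist k0 k1" using e by simp
      then show ?thesis
        using k0(2) le_c[OF k1(1)] k1(2) d unfolding u(2) abs_le_iff by linarith
    qed
    ultimately show "\<exists>u. \<bar>Phi u - c\<bar> \<le> \<delta> \<and> (1 + norm u) * norm (D u) \<le> \<delta>" by blast
  qed
qed

end

section \<open>Projections and weak compactness in Hilbert spaces\<close>

theorem hilbert_projection:
  fixes S :: "'a::{real_inner, complete_space} set"
  assumes "subspace S" "closed S"
  obtains v where "v \<in> S" "u - v \<in> orth_compl S"
proof -
  define d where "d = Inf ((\<lambda>v. (norm (u - v))\<^sup>2) ` S)"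
  have ne: "S \<noteq> {}" using subspace_0[OF assms(1)] by blast
  have bdd: "bdd_below ((\<lambda>v. (norm (u - v))\<^sup>2) ` S)" by (rule bdd_belowI[of _ 0]) auto
  have d_le: "d \<le> (norm (u - v))\<^sup>2" if "v \<in> S" for v
    unfolding d_def by (rule cInf_lower[OF imageI[OF that] bdd])
  have "\<exists>v\<in>S. (norm (u - v))\<^sup>2 < d + 1 / real (Suc n)" for n
  proof -
    have "d < d + 1 / real (Suc n)" by simp
    then show ?thesis using cInf_less_iff[OF _ bdd] ne unfolding d_def by blast
  qed
  then obtain v where v: "\<And>n. v n \<in> S" and v_lt: "\<And>n. (norm (u - v n))\<^sup>2 < d + 1 / real (Suc n)"
    by metis
  have par: "(norm (v m - v n))\<^sup>2 \<le> 2 * (1 / real (Suc m)) + 2 * (1 / real (Suc n))" for m n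
  proof -
    have "(1/2) *\<^sub>R (v m + v n) \<in> S" using v assms(1) by (simp add: subspace_add subspace_scale)
    then have "d \<le> (norm (u - (1/2) *\<^sub>R (v m + v n)))\<^sup>2" by (rule d_le)
    moreover have "(norm (v m - v n))\<^sup>2 = 2 * (norm (u - v m))\<^sup>2 + 2 * (norm (u - v n))\<^sup>2
        - 4 * (norm (u - (1/2) *\<^sub>R (v m + v n)))\<^sup>2"
      unfolding power2_norm_eq_inner
      by (simp add: inner_diff_left inner_diff_right inner_add_left inner_add_right inner_commute algebra_simps)
    ultimately show ?thesis using v_lt[of m] v_lt[of n] by linarith
  qed
  have "Cauchy v"
    unfolding Cauchy_altdef
  proof (intro allI impI)
    fix e :: real assume e: "0 < e"
    then have "0 < e\<^sup>2 / 4" by simp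
    then obtain N where N: "1 / real (Suc N) < e\<^sup>2 / 4" by (rule nat_approx_posE)
    have "dist (v m) (v n) < e" if "m \<ge> N" "n > m" for m n
    proof -
      have "1 / real (Suc m) \<le> 1 / real (Suc N)" "1 / real (Suc n) \<le> 1 / real (Suc N)"
        using that by (intro divide_left_mono; simp)+
      then have "2 * (1 / real (Suc m)) + 2 * (1 / real (Suc n)) < e\<^sup>2"
        using N by linarith
      then have "(norm (v m - v n))\<^sup>2 < e\<^sup>2" using par[of m n] by linarith
      then show ?thesis unfolding dist_norm using e by (meson less_imp_le power_less_imp_less_base)
    qed
    then show "\<exists>M. \<forall>m\<ge>M. \<forall>n>m. dist (v m) (v n) < e" by blast
  qed
  then obtain l where l: "v \<longlonglongrightarrow> l" by (metis Cauchy_convergent convergent_def)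
  have lS: "l \<in> S" using closed_sequentially[OF assms(2) _ l] v by blast
  have lim: "(\<lambda>n. (norm (u - v n))\<^sup>2) \<longlonglongrightarrow> (norm (u - l))\<^sup>2" by (intro tendsto_intros l)
  have "(\<lambda>n. d + 1 / real (Suc n)) \<longlonglongrightarrow> d + 0"
    by (intro tendsto_intros LIMSEQ_Suc[OF lim_1_over_n])
  then have le_d: "(norm (u - l))\<^sup>2 \<le> d"
    using LIMSEQ_le[OF lim] v_lt less_imp_le unfolding add_0_right by blast
  have "(u - l) \<bullet> w = 0" if w: "w \<in> S" for w
  proof (cases "w = 0")
    case False
    \<comment> \<open>The minimiser of the quadratic
      \<open>t \<mapsto> (norm (u - l - t *\<^sub>R w))\<^sup>2\<close>.\<close>
    define t where "t = ((u - l) \<bullet> w) / (w \<bullet> w)"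
    have "l + t *\<^sub>R w \<in> S" using lS w assms(1) by (simp add: subspace_add subspace_scale)
    then have "(norm (u - l))\<^sup>2 \<le> (norm (u - (l + t *\<^sub>R w)))\<^sup>2" using le_d d_le order_trans by blast
    also have "\<dots> = (norm (u - l))\<^sup>2 - 2 * t * ((u - l) \<bullet> w) + t\<^sup>2 * (w \<bullet> w)"
      unfolding power2_norm_eq_inner
      by (simp add: inner_diff_left inner_diff_right inner_add_left inner_add_right inner_commute
          power2_eq_square algebra_simps)
    also have "\<dots> = (norm (u - l))\<^sup>2 - ((u - l) \<bullet> w)\<^sup>2 / (w \<bullet> w)"
      using False by (simp add: t_def power2_eq_square field_simps)
    finally have "((u - l) \<bullet> w)\<^sup>2 / (w \<bullet> w) \<le> 0" by simp
    moreover have "0 < w \<bullet> w" using False by simp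
    ultimately have "((u - l) \<bullet> w)\<^sup>2 \<le> 0" by (simp add: divide_le_0_iff)
    then show ?thesis by simp
  qed simp
  then show thesis using that[of l] lS by (simp add: orth_compl_def)
qed

lemma orth_compl_inter:
  assumes "x \<in> S" "x \<in> orth_compl S"
  shows "x = 0"
  using assms by (auto simp: orth_compl_def)

lemma subspace_orth_compl: "subspace (orth_compl S)"
  by (auto simp: orth_compl_def subspace_def inner_add_left)

lemma proj_minus_eqI:
  fixes S :: "'a::{real_inner, complete_space} set"
  assumes "subspace S" "v \<in> S" "u - v \<in> orth_compl S"
  shows "proj_minus S u = v"
  unfolding proj_minus_def
proof (rule the_equality)
  fix w assume w: "w \<in> S \<and> u - w \<in> orth_compl S"
  have "(u - v) - (u - w) \<in> orth_compl S" 
    using subspace_diff[OF subspace_orth_compl, of "u - v" S "u - w"] w assms by blast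
  then have "w - v \<in> orth_compl S" by simp
  moreover have "w - v \<in> S" using w assms by (simp add: subspace_diff)
  ultimately show "w = v" using orth_compl_inter by fastforce
qed (use assms in auto)

lemma proj_minus_in:
  fixes S :: "'a::{real_inner, complete_space} set"
  assumes "subspace S" "closed S"
  shows "proj_minus S u \<in> S" "u - proj_minus S u \<in> orth_compl S"
proof -
  obtain v where "v \<in> S" "u - v \<in> orth_compl S" using hilbert_projection[OF assms] by blast
  moreover then have "proj_minus S u = v" by (intro proj_minus_eqI assms)
  ultimately show "proj_minus S u \<in> S" "u - proj_minus S u \<in> orth_compl S" by auto
qed

lemma inner_proj_minus:
  fixes S :: "'a::{real_inner, complete_space} set"
  assumes "subspace S" "closed S"
  shows "proj_minus S u \<bullet> w = u \<bullet> proj_minus S w"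
proof -
  have "(u - proj_minus S u) \<bullet> proj_minus S w = 0" "(w - proj_minus S w) \<bullet> proj_minus S u = 0"
    using proj_minus_in[OF assms] by (auto simp: orth_compl_def)
  then have "u \<bullet> proj_minus S w = proj_minus S u \<bullet> proj_minus S w"
    "w \<bullet> proj_minus S u = proj_minus S w \<bullet> proj_minus S u"
    by (simp_all add: inner_diff_left)
  then show ?thesis by (metis inner_commute)
qed

lemma bounded_linear_proj_minus:
  fixes S :: "'a::{real_inner, complete_space} set"
  assumes "subspace S" "closed S"
  shows "bounded_linear (proj_minus S)"
proof (rule bounded_linear_intro[where K = 1])
  note in_S = proj_minus_in[OF assms]
  show "proj_minus S (x + y) = proj_minus S x + proj_minus S y" for x y
  proof (rule proj_minus_eqI[OF assms(1)])
    show "proj_minus S x + proj_minus S y \<in> S" using in_S by (intro subspace_add assms)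
    have "(x - proj_minus S x) + (y - proj_minus S y) \<in> orth_compl S"
      using in_S by (intro subspace_add[OF subspace_orth_compl])
    then show "x + y - (proj_minus S x + proj_minus S y) \<in> orth_compl S" by (simp add: algebra_simps)
  qed
  show "proj_minus S (r *\<^sub>R x) = r *\<^sub>R proj_minus S x" for r x
  proof (rule proj_minus_eqI[OF assms(1)])
    show "r *\<^sub>R proj_minus S x \<in> S" using in_S by (intro subspace_scale assms)
    have "r *\<^sub>R (x - proj_minus S x) \<in> orth_compl S"
      using in_S by (intro subspace_scale[OF subspace_orth_compl])
    then show "r *\<^sub>R x - r *\<^sub>R proj_minus S x \<in> orth_compl S" by (simp add: algebra_simps)
  qed
  show "norm (proj_minus S x) \<le> norm x * 1" for x
  proof -
    have "(x - proj_minus S x) \<bullet> proj_minus S x = 0" using in_S by (auto simp: orth_compl_def)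
    then have "(norm (proj_minus S x))\<^sup>2 = x \<bullet> proj_minus S x"
      by (simp add: power2_norm_eq_inner inner_diff_left)
    also have "\<dots> \<le> norm x * norm (proj_minus S x)" by (rule norm_cauchy_schwarz)
    finally show ?thesis
      by (cases "norm (proj_minus S x) = 0") (auto simp: power2_eq_square)
  qed
qed

lemma subspace_closure:
  fixes S :: "'a::real_normed_vector set"
  assumes "subspace S"
  shows "subspace (closure S)"
proof (rule subspaceI)
  show "0 \<in> closure S" using subspace_0[OF assms] closure_subset by blast
next
  fix x y assume "x \<in> closure S" "y \<in> closure S"
  then obtain a b where "\<And>n. a n \<in> S" "a \<longlonglongrightarrow> x" "\<And>n. b n \<in> S" "b \<longlonglongrightarrow> y"
    unfolding closure_sequential by blast
  then have "\<And>n. a n + b n \<in> S" "(\<lambda>n. a n + b n) \<longlonglongrightarrow> x + y"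
    by (auto intro: subspace_add[OF assms] tendsto_add)
  then show "x + y \<in> closure S"
    unfolding closure_sequential by (intro exI[of _ "\<lambda>n. a n + b n"] conjI allI)
next
  fix c :: real and x assume "x \<in> closure S"
  then obtain a where "\<And>n. a n \<in> S" "a \<longlonglongrightarrow> x"
    unfolding closure_sequential by blast
  then have "\<And>n. c *\<^sub>R a n \<in> S" "(\<lambda>n. c *\<^sub>R a n) \<longlonglongrightarrow> c *\<^sub>R x"
    by (auto intro: subspace_scale[OF assms] tendsto_scaleR tendsto_const)
  then show "c *\<^sub>R x \<in> closure S"
    unfolding closure_sequential by (intro exI[of _ "\<lambda>n. c *\<^sub>R a n"] conjI allI)
qed

lemma closure_span_orthogonal:
  assumes "x \<in> closure (span S)" "\<And>y. y \<in> S \<Longrightarrow> z \<bullet> y = 0"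
  shows "z \<bullet> x = 0"
proof -
  have "span S \<subseteq> {y. z \<bullet> y = 0}"
    using assms(2) by (intro span_minimal) (auto simp: subspace_def inner_add_right)
  moreover have "closed {y. z \<bullet> y = 0}" by (intro closed_Collect_eq continuous_intros)
  ultimately have "closure (span S) \<subseteq> {y. z \<bullet> y = 0}" by (rule closure_minimal)
  then show ?thesis using assms(1) by blast
qed

section \<open>Weak compactness through orthonormal coordinates\<close>

locale orthonormal_sequence =
  fixes f :: "nat \<Rightarrow> 'a::{real_inner, complete_space}"
  assumes orthonormal: "\<And>i j. f i \<bullet> f j = (if i = j then 1 else 0)"
begin

lemma inner_partial_sum: "(\<Sum>j<n. x j *\<^sub>R f j) \<bullet> f i = (if i < n then x i else 0)"
  by (simp add: inner_sum_left orthonormal if_distrib sum.delta cong: if_cong)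

lemma norm_partial_sum: "(norm (\<Sum>j<n. x j *\<^sub>R f j))\<^sup>2 = (\<Sum>j<n. (x j)\<^sup>2)"
proof -
  have "(norm (\<Sum>j<n. x j *\<^sub>R f j))\<^sup>2 = (\<Sum>i<n. x i * ((\<Sum>j<n. x j *\<^sub>R f j) \<bullet> f i))"
    unfolding power2_norm_eq_inner inner_sum_right[of _ _ "{..<n}"] by simp
  also have "\<dots> = (\<Sum>i<n. (x i)\<^sup>2)" by (intro sum.cong) (auto simp: inner_partial_sum power2_eq_square)
  finally show ?thesis .
qed

lemma bessel: "(\<Sum>j<n. (u \<bullet> f j)\<^sup>2) \<le> (norm u)\<^sup>2"
proof -
  let ?s = "\<Sum>j<n. (u \<bullet> f j) *\<^sub>R f j"
  have "u \<bullet> ?s = (\<Sum>j<n. (u \<bullet> f j)\<^sup>2)" by (simp add: inner_sum_right power2_eq_square)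
  then have "(norm (u - ?s))\<^sup>2 = (norm u)\<^sup>2 - (\<Sum>j<n. (u \<bullet> f j)\<^sup>2)"
    using norm_partial_sum[of "\<lambda>j. u \<bullet> f j" n]
    by (simp add: power2_norm_eq_inner inner_diff_left inner_diff_right inner_commute)
  then show ?thesis by (metis diff_ge_0_iff_ge zero_le_power2)
qed

text \<open>Convergence extends from the sequence to its span by linearity and to the closed span by
  the norm bound. An arbitrary test vector may be replaced by its projection onto the closed span,
  in which \<open>x\<close> and \<open>l\<close> lie.\<close>

lemma weak_conv_if_coordinates:
  assumes x: "\<And>n. x n \<in> closure (span (range f))" "\<And>n. norm (x n) \<le> R"
    and l: "l \<in> closure (span (range f))"
    and coord: "\<And>j. (\<lambda>n. x n \<bullet> f j) \<longlonglongrightarrow> l \<bullet> f j"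
  shows "weak_conv x l"
proof -
  let ?S = "closure (span (range f))"
  have sub: "subspace ?S" by (intro subspace_closure subspace_span)
  have "(\<lambda>n. x n \<bullet> y) \<longlonglongrightarrow> l \<bullet> y" if "y \<in> span (range f)" for y
    using that
  proof (induction rule: span_induct_alt)
    case base
    then show ?case by simp
  next
    case (step c z y)
    then have "(\<lambda>n. x n \<bullet> z) \<longlonglongrightarrow> l \<bullet> z" using coord by auto
    then show ?case
      unfolding inner_add_right inner_scaleR_right by (intro tendsto_add tendsto_mult_left step)
  qed
  then have span: "(\<lambda>n. (x n - l) \<bullet> y) \<longlonglongrightarrow> 0" if "y \<in> span (range f)" for y
    using that LIM_zero by (fastforce simp: inner_diff_left)
  have R: "0 \<le> R" using x(2)[of 0] norm_ge_zero order_trans by blast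
  have clos: "(\<lambda>n. (x n - l) \<bullet> y) \<longlonglongrightarrow> 0" if y: "y \<in> ?S" for y
  proof (rule LIMSEQ_I)
    fix e :: real assume e: "0 < e"
    define M where "M = R + norm l + 1"
    have M: "0 < M" using R by (simp add: M_def add_nonneg_pos)
    obtain z where z: "z \<in> span (range f)" "dist z y < e / (2 * M)"
      using y e M unfolding closure_approachable by (meson divide_pos_pos mult_pos_pos zero_less_numeral)
    obtain N where N: "\<And>n. n \<ge> N \<Longrightarrow> \<bar>(x n - l) \<bullet> z\<bar> < e / 2"
      using LIMSEQ_D[OF span[OF z(1)], of "e / 2"] e by auto
    have "norm ((x n - l) \<bullet> y - 0) < e" if "n \<ge> N" for n
    proof -
      have "norm (x n - l) \<le> M" using norm_triangle_ineq4[of "x n" l] x(2)[of n] by (simp add: M_def)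
      then have "norm (x n - l) * norm (y - z) \<le> M * (e / (2 * M))"
        using z(2) M e by (intro mult_mono) (auto simp: dist_norm norm_minus_commute)
      then have "\<bar>(x n - l) \<bullet> (y - z)\<bar> \<le> e / 2"
        using Cauchy_Schwarz_ineq2[of "x n - l" "y - z"] M by simp
      moreover have "(x n - l) \<bullet> y = (x n - l) \<bullet> (y - z) + (x n - l) \<bullet> z"
        by (simp add: inner_diff_right)
      ultimately show ?thesis using N[OF that] by simp
    qed
    then show "\<exists>no. \<forall>n\<ge>no. norm ((x n - l) \<bullet> y - 0) < e" by blast
  qed
  have "(\<lambda>n. x n \<bullet> y) \<longlonglongrightarrow> l \<bullet> y" for y
  proof -
    obtain v where v: "v \<in> ?S" "y - v \<in> orth_compl ?S"
      using hilbert_projection[OF sub closed_closure] by blast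
    have "x n - l \<in> ?S" for n using x(1) l sub by (simp add: subspace_diff)
    then have "(y - v) \<bullet> (x n - l) = 0" for n using v(2) by (simp add: orth_compl_def)
    then have "(x n - l) \<bullet> y = (x n - l) \<bullet> v" for n
      unfolding inner_diff_left[of y v] right_minus_eq by (metis inner_commute)
    then have "(\<lambda>n. (x n - l) \<bullet> y) \<longlonglongrightarrow> 0" using clos[OF v(1)] by simp
    then show ?thesis unfolding inner_diff_left by (rule LIM_zero_cancel)
  qed
  then show ?thesis by (simp add: weak_conv_def)
qed

lemma riesz_fischer:
  assumes "\<And>n. (\<Sum>j<n. (x j)\<^sup>2) \<le> R\<^sup>2" "0 \<le> R"
  obtains l where "l \<in> closure (span (range f))" "norm l \<le> R" "\<And>j. l \<bullet> f j = x j"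
proof -
  define s where "s n = (\<Sum>j<n. x j *\<^sub>R f j)" for n
  have summ: "summable (\<lambda>j. (x j)\<^sup>2)"
    by (rule summableI_nonneg_bounded[where x = "R\<^sup>2"]) (use assms in auto)
  have diff: "(norm (s n - s m))\<^sup>2 = (\<Sum>j=m..<n. (x j)\<^sup>2)" if "m \<le> n" for m n
  proof -
    have "s n - s m = (\<Sum>j<n. (if j < m then 0 else x j) *\<^sub>R f j)"
    proof -
      have "s n = (\<Sum>j\<in>{..<m}. x j *\<^sub>R f j) + (\<Sum>j\<in>{m..<n}. x j *\<^sub>R f j)"
        unfolding s_def using that by (simp add: sum.atLeastLessThan_concat flip: atLeast0LessThan)
      moreover have "(\<Sum>j\<in>{m..<n}. x j *\<^sub>R f j) = (\<Sum>j<n. (if j < m then 0 else x j) *\<^sub>R f j)"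
        by (rule sum.mono_neutral_cong_left) auto
      ultimately show ?thesis by (simp add: s_def)
    qed
    then have "(norm (s n - s m))\<^sup>2 = (\<Sum>j<n. (if j < m then 0 else x j)\<^sup>2)"
      by (simp add: norm_partial_sum)
    also have "\<dots> = (\<Sum>j=m..<n. (x j)\<^sup>2)" by (rule sum.mono_neutral_cong_right) auto
    finally show ?thesis .
  qed
  have "Cauchy s"
    unfolding Cauchy_altdef
  proof (intro allI impI)
    fix e :: real assume e: "0 < e"
    obtain N where N: "\<And>m n. m \<ge> N \<Longrightarrow> norm (\<Sum>j=m..<n. (x j)\<^sup>2) < e\<^sup>2"
      using summ[unfolded summable_Cauchy] e by (meson zero_less_power)
    have "dist (s m) (s n) < e" if "m \<ge> N" "n > m" for m n
    proof -
      have "(norm (s n - s m))\<^sup>2 < e\<^sup>2" using N[OF that(1), of n] diff[of m n] that(2) by simp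
      then show ?thesis unfolding dist_norm using e
        by (metis less_imp_le norm_minus_commute power_less_imp_less_base)
    qed
    then show "\<exists>M. \<forall>m\<ge>M. \<forall>n>m. dist (s m) (s n) < e" by blast
  qed
  then obtain l where l: "s \<longlonglongrightarrow> l" by (metis Cauchy_convergent convergent_def)
  show thesis
  proof
    have "s n \<in> span (range f)" for n
      unfolding s_def by (intro span_sum span_scale span_base) auto
    then show "l \<in> closure (span (range f))" using l closure_sequential by blast
    have "norm (s n) \<le> R" for n
      using norm_partial_sum[of x n] assms by (metis power2_le_imp_le s_def)
    then show "norm l \<le> R" using LIMSEQ_le_const2[OF tendsto_norm[OF l]] by blast
    fix j
    have "(\<lambda>n. s n \<bullet> f j) \<longlonglongrightarrow> l \<bullet> f j" by (intro tendsto_intros l)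
    moreover have "\<forall>\<^sub>F n in sequentially. s n \<bullet> f j = x j"
      using eventually_gt_at_top[of j] by eventually_elim (simp add: s_def inner_partial_sum)
    then have "(\<lambda>n. s n \<bullet> f j) \<longlonglongrightarrow> x j" by (rule tendsto_eventually)
    ultimately show "l \<bullet> f j = x j" by (rule LIMSEQ_unique)
  qed
qed

text \<open>Sequential compactness of a product of intervals replaces the diagonal extraction.
  Bessel's inequality passes to the limit coordinates, so they belong to a vector of norm at most
  R.\<close>

lemma weakly_compact_ball:
  assumes x: "\<And>n. x n \<in> closure (span (range f))" "\<And>n. norm (x n) \<le> R"
  obtains l r where "l \<in> closure (span (range f))" "norm l \<le> R"
    "strict_mono (r :: nat \<Rightarrow> nat)" "weak_conv (\<lambda>n. x (r n)) l"
proof -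
  have R: "0 \<le> R" using x(2)[of 0] norm_ge_zero order_trans by blast
  have "compact {z :: nat \<Rightarrow> real. \<forall>i. z i \<in> {-R..R}}"
    by (rule compact_fun_box) simp
  then have "seq_compact {z :: nat \<Rightarrow> real. \<forall>i. z i \<in> {-R..R}}" by (rule compact_imp_seq_compact)
  moreover have "\<forall>n. (\<lambda>j. x n \<bullet> f j) \<in> {z. \<forall>i. z i \<in> {-R..R}}"
  proof
    fix n
    have "\<bar>x n \<bullet> f j\<bar> \<le> R" for j
    proof -
      have "norm (f j) = 1" using orthonormal[of j j] by (simp add: norm_eq_sqrt_inner)
      then show ?thesis using Cauchy_Schwarz_ineq2[of "x n" "f j"] x(2)[of n] by simp
    qed
    then show "(\<lambda>j. x n \<bullet> f j) \<in> {z. \<forall>i. z i \<in> {-R..R}}" by (simp add: abs_le_iff minus_le_iff)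
  qed
  ultimately obtain y r where r: "strict_mono (r :: nat \<Rightarrow> nat)"
    and y: "((\<lambda>n j. x n \<bullet> f j) \<circ> r) \<longlonglongrightarrow> y"
    by (rule seq_compactE) blast
  have coord: "(\<lambda>n. x (r n) \<bullet> f j) \<longlonglongrightarrow> y j" for j
    using y unfolding tendsto_componentwise_iff_fun by (simp add: o_def)
  have "(\<Sum>j<n. (y j)\<^sup>2) \<le> R\<^sup>2" for n
  proof (rule LIMSEQ_le_const2)
    show "(\<lambda>m. \<Sum>j<n. (x (r m) \<bullet> f j)\<^sup>2) \<longlonglongrightarrow> (\<Sum>j<n. (y j)\<^sup>2)" by (intro tendsto_intros coord)
    have "(\<Sum>j<n. (x (r m) \<bullet> f j)\<^sup>2) \<le> R\<^sup>2" for m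
      using bessel[of "x (r m)" n] power_mono[OF x(2)[of "r m"] norm_ge_zero, of 2] by linarith
    then show "\<exists>N. \<forall>m\<ge>N. (\<Sum>j<n. (x (r m) \<bullet> f j)\<^sup>2) \<le> R\<^sup>2" by blast
  qed
  then obtain l where l: "l \<in> closure (span (range f))" "norm l \<le> R" "\<And>j. l \<bullet> f j = y j"
    using riesz_fischer[of y R] R by blast
  have "weak_conv (\<lambda>n. x (r n)) l"
    by (rule weak_conv_if_coordinates[of _ R]) (use x l coord in auto)
  then show thesis using that l r by blast
qed

end

section \<open>Linking for odd weak-to-strong continuous perturbations\<close>

context orthonormal_sequence
begin

text \<open>The Borsuk theorem is applied to p + 1 coordinates and the p odd functions
  \<open>(u + k u) \<bullet> f (Suc i)\<close>. The last conclusion records that the part of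
  \<open>u\<close> off \<open>f 0\<close> is spanned by the very vectors to which
  \<open>u + k u\<close> is orthogonal; the passage to infinite dimension depends on it.\<close>

lemma linking_finite:
  fixes k :: "'a \<Rightarrow> 'a"
  assumes "0 < p" "0 < r" "0 < rho"
    and kcont: "continuous_on UNIV k" and kodd: "\<And>u. k (- u) = - k u"
    and bdry: "\<And>u. u \<in> span (range f) \<Longrightarrow> norm u = rho \<Longrightarrow> r < norm (u + k u)"
  obtains u where "u \<in> span (range f)" "norm u \<le> rho" "norm (u + k u) = r"
    "\<And>i. i < p \<Longrightarrow> (u + k u) \<bullet> f (Suc i) = 0" "u - (u \<bullet> f 0) *\<^sub>R f 0 \<in> span ((\<lambda>i. f (Suc i)) ` {..<p})"
proof -
  define U where "U x = (\<Sum>j\<le>p. x j *\<^sub>R f j)" for x :: "nat \<Rightarrow> real"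
  \<comment> \<open>A zero of this minimum lies on the sphere of radius \<open>rho\<close> or has an
    image of norm r. In the first case \<open>bdry\<close> makes the other term negative, so the
    second holds.\<close>
  define s where "s x = min (rho - norm (U x)) (r - norm (U x + k (U x)))" for x
  have U_cont: "continuous_on UNIV U"
    unfolding U_def by (intro continuous_intros continuous_on_product_then_coordinatewise continuous_on_id)
  have kU_cont: "continuous_on UNIV (\<lambda>x. k (U x))"
    by (rule continuous_on_compose2[OF kcont U_cont]) simp
  have U_neg: "U (\<lambda>j. - x j) = - U x" for x by (simp add: U_def sum_negf)
  have U_coord: "U x \<bullet> f i = (if i \<le> p then x i else 0)" for x i
    using inner_partial_sum[of x "Suc p" i] by (simp add: U_def lessThan_Suc_atMost less_Suc_eq_le)
  have k0: "k 0 = 0" using kodd[of 0] by (simp add: eq_neg_iff_add_eq_0 flip: scaleR_2)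
  have U0: "U (\<lambda>_. 0) = 0" by (simp add: U_def)
  obtain x where x: "\<forall>j>p. x j = 0" "s x = 0" "\<forall>i<p. (U x + k (U x)) \<bullet> f (Suc i) = 0"
  proof (rule odd_even_common_zero[of p "\<lambda>i x. (U x + k (U x)) \<bullet> f (Suc i)" s rho])
    show "0 < p" by fact
    show "continuous_on UNIV (\<lambda>x. (U x + k (U x)) \<bullet> f (Suc i))" for i
      by (intro continuous_intros U_cont kU_cont)
    show "continuous_on UNIV s" unfolding s_def by (intro continuous_intros U_cont kU_cont)
    show "(U (\<lambda>j. - x j) + k (U (\<lambda>j. - x j))) \<bullet> f (Suc i) = - ((U x + k (U x)) \<bullet> f (Suc i))" for i x
      by (simp add: U_neg kodd inner_add_left inner_diff_left)
    have "norm (- U x - k (U x)) = norm (U x + k (U x))" for x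
      using norm_minus_cancel[of "U x + k (U x)"] by simp
    then show "s (\<lambda>j. - x j) = s x" for x by (simp add: s_def U_neg kodd)
    show "0 < s (\<lambda>_. 0)" using assms(2,3) by (simp add: s_def U0 k0)
    fix x :: "nat \<Rightarrow> real" and i assume x: "\<forall>j>p. x j = 0" "0 < s x"
    have "norm (f i) = 1" using orthonormal[of i i] by (simp add: norm_eq_sqrt_inner)
    then have "\<bar>U x \<bullet> f i\<bar> \<le> norm (U x)" using Cauchy_Schwarz_ineq2[of "U x" "f i"] by simp
    moreover have "norm (U x) < rho" using x(2) by (simp add: s_def)
    ultimately show "\<bar>x i\<bar> \<le> rho" using x(1) assms(3) by (cases "i \<le> p") (auto simp: U_coord)
  qed blast
  have span: "U x \<in> span (range f)" unfolding U_def by (intro span_sum span_scale span_base) auto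
  have le: "norm (U x) \<le> rho" "norm (U x + k (U x)) \<le> r" using x(2) by (auto simp: s_def min_def split: if_splits)
  show thesis
  proof
    show "norm (U x + k (U x)) = r"
      using bdry[OF span] le x(2) by (auto simp: s_def min_def split: if_splits)
    have "U x = x 0 *\<^sub>R f 0 + (\<Sum>i<p. x (Suc i) *\<^sub>R f (Suc i))"
      unfolding U_def by (rule sum.atMost_shift)
    then have "U x - (U x \<bullet> f 0) *\<^sub>R f 0 = (\<Sum>i<p. x (Suc i) *\<^sub>R f (Suc i))"
      unfolding U_coord by simp
    moreover have "(\<Sum>i<p. x (Suc i) *\<^sub>R f (Suc i)) \<in> span ((\<lambda>i. f (Suc i)) ` {..<p})"
      by (intro span_sum span_scale span_base imageI)
    ultimately show "U x - (U x \<bullet> f 0) *\<^sub>R f 0 \<in> span ((\<lambda>i. f (Suc i)) ` {..<p})" by metis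
  qed (use span le x in auto)
qed

text \<open>A Galerkin limit. Weak-to-strong continuity lets the orthogonality relations pass to a
  weak limit, but the condition on the norm needs strong convergence, which the orthogonality itself
  supplies.\<close>

theorem linking:
  fixes k :: "'a \<Rightarrow> 'a" and r rho :: real
  defines "B \<equiv> {u \<in> closure (span (range f)). norm u \<le> rho}"
  assumes "0 < r" "0 < rho"
    and kcont: "continuous_on UNIV k" and kodd: "\<And>u. k (- u) = - k u"
    and kws: "\<And>x l. (\<And>n. x n \<in> B) \<Longrightarrow> l \<in> B \<Longrightarrow> weak_conv x l \<Longrightarrow> (\<lambda>n. k (x n)) \<longlonglongrightarrow> k l"
    and bdry: "\<And>u. u \<in> B \<Longrightarrow> norm u = rho \<Longrightarrow> r < norm (u + k u)"
  obtains u where "u \<in> B" "norm (u + k u) = r" "\<And>i. (u + k u) \<bullet> f (Suc i) = 0"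
proof -
  have spanB: "u \<in> closure (span (range f))" if "u \<in> span (range f)" for u
    using that closure_subset by blast
  have "\<exists>u. u \<in> span (range f) \<and> norm u \<le> rho \<and> norm (u + k u) = r \<and>
      (\<forall>i<Suc n. (u + k u) \<bullet> f (Suc i) = 0) \<and>
      u - (u \<bullet> f 0) *\<^sub>R f 0 \<in> span ((\<lambda>i. f (Suc i)) ` {..<Suc n})" for n
  proof (rule linking_finite[of "Suc n" r rho k])
    show "r < norm (u + k u)" if "u \<in> span (range f)" "norm u = rho" for u
      using bdry that spanB by (simp add: B_def)
  qed (use assms in blast)+
  then obtain x where x: "\<And>n. x n \<in> span (range f)" "\<And>n. norm (x n) \<le> rho"
    and xr: "\<And>n. norm (x n + k (x n)) = r"
    and xo: "\<And>n i. i < Suc n \<Longrightarrow> (x n + k (x n)) \<bullet> f (Suc i) = 0"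
    and xs: "\<And>n. x n - (x n \<bullet> f 0) *\<^sub>R f 0 \<in> span ((\<lambda>i. f (Suc i)) ` {..<Suc n})"
    by metis
  have xB: "x n \<in> B" for n using x spanB by (simp add: B_def)
  obtain l \<phi> where l: "l \<in> closure (span (range f))" "norm l \<le> rho"
    and \<phi>: "strict_mono (\<phi> :: nat \<Rightarrow> nat)" and w: "weak_conv (\<lambda>n. x (\<phi> n)) l"
    using weakly_compact_ball[of x rho] x spanB by blast
  have lB: "l \<in> B" using l by (simp add: B_def)
  let ?x = "\<lambda>n. x (\<phi> n)"
  have kl: "(\<lambda>n. k (?x n)) \<longlonglongrightarrow> k l" by (rule kws[OF xB lB w])
  have wi: "(\<lambda>n. ?x n \<bullet> y) \<longlonglongrightarrow> l \<bullet> y" for y using w by (simp add: weak_conv_def)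
  have orth: "(l + k l) \<bullet> f (Suc i) = 0" for i
  proof -
    have "(\<lambda>n. (?x n + k (?x n)) \<bullet> f (Suc i)) \<longlonglongrightarrow> (l + k l) \<bullet> f (Suc i)"
      unfolding inner_add_left by (intro tendsto_add wi tendsto_inner kl tendsto_const)
    moreover have "\<forall>\<^sub>F n in sequentially. (?x n + k (?x n)) \<bullet> f (Suc i) = 0"
      using eventually_ge_at_top[of i]
    proof eventually_elim
      case (elim n)
      then have "i < Suc (\<phi> n)" using seq_suble[OF \<phi>, of n] by linarith
      then show ?case by (rule xo)
    qed
    then have "(\<lambda>n. (?x n + k (?x n)) \<bullet> f (Suc i)) \<longlonglongrightarrow> 0" by (rule tendsto_eventually)
    ultimately show ?thesis by (rule LIMSEQ_unique)
  qed
  text \<open>The tail \<open>h u\<close> of \<open>u\<close> is orthogonal to \<open>u + k u\<close>, which expresses \<open>\<parallel>u\<parallel>\<^sup>2\<close> by weakly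
    continuous terms; hence the weak convergence is strong.\<close>
  define h where "h u = u - (u \<bullet> f 0) *\<^sub>R f 0" for u
  have norm_eq: "u \<bullet> u = (u \<bullet> f 0) * (u \<bullet> f 0 + k u \<bullet> f 0) - u \<bullet> k u" if "(u + k u) \<bullet> h u = 0" for u
    using that by (simp add: h_def inner_add_left inner_diff_right inner_commute[of "k u" u] algebra_simps)
  have hx: "(x n + k (x n)) \<bullet> h (x n) = 0" for n
  proof -
    have "h (x n) \<in> closure (span ((\<lambda>i. f (Suc i)) ` {..<Suc n}))"
      using xs[of n] closure_subset unfolding h_def by blast
    then show ?thesis by (rule closure_span_orthogonal) (use xo in auto)
  qed
  \<comment> \<open>The limit image is orthogonal to every \<open>f (Suc i)\<close>, hence to each
    tail \<open>h (?x n)\<close>; \<open>h\<close> is linear and weakly continuous, so the relation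
    survives for \<open>h l\<close>.\<close>
  have hl: "(l + k l) \<bullet> h l = 0"
  proof -
    have "(l + k l) \<bullet> h (?x n) = 0" for n
    proof -
      have "h (?x n) \<in> closure (span ((\<lambda>i. f (Suc i)) ` {..<Suc (\<phi> n)}))"
        using xs[of "\<phi> n"] closure_subset unfolding h_def by blast
      then show ?thesis by (rule closure_span_orthogonal) (use orth in auto)
    qed
    moreover have "(\<lambda>n. (l + k l) \<bullet> h (?x n)) \<longlonglongrightarrow> (l + k l) \<bullet> h l"
      unfolding h_def inner_diff_right inner_scaleR_right
    proof (intro tendsto_diff tendsto_mult tendsto_const wi)
      show "(\<lambda>n. y \<bullet> ?x n) \<longlonglongrightarrow> y \<bullet> l" for y
        unfolding inner_commute[of y] by (rule wi)
    qed
    ultimately show ?thesis by (simp add: LIMSEQ_const_iff)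
  qed
  have xk: "(\<lambda>n. ?x n \<bullet> k (?x n)) \<longlonglongrightarrow> l \<bullet> k l"
  proof -
    have "(\<lambda>n. ?x n \<bullet> (k (?x n) - k l)) \<longlonglongrightarrow> 0"
    proof (rule Lim_null_comparison[OF always_eventually])
      have "norm (?x n \<bullet> (k (?x n) - k l)) \<le> rho * norm (k (?x n) - k l)" for n
        using Cauchy_Schwarz_ineq2[of "?x n" "k (?x n) - k l"] x(2)[of "\<phi> n"]
          mult_right_mono[OF x(2)[of "\<phi> n"] norm_ge_zero[of "k (?x n) - k l"]]
        unfolding real_norm_def by linarith
      then show "\<forall>n. norm (?x n \<bullet> (k (?x n) - k l)) \<le> rho * norm (k (?x n) - k l)" by blast
      have "(\<lambda>n. norm (k (?x n) - k l)) \<longlonglongrightarrow> 0" using kl LIM_zero tendsto_norm_zero by blast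
      then show "(\<lambda>n. rho * norm (k (?x n) - k l)) \<longlonglongrightarrow> 0" by (rule tendsto_mult_right_zero)
    qed
    then have "(\<lambda>n. ?x n \<bullet> (k (?x n) - k l) + ?x n \<bullet> k l) \<longlonglongrightarrow> 0 + l \<bullet> k l" by (intro tendsto_add wi)
    then show ?thesis by (simp add: inner_diff_right)
  qed
  have "(\<lambda>n. ?x n \<bullet> ?x n) \<longlonglongrightarrow> l \<bullet> l"
    unfolding norm_eq[OF hx] norm_eq[OF hl]
    by (intro tendsto_diff tendsto_mult tendsto_add wi xk tendsto_inner kl tendsto_const)
  then have "(\<lambda>n. ?x n \<bullet> ?x n - 2 * (?x n \<bullet> l) + l \<bullet> l) \<longlonglongrightarrow> l \<bullet> l - 2 * (l \<bullet> l) + l \<bullet> l"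
    by (intro tendsto_add tendsto_diff tendsto_mult tendsto_const wi)
  moreover have "(norm (?x n - l))\<^sup>2 = ?x n \<bullet> ?x n - 2 * (?x n \<bullet> l) + l \<bullet> l" for n
    by (simp add: power2_norm_eq_inner inner_diff_left inner_diff_right inner_commute)
  ultimately have "(\<lambda>n. (norm (?x n - l))\<^sup>2) \<longlonglongrightarrow> 0" by simp
  then have "(\<lambda>n. sqrt ((norm (?x n - l))\<^sup>2)) \<longlonglongrightarrow> sqrt 0" by (rule tendsto_real_sqrt)
  then have "(\<lambda>n. ?x n - l) \<longlonglongrightarrow> 0" by (simp add: tendsto_norm_zero_iff)
  then have "?x \<longlonglongrightarrow> l" by (rule LIM_zero_cancel)
  then have "(\<lambda>n. norm (?x n + k (?x n))) \<longlonglongrightarrow> norm (l + k l)" by (intro tendsto_norm tendsto_add kl)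
  then have "norm (l + k l) = r" by (simp add: xr LIMSEQ_const_iff)
  then show thesis using that lB orth by blast
qed

end

section \<open>Critical levels of even functionals\<close>

text \<open>Orthogonality turns the squared norm of the projection into
  \<open>u \<bullet> proj_minus Xm u\<close>. The form becomes a combination of bounded bilinear
  expressions, convenient for differentiation and for weak limits.\<close>

lemma Phi_fun_eq:
  fixes Xm :: "'a::{real_inner, complete_space} set"
  assumes "subspace Xm" "closed Xm"
  shows "Phi_fun Xm Psi u = (1/2) * (u \<bullet> u) - u \<bullet> proj_minus Xm u + Psi u"
proof -
  let ?P = "proj_minus Xm u"
  have "(u - ?P) \<bullet> ?P = 0" using proj_minus_in[OF assms] by (auto simp: orth_compl_def)
  then have "u \<bullet> ?P = ?P \<bullet> ?P" by (simp add: inner_diff_left)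
  then show ?thesis
    unfolding Phi_fun_def proj_plus_def power2_norm_eq_inner
    by (simp add: inner_diff_left inner_diff_right inner_commute[of ?P u] algebra_simps)
qed

lemma Phi_fun_uminus:
  fixes Xm :: "'a::{real_inner, complete_space} set"
  assumes "subspace Xm" "closed Xm" "\<And>u. Psi (- u) = Psi u"
  shows "Phi_fun Xm Psi (- u) = Phi_fun Xm Psi u"
  using linear_neg[OF bounded_linear.linear[OF bounded_linear_proj_minus[OF assms(1,2)]]] assms(3)
  by (simp add: Phi_fun_eq[OF assms(1,2)])

text \<open>Self-adjointness moves the projection onto the direction \<open>w\<close>. For fixed
  \<open>w\<close> the quadratic part is then an inner product with a fixed vector, hence weakly
  continuous in \<open>u\<close>.\<close>

lemma Phi_fun_derivative_eq:
  fixes Xm :: "'a::{real_inner, complete_space} set"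
  assumes Xm: "subspace Xm" "closed Xm"
    and Psi: "\<And>u. (Psi has_derivative blinfun_apply (Psi' u)) (at u)"
    and Phi: "\<And>u. (Phi_fun Xm Psi has_derivative blinfun_apply (Phi' u)) (at u)"
  shows "Phi' u w = u \<bullet> w - 2 * (u \<bullet> proj_minus Xm w) + Psi' u w"
proof -
  note P = bounded_linear.has_derivative[OF bounded_linear_proj_minus[OF Xm] has_derivative_ident]
  have "((\<lambda>u. (1/2) * (u \<bullet> u) - u \<bullet> proj_minus Xm u + Psi u) has_derivative
     (\<lambda>w. (1/2) * (u \<bullet> w + w \<bullet> u) - (u \<bullet> proj_minus Xm w + w \<bullet> proj_minus Xm u) + Psi' u w)) (at u)"
    by (intro has_derivative_add has_derivative_diff has_derivative_mult_right has_derivative_inner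
        has_derivative_ident P Psi)
  then have "(Phi_fun Xm Psi has_derivative
     (\<lambda>w. (1/2) * (u \<bullet> w + w \<bullet> u) - (u \<bullet> proj_minus Xm w + w \<bullet> proj_minus Xm u) + Psi' u w)) (at u)"
    by (simp add: Phi_fun_eq[OF Xm, abs_def])
  from has_derivative_unique[OF Phi this] have
    "Phi' u w = (1/2) * (u \<bullet> w + w \<bullet> u) - (u \<bullet> proj_minus Xm w + w \<bullet> proj_minus Xm u) + Psi' u w"
    by metis
  moreover have "w \<bullet> proj_minus Xm u = u \<bullet> proj_minus Xm w"
    using inner_proj_minus[OF Xm, of w u] by (simp add: inner_commute)
  ultimately show ?thesis by (simp add: inner_commute[of w u])
qed

lemma Phi_fun_derivative_weak:
  fixes Xm :: "'a::{real_inner, complete_space} set"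
  assumes "subspace Xm" "closed Xm"
    and "\<And>u. (Psi has_derivative blinfun_apply (Psi' u)) (at u)"
    and "\<And>x u. weak_conv x u \<Longrightarrow> weak_conv_dual (\<lambda>n. Psi' (x n)) (Psi' u)"
    and "\<And>u. (Phi_fun Xm Psi has_derivative blinfun_apply (Phi' u)) (at u)"
    and x: "weak_conv x u"
  shows "weak_conv_dual (\<lambda>n. Phi' (x n)) (Phi' u)"
proof -
  have "(\<lambda>n. x n \<bullet> w - 2 * (x n \<bullet> proj_minus Xm w) + Psi' (x n) w)
      \<longlonglongrightarrow> u \<bullet> w - 2 * (u \<bullet> proj_minus Xm w) + Psi' u w" for w
    using x assms(4)[OF x] unfolding weak_conv_def weak_conv_dual_def
    by (intro tendsto_add tendsto_diff tendsto_mult tendsto_const) blast+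
  then show ?thesis
    by (simp add: weak_conv_dual_def Phi_fun_derivative_eq[OF assms(1-3,5)])
qed

text \<open>The negative square is not weakly lower semicontinuous in general, but the base points
  lie in the orthogonal complement of \<open>Xm\<close>, so the projection sees only the strongly
  convergent shifts \<open>b\<close>.\<close>

lemma Phi_fun_weak_lsc:
  fixes Xm :: "'a::{real_inner, complete_space} set"
  assumes Xm: "subspace Xm" "closed Xm"
    and Psi_wlsc: "\<And>x u. weak_conv x u \<Longrightarrow> ereal (Psi u) \<le> liminf (\<lambda>n. ereal (Psi (x n)))"
    and x: "\<And>n. x n \<in> orth_compl Xm" "l \<in> orth_compl Xm" "weak_conv x l" and b: "b \<longlonglongrightarrow> b'"
    and le: "\<And>n. Phi_fun Xm Psi (x n + b n) \<le> c"
  shows "Phi_fun Xm Psi (l + b') \<le> c"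
proof -
  let ?P = "proj_minus Xm"
  interpret P: bounded_linear ?P by (rule bounded_linear_proj_minus[OF Xm])
  have P0: "?P u = 0" if "u \<in> orth_compl Xm" for u
    using that subspace_0[OF Xm(1)] by (intro proj_minus_eqI[OF Xm(1)]) auto
  have P_idem: "u \<bullet> ?P v = ?P u \<bullet> ?P v" for u v
  proof -
    have "(u - ?P u) \<bullet> ?P v = 0" using proj_minus_in[OF Xm] by (auto simp: orth_compl_def)
    then show ?thesis by (simp add: inner_diff_left)
  qed
  define y where "y n = x n + b n" for n
  define z where "z = l + b'"
  have yz: "weak_conv y z" unfolding y_def z_def by (rule weak_conv_add[OF x(3) b])
  have Py: "y n \<bullet> ?P (y n) = ?P (b n) \<bullet> ?P (b n)" for n
    unfolding P_idem[of "y n"] by (simp add: y_def P.add P0[OF x(1)])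
  have Pz: "z \<bullet> ?P z = ?P b' \<bullet> ?P b'"
    unfolding P_idem[of z] by (simp add: z_def P.add P0[OF x(2)])
  \<comment> \<open>The square of the norm is replaced by its tangent at \<open>z\<close>, from
    \<open>y n \<bullet> y n \<ge> 2 * (y n \<bullet> z) - z \<bullet> z\<close>. This upper bound
    for \<open>Psi (y n)\<close> is weakly continuous and exact in the limit.\<close>
  define q where "q n = c - y n \<bullet> z + (1/2) * (z \<bullet> z) + ?P (b n) \<bullet> ?P (b n)" for n
  have "Psi (y n) \<le> q n" for n
  proof -
    have "0 \<le> (y n - z) \<bullet> (y n - z)" by simp
    then have "2 * (y n \<bullet> z) - z \<bullet> z \<le> y n \<bullet> y n"
      by (simp add: inner_diff_left inner_diff_right inner_commute)
    then show ?thesis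
      using le[of n] by (simp add: Phi_fun_eq[OF Xm] Py q_def flip: y_def)
  qed
  then have "liminf (\<lambda>n. ereal (Psi (y n))) \<le> liminf (\<lambda>n. ereal (q n))"
    by (intro Liminf_mono always_eventually) simp
  moreover have "q \<longlonglongrightarrow> c - z \<bullet> z + (1/2) * (z \<bullet> z) + ?P b' \<bullet> ?P b'"
  proof -
    have "(\<lambda>n. y n \<bullet> z) \<longlonglongrightarrow> z \<bullet> z" using yz by (simp add: weak_conv_def)
    then show ?thesis
      unfolding q_def
      by (rule tendsto_add[OF tendsto_add[OF tendsto_diff[OF tendsto_const] tendsto_const]
            tendsto_inner[OF P.tendsto[OF b] P.tendsto[OF b]]])
  qed
  then have "liminf (\<lambda>n. ereal (q n)) = ereal (c - z \<bullet> z + (1/2) * (z \<bullet> z) + ?P b' \<bullet> ?P b')"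
    by (intro lim_imp_Liminf) auto
  ultimately have "ereal (Psi z) \<le> ereal (c - z \<bullet> z + (1/2) * (z \<bullet> z) + ?P b' \<bullet> ?P b')"
    using Psi_wlsc[OF yz] order_trans by metis
  then show ?thesis
    unfolding z_def[symmetric] Phi_fun_eq[OF Xm] Pz by simp
qed

lemma in_Xk_minus:
  fixes Xm :: "'a::{real_inner, complete_space} set"
  assumes Xm: "subspace Xm" "closed Xm"
    and orth: "\<And>i j. e i \<bullet> e j = (if i = j then 1 else 0)"
    and e_in: "\<And>i. e i \<in> orth_compl Xm"
    and basis: "closure (span (range e)) = orth_compl Xm"
    and v: "\<And>j. k < j \<Longrightarrow> v \<bullet> e j = 0"
  shows "v \<in> Xk_minus Xm e k"
proof -
  interpret orthonormal_sequence e by standard (rule orth)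
  let ?p = "proj_minus Xm v"
  note p = proj_minus_in[OF Xm, of v]
  define y where "y = (\<Sum>j<Suc k. (v \<bullet> e j) *\<^sub>R e j)"
  have y: "y \<in> span (e ` {..k})" unfolding y_def by (intro span_sum span_scale span_base) auto
  then have "y \<in> closure (span (range e))"
    using span_mono[of "e ` {..k}" "range e"] closure_subset by blast
  then have mem: "v - ?p - y \<in> closure (span (range e))"
    using subspace_diff[OF subspace_orth_compl p(2), of y] unfolding basis by blast
  have orth0: "(v - ?p - y) \<bullet> e j = 0" for j
  proof -
    have "e j \<bullet> ?p = 0" using p(1) e_in[of j] by (auto simp: orth_compl_def)
    then have "?p \<bullet> e j = 0" by (simp add: inner_commute)
    then show ?thesis
      unfolding inner_diff_left y_def inner_partial_sum using v[of j] by auto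
  qed
  have "(v - ?p - y) \<bullet> (v - ?p - y) = 0"
    by (rule closure_span_orthogonal[OF mem]) (use orth0 in blast)
  then have "v = ?p + y" by (simp add: diff_eq_eq add.commute)
  then show ?thesis using p(1) y unfolding Xk_minus_def by blast
qed

text \<open>Condition (B1) supplies two numbers: \<open>L\<close> defines the admissible class and
  forces the linking, and \<beta> bounds the resulting level away from zero. They are real although
  the extrema are taken in the extended reals.\<close>

lemma dual_fountain_level:
  fixes Xm :: "'a::{real_inner, complete_space} set"
    and e :: "nat \<Rightarrow> 'a" and rho r :: real and k :: nat
  assumes separable: "\<exists>D::'a set. countable D \<and> closure D = UNIV"
    and Xm: "subspace Xm" "closed Xm"
    and e_orthonormal: "\<And>i j. e i \<bullet> e j = (if i = j then 1 else 0)"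
    and e_in: "\<And>i. e i \<in> orth_compl Xm"
    and e_basis: "closure (span (range e)) = orth_compl Xm"
    and Psi_deriv: "\<And>u. (Psi has_derivative blinfun_apply (Psi' u)) (at u)"
    and Psi_even: "\<And>u. Psi (- u) = Psi u"
    and Psi_wlsc: "\<And>x u. weak_conv x u \<Longrightarrow> ereal (Psi u) \<le> liminf (\<lambda>n. ereal (Psi (x n)))"
    and Psi'_wcont: "\<And>x u. weak_conv x u \<Longrightarrow> weak_conv_dual (\<lambda>n. Psi' (x n)) (Psi' u)"
    and Phi_deriv: "\<And>u. (Phi_fun Xm Psi has_derivative blinfun_apply (Phi' u)) (at u)"
    and radii: "0 < r" "r < rho"
    and B1a: "max 0 (Sup ((\<lambda>u. ereal (Phi_fun Xm Psi u)) ` {u. norm u \<le> r}))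
        < Inf ((\<lambda>u. ereal (Phi_fun Xm Psi u)) ` {u \<in> Xk_plus e k. norm u = rho})"
    and B1b: "Sup ((\<lambda>u. ereal (Phi_fun Xm Psi u)) ` {u \<in> Xk_minus Xm e k. norm u = r}) < 0"
  obtains c where "Inf ((\<lambda>u. ereal (Phi_fun Xm Psi u)) ` {u \<in> Xk_plus e k. norm u \<le> rho}) \<le> ereal c"
    "c < 0" "\<And>\<delta>. 0 < \<delta> \<Longrightarrow> \<exists>u. \<bar>Phi_fun Xm Psi u - c\<bar> \<le> \<delta> \<and> (1 + norm u) * norm (Phi' u) \<le> \<delta>"
proof -
  let ?Phi = "Phi_fun Xm Psi"
  \<comment> \<open>The vector \<open>f 0 = e k\<close> is shared by X_k^+ and X_k^-; orthogonality
    to all \<open>f (Suc i)\<close> is what places a vector in X_k^-.\<close>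
  define f where "f j = e (k + j)" for j
  interpret orthonormal_sequence f by standard (simp add: f_def e_orthonormal)
  have "e ` {k..} = range f"
  proof -
    have "{k..} = range ((+) k)" by (auto simp: image_iff le_iff_add)
    then show ?thesis by (auto simp: f_def)
  qed
  then have plus: "Xk_plus e k = closure (span (range f))" by (simp add: Xk_plus_def)
  have "closure (span (range f)) \<subseteq> closure (span (range e))"
    by (intro closure_mono span_mono) (auto simp: f_def)
  then have plus_orth: "u \<in> orth_compl Xm" if "u \<in> Xk_plus e k" for u
    using that e_basis plus by blast
  define B where "B = {u \<in> Xk_plus e k. norm u \<le> rho}"
  define E where "E = {u \<in> Xk_plus e k. norm u = rho}"
  \<comment> \<open>Values at least L occur only outside the ball of radius r, so the constraint on
    \<open>E\<close> becomes the boundary hypothesis of \<open>linking\<close>; the zero map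
    satisfies it because the infimum over \<open>E\<close> exceeds L.\<close>
  obtain L where L: "max 0 (Sup ((\<lambda>u. ereal (?Phi u)) ` {u. norm u \<le> r})) < ereal L"
    "ereal L < Inf ((\<lambda>u. ereal (?Phi u)) ` E)"
    using ereal_dense2[OF B1a] unfolding E_def by blast
  have below: "?Phi u < L" if "norm u \<le> r" for u
  proof -
    have "ereal (?Phi u) \<le> Sup ((\<lambda>u. ereal (?Phi u)) ` {u. norm u \<le> r})"
      using that by (intro Sup_upper) auto
    then have "ereal (?Phi u) < ereal L" using L(1) by (meson le_less_trans max_less_iff_conj)
    then show ?thesis by simp
  qed
  have above: "L \<le> ?Phi u" if "u \<in> E" for u
  proof -
    have "ereal L \<le> ereal (?Phi u)" using L(2) Inf_lower[OF imageI[OF that]] by (meson less_imp_le order_trans)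
    then show ?thesis by simp
  qed
  obtain \<beta> where \<beta>: "Sup ((\<lambda>u. ereal (?Phi u)) ` {u \<in> Xk_minus Xm e k. norm u = r}) < ereal \<beta>" "ereal \<beta> < 0"
    using ereal_dense2[OF B1b] by blast
  have minus: "?Phi u \<le> \<beta>" if "u \<in> Xk_minus Xm e k" "norm u = r" for u
  proof -
    have "ereal (?Phi u) \<le> Sup ((\<lambda>u. ereal (?Phi u)) ` {u \<in> Xk_minus Xm e k. norm u = r})"
      using that by (intro Sup_upper) auto
    then have "ereal (?Phi u) < ereal \<beta>" using \<beta>(1) by (rule le_less_trans)
    then show ?thesis by simp
  qed
  have B0: "0 \<in> B" using radii closure_subset span_zero by (fastforce simp: B_def plus)
  interpret weak_minimax ?Phi Phi' B E L rho
  proof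
    show "(?Phi has_derivative blinfun_apply (Phi' u)) (at u)" for u by (rule Phi_deriv)
    show "?Phi (- u) = ?Phi u" for u using Phi_fun_uminus[OF Xm, of Psi] Psi_even by blast
    show "weak_conv_dual (\<lambda>n. Phi' (x n)) (Phi' u)" if "weak_conv x u" for x u
      by (rule Phi_fun_derivative_weak[OF Xm Psi_deriv Psi'_wcont Phi_deriv that])
    show "norm u \<le> rho" if "u \<in> B" for u using that by (simp add: B_def)
    show "B \<noteq> {}" using B0 by blast
    show "E \<subseteq> B" by (auto simp: E_def B_def)
    show "\<exists>l\<in>B. \<exists>r::nat \<Rightarrow> nat. strict_mono r \<and> weak_conv (\<lambda>n. x (r n)) l"
      if "\<And>n. x n \<in> B" for x :: "nat \<Rightarrow> 'a"
      using weakly_compact_ball[of x rho] that unfolding B_def plus by blast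
    show "?Phi (l + b') \<le> c" if "\<And>n. x n \<in> B" "l \<in> B" "weak_conv x l" "b \<longlonglongrightarrow> b'"
      "\<And>n. ?Phi (x n + b n) \<le> c" for x l b b' c
      by (rule Phi_fun_weak_lsc[OF Xm Psi_wlsc _ _ that(3-5)]) (use that plus_orth in \<open>auto simp: B_def\<close>)
  qed
  have zero: "0 \<in> admissible"
    using above by (simp add: admissible_def weak_strong_def)
  have "\<exists>u\<in>B. ?Phi (u + \<kappa> u) \<le> \<beta>" if \<kappa>: "\<kappa> \<in> admissible" for \<kappa>
  proof -
    obtain u where u: "u \<in> B" "norm (u + \<kappa> u) = r" "\<And>i. (u + \<kappa> u) \<bullet> f (Suc i) = 0"
    proof (rule linking[of r rho \<kappa>, folded plus, folded B_def])
      show "0 < r" "0 < rho" using radii by auto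
      show "continuous_on UNIV \<kappa>" by simp
      show "\<kappa> (- u) = - \<kappa> u" for u using \<kappa> by (simp add: admissible_def)
      show "(\<lambda>n. \<kappa> (x n)) \<longlonglongrightarrow> \<kappa> l" if "\<And>n. x n \<in> B" "l \<in> B" "weak_conv x l" for x l
        by (rule weak_graph(1)[OF \<kappa> that])
      show "r < norm (u + \<kappa> u)" if "u \<in> B" "norm u = rho" for u
      proof -
        have "u \<in> E" using that by (simp add: E_def B_def)
        then have "L \<le> ?Phi (u + \<kappa> u)" using \<kappa> by (simp add: admissible_def)
        then show ?thesis using below[of "u + \<kappa> u"] by linarith
      qed
    qed blast
    have "u + \<kappa> u \<in> Xk_minus Xm e k"
    proof (rule in_Xk_minus[OF Xm e_orthonormal e_in e_basis])
      fix j assume "k < j"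
      then obtain i where "j = k + Suc i" using less_imp_Suc_add by auto
      then show "(u + \<kappa> u) \<bullet> e j = 0" using u(3)[of i] by (simp add: f_def)
    qed
    then show ?thesis using minus u(1,2) by blast
  qed
  from almost_critical[OF separable zero this] obtain c where c: "c \<le> \<beta>" "lowest 0 \<le> c"
    "\<And>\<delta>. 0 < \<delta> \<Longrightarrow> \<exists>u. \<bar>?Phi u - c\<bar> \<le> \<delta> \<and> (1 + norm u) * norm (Phi' u) \<le> \<delta>" by blast
  \<comment> \<open>The left side is an extended infimum and the right side a real one, hence the
    cases; plus infinity is excluded by the point 0 of \<open>B\<close>.\<close>
  have "Inf ((\<lambda>u. ereal (?Phi u)) ` B) \<le> ereal (lowest 0)"
  proof (cases "Inf ((\<lambda>u. ereal (?Phi u)) ` B)")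
    case (real a)
    have "a \<le> ?Phi u" if "u \<in> B" for u
      using Inf_lower[OF imageI[OF that], of "\<lambda>u. ereal (?Phi u)"] real by simp
    then have "a \<le> lowest 0" by (intro le_lowest) simp
    then show ?thesis using real by simp
  next
    case PInf
    have "Inf ((\<lambda>u. ereal (?Phi u)) ` B) \<le> ereal (?Phi 0)" by (rule Inf_lower[OF imageI[OF B0]])
    then show ?thesis using PInf by simp
  qed simp
  then have "Inf ((\<lambda>u. ereal (?Phi u)) ` B) \<le> ereal c" using c(2) by (meson ereal_less_eq(3) order_trans)
  moreover have "c < 0" using c(1) \<beta>(2) by simp
  ultimately show thesis using that c(3) unfolding B_def by blast
qed

theorem theorem2p4:
  fixes Xm :: "'a::{real_inner, complete_space} set"
    and e :: "nat \<Rightarrow> 'a"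
    and Psi :: "'a \<Rightarrow> real"
    and Psi' :: "'a \<Rightarrow> ('a \<Rightarrow>\<^sub>L real)"
    and Phi' :: "'a \<Rightarrow> ('a \<Rightarrow>\<^sub>L real)"
    and k0 :: nat
    and rho r :: "nat \<Rightarrow> real"
  defines "Phi \<equiv> Phi_fun Xm Psi"
    and "d \<equiv> (\<lambda>k. Inf ((\<lambda>u. ereal (Phi_fun Xm Psi u)) ` {u \<in> Xk_plus e k. norm u \<le> rho k}))"
  assumes separable: "\<exists>D::'a set. countable D \<and> closure D = UNIV"
    and Xm_subspace: "subspace Xm" and Xm_closed: "closed Xm"
    and e_orthonormal: "\<And>i j. e i \<bullet> e j = (if i = j then 1 else 0)"
    and e_in: "\<And>i. e i \<in> orth_compl Xm"
    and e_basis: "closure (span (range e)) = orth_compl Xm"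
    and Psi_deriv: "\<And>u. (Psi has_derivative blinfun_apply (Psi' u)) (at u)"
    and Psi'_cont: "continuous_on UNIV Psi'"
    and Psi_even: "\<And>u. Psi (- u) = Psi u"
    and Psi_bdd_below: "\<exists>m. \<forall>u. m \<le> Psi u"
    and Psi_wlsc: "\<And>x u. weak_conv x u \<Longrightarrow> ereal (Psi u) \<le> liminf (\<lambda>n. ereal (Psi (x n)))"
    and Psi'_wcont: "\<And>x u. weak_conv x u \<Longrightarrow> weak_conv_dual (\<lambda>n. Psi' (x n)) (Psi' u)"
    and Phi_deriv: "\<And>u. (Phi has_derivative blinfun_apply (Phi' u)) (at u)"
    and radii: "\<And>k. k \<ge> k0 \<Longrightarrow> 0 < r k \<and> r k < rho k"
    and B1a: "\<And>k. k \<ge> k0 \<Longrightarrow>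
        Inf ((\<lambda>u. ereal (Phi u)) ` {u \<in> Xk_plus e k. norm u = rho k})
        > max 0 (Sup ((\<lambda>u. ereal (Phi u)) ` {u. norm u \<le> r k}))"
    and B1b: "\<And>k. k \<ge> k0 \<Longrightarrow>
        Sup ((\<lambda>u. ereal (Phi u)) ` {u \<in> Xk_minus Xm e k. norm u = r k}) < 0"
    and B2: "d \<longlonglongrightarrow> 0"
  shows "(\<forall>k\<ge>k0. \<exists>c::real. d k \<le> ereal c \<and> c < 0 \<and>
            (\<exists>u::nat \<Rightarrow> 'a. ((\<lambda>n. Phi (u n)) \<longlonglongrightarrow> c) \<and>
                ((\<lambda>n. (1 + norm (u n)) *\<^sub>R Phi' (u n)) \<longlonglongrightarrow> 0)))
       \<and> ((\<forall>c::real. d k0 \<le> ereal c \<and> c < 0 \<longrightarrow> cerami Phi Phi' c) \<longrightarrow>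
            (\<exists>u::nat \<Rightarrow> 'a. (\<forall>k. Phi' (u k) = 0) \<and>
                filterlim (\<lambda>k. Phi (u k)) (at_left 0) sequentially))"
proof -
  have level: "\<exists>c. d k \<le> ereal c \<and> c < 0 \<and>
      (\<exists>u::nat \<Rightarrow> 'a. ((\<lambda>n. Phi (u n)) \<longlonglongrightarrow> c) \<and> ((\<lambda>n. (1 + norm (u n)) *\<^sub>R Phi' (u n)) \<longlonglongrightarrow> 0))"
    if k: "k0 \<le> k" for k
  proof -
    obtain c where c: "d k \<le> ereal c" "c < 0"
      and ps: "\<And>\<delta>. 0 < \<delta> \<Longrightarrow> \<exists>u. \<bar>Phi u - c\<bar> \<le> \<delta> \<and> (1 + norm u) * norm (Phi' u) \<le> \<delta>"
      using dual_fountain_level[OF separable Xm_subspace Xm_closed e_orthonormal e_in e_basis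
          Psi_deriv Psi_even Psi_wlsc Psi'_wcont Phi_deriv[unfolded Phi_def]
          radii[THEN conjunct1, OF k] radii[THEN conjunct2, OF k]
          B1a[unfolded Phi_def, OF k] B1b[unfolded Phi_def, OF k]]
      unfolding Phi_def d_def by blast
    have "\<exists>u. \<bar>Phi u - c\<bar> \<le> 1 / real (Suc n) \<and> (1 + norm u) * norm (Phi' u) \<le> 1 / real (Suc n)" for n
      by (rule ps) simp
    then obtain u where u: "\<And>n. \<bar>Phi (u n) - c\<bar> \<le> 1 / real (Suc n)"
      "\<And>n. (1 + norm (u n)) * norm (Phi' (u n)) \<le> 1 / real (Suc n)" by metis
    have null: "(\<lambda>n. 1 / real (Suc n)) \<longlonglongrightarrow> 0" by (rule LIMSEQ_Suc[OF lim_1_over_n])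
    have "(\<lambda>n. Phi (u n) - c) \<longlonglongrightarrow> 0"
      by (rule Lim_null_comparison[OF always_eventually null]) (use u(1) in simp)
    then have "(\<lambda>n. Phi (u n)) \<longlonglongrightarrow> c" by (rule LIM_zero_cancel)
    moreover have "(\<lambda>n. (1 + norm (u n)) *\<^sub>R Phi' (u n)) \<longlonglongrightarrow> 0"
      by (rule Lim_null_comparison[OF always_eventually null]) (use u(2) in simp)
    ultimately show ?thesis using c by blast
  qed
  have critical: "\<exists>w. Phi w = c \<and> Phi' w = 0"
    if cer: "cerami Phi Phi' c" and u: "(\<lambda>n. Phi (u n)) \<longlonglongrightarrow> c" "(\<lambda>n. (1 + norm (u n)) *\<^sub>R Phi' (u n)) \<longlonglongrightarrow> 0"
    for c and u :: "nat \<Rightarrow> 'a"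
  proof -
    obtain s where s: "strict_mono (s :: nat \<Rightarrow> nat)" "convergent (u \<circ> s)"
      using cer u unfolding cerami_def by blast
    then obtain w where w: "(\<lambda>n. u (s n)) \<longlonglongrightarrow> w" by (auto simp: convergent_def o_def)
    have "isCont Phi w" using Phi_deriv has_derivative_continuous by blast
    then have "(\<lambda>n. Phi (u (s n))) \<longlonglongrightarrow> Phi w" using w by (rule isCont_tendsto_compose)
    moreover have "(\<lambda>n. Phi (u (s n))) \<longlonglongrightarrow> c"
      using LIMSEQ_subseq_LIMSEQ[OF u(1) s(1)] by (simp add: o_def)
    ultimately have "Phi w = c" by (rule LIMSEQ_unique)
    moreover have "Phi' w = 0"
    proof (rule blinfun_eqI)
      fix h
      \<comment> \<open>Testing against a fixed \<open>h\<close> is enough: the values converge to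
        \<open>Phi' w h\<close> by weak continuity, and to 0 because the Cerami weight is at least
        1.\<close>
      have "weak_conv_dual (\<lambda>n. Phi' (u (s n))) (Phi' w)"
        by (rule Phi_fun_derivative_weak[OF Xm_subspace Xm_closed Psi_deriv Psi'_wcont
              Phi_deriv[unfolded Phi_def] weak_conv_if_tendsto[OF w]])
      then have "(\<lambda>n. Phi' (u (s n)) h) \<longlonglongrightarrow> Phi' w h" by (simp add: weak_conv_dual_def)
      moreover have "(\<lambda>n. Phi' (u (s n)) h) \<longlonglongrightarrow> 0"
      proof (rule Lim_null_comparison[OF always_eventually])
        have "norm (Phi' (u (s n)) h) \<le> norm ((1 + norm (u (s n))) *\<^sub>R Phi' (u (s n))) * norm h" for n
        proof -
          have "norm (Phi' (u (s n)) h) \<le> 1 * norm (Phi' (u (s n))) * norm h"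
            using norm_blinfun[of "Phi' (u (s n))" h] by simp
          also have "\<dots> \<le> (1 + norm (u (s n))) * norm (Phi' (u (s n))) * norm h"
            by (intro mult_right_mono) auto
          finally show ?thesis by simp
        qed
        then show "\<forall>n. norm (Phi' (u (s n)) h) \<le> norm ((1 + norm (u (s n))) *\<^sub>R Phi' (u (s n))) * norm h"
          by blast
        have "(\<lambda>n. norm ((1 + norm (u (s n))) *\<^sub>R Phi' (u (s n)))) \<longlonglongrightarrow> 0"
          using tendsto_norm_zero[OF LIMSEQ_subseq_LIMSEQ[OF u(2) s(1)]] by (simp add: o_def)
        then show "(\<lambda>n. norm ((1 + norm (u (s n))) *\<^sub>R Phi' (u (s n))) * norm h) \<longlonglongrightarrow> 0"
          by (rule tendsto_mult_left_zero)
      qed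
      ultimately show "Phi' w h = blinfun_apply 0 h" by (simp add: LIMSEQ_unique)
    qed
    ultimately show ?thesis by blast
  qed
  have "\<exists>u::nat \<Rightarrow> 'a. (\<forall>k. Phi' (u k) = 0) \<and> filterlim (\<lambda>k. Phi (u k)) (at_left 0) sequentially"
    if ce: "\<forall>c::real. d k0 \<le> ereal c \<and> c < 0 \<longrightarrow> cerami Phi Phi' c"
  proof -
    obtain c0 where "d k0 \<le> ereal c0" "c0 < 0" using level[of k0] by blast
    \<comment> \<open>Since \<open>d\<close> tends to 0, strict negativity gives
      \<open>d k0 < d k\<close> for large k, so the levels found there fall into the range where the
      Cerami condition is assumed.\<close>
    then have "d k0 < 0" by (metis ereal_less(3) le_less_trans zero_ereal_def less_ereal.simps(1))
    then have "\<forall>\<^sub>F k in sequentially. d k0 < d k" by (rule order_tendstoD(1)[OF B2])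
    then obtain K where K: "\<And>k. K \<le> k \<Longrightarrow> d k0 < d k" unfolding eventually_sequentially by blast
    have "\<exists>w. d (k + max K k0) \<le> ereal (Phi w) \<and> Phi w < 0 \<and> Phi' w = 0" for k
    proof -
      let ?k = "k + max K k0"
      obtain c u where c: "d ?k \<le> ereal c" "c < 0" and u: "(\<lambda>n. Phi (u n)) \<longlonglongrightarrow> c"
        "(\<lambda>n. (1 + norm (u n)) *\<^sub>R Phi' (u n)) \<longlonglongrightarrow> 0"
      proof -
        have "k0 \<le> ?k" by simp
        from level[OF this] show thesis using that by blast
      qed
      have "d k0 \<le> ereal c" using K[of ?k] c(1) by (meson less_imp_le max.cobounded1 order_trans trans_le_add2)
      then have "cerami Phi Phi' c" using ce c(2) by blast
      then show ?thesis using critical[OF _ u] c by blast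
    qed
    then obtain w where w: "\<And>k. d (k + max K k0) \<le> ereal (Phi (w k))" "\<And>k. Phi (w k) < 0" "\<And>k. Phi' (w k) = 0"
      by metis
    have "(\<lambda>k. d (k + max K k0)) \<longlonglongrightarrow> 0" by (rule LIMSEQ_ignore_initial_segment[OF B2])
    \<comment> \<open>The critical values are squeezed between \<open>d\<close> and 0; being
      strictly negative, they approach 0 from the left.\<close>
    then have "(\<lambda>k. ereal (Phi (w k))) \<longlonglongrightarrow> 0"
      by (rule tendsto_sandwich[OF _ _ _ tendsto_const, rotated 2])
         (use w in \<open>auto intro!: always_eventually less_imp_le\<close>)
    then have "(\<lambda>k. Phi (w k)) \<longlonglongrightarrow> 0" by (simp add: zero_ereal_def)
    then have "filterlim (\<lambda>k. Phi (w k)) (at_left 0) sequentially"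
      by (rule tendsto_imp_filterlim_at_left) (use w(2) in simp)
    then show ?thesis using w(3) by blast
  qed
  then show ?thesis using level by blast
qed

end
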